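(* For integers $n,k,g\ge 1$ and every positive integer $q$, we have $$\frac{1}{n!}\sum_{u_1,\dots,u_k\in S_n} q^{\kappa(u_1^2u_2^2\cdots u_k^2)} = \sum_{\lambda\vdash n} H_\lambda^{k-2}\prod_{t\in\lambda}(q+c(t))$$ and $$\frac{1}{n!}\sum_{u_1,v_1,\dots,u_g,v_g\in S_n} q^{\kappa([u_1,v_1]\cdots[u_g,v_g])} = \sum_{\lambda\vdash n} H_\lambda^{2g-2}\prod_{t\in\lambda}(q+c(t)).$$
   Context: $S_n$ is the symmetric group on an $n$-element set. For $w\in S_n$, $\kappa(w)$ is the number of cycles of $w$ (fixed points counted as cycles). For a partition $\lambda\vdash n$, $H_\lambda$ is the product of the hook lengths of the Young diagram of $\lambda$; the product over $t\in\lambda$ is over the cells of the Young diagram, and $c(t)$ is the content of the cell $t$, i.e. $c(t)=j-i$ for the cell in row $i$ and column $j$. The commutator is $[u,v]=uvu^{-1}v^{-1}$. *)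

theory Defs
  imports Complex_Main "HOL-Library.FuncSet" "HOL-Combinatorics.Combinatorics"
begin

definition Sym :: "nat \<Rightarrow> (nat \<Rightarrow> nat) set" where
  "Sym n = {p. p permutes {1..n}}"

text \<open>For a permutation of a finite set, \<^term>\<open>orbit w x\<close> contains \<^term>\<open>x\<close>; in particular
  fixed points give singleton orbits and are counted.\<close>

definition num_cycles :: "nat \<Rightarrow> (nat \<Rightarrow> nat) \<Rightarrow> nat" where
  "num_cycles n w = card (orbit w ` {1..n})"

definition commutator :: "('a \<Rightarrow> 'a) \<Rightarrow> ('a \<Rightarrow> 'a) \<Rightarrow> 'a \<Rightarrow> 'a" where
  "commutator u v = u \<circ> v \<circ> inv u \<circ> inv v"

text \<open>The product of \<open>f 1, f 2, \<dots>, f k\<close> in this order.\<close>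

definition comp_prod :: "(nat \<Rightarrow> 'a \<Rightarrow> 'a) \<Rightarrow> nat \<Rightarrow> 'a \<Rightarrow> 'a" where
  "comp_prod f k = foldr (\<circ>) (map f [1..<Suc k]) id"

text \<open>An integer partition is the weakly decreasing list of its positive parts.\<close>

definition partitions :: "nat \<Rightarrow> nat list set" where
  "partitions n = {\<mu>. sorted_wrt (\<ge>) \<mu> \<and> (\<forall>x\<in>set \<mu>. 0 < x) \<and> sum_list \<mu> = n}"

text \<open>Cells are (row, column) pairs, both counted from 0. Neither contents nor hook lengths depend
  on whether counting starts at 0 or 1.\<close>

definition young_diagram :: "nat list \<Rightarrow> (nat \<times> nat) set" where
  "young_diagram \<mu> = {(i, j). i < length \<mu> \<and> j < \<mu> ! i}"

definition content :: "nat \<times> nat \<Rightarrow> int" where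
  "content t = int (snd t) - int (fst t)"

definition hook :: "nat list \<Rightarrow> nat \<times> nat \<Rightarrow> (nat \<times> nat) set" where
  "hook \<mu> t = {s \<in> young_diagram \<mu>.
     fst s = fst t \<and> snd t \<le> snd s \<or> snd s = snd t \<and> fst t \<le> fst s}"

definition hook_product :: "nat list \<Rightarrow> nat" where
  "hook_product \<mu> = (\<Prod>t\<in>young_diagram \<mu>. card (hook \<mu> t))"

lemma finite_partitions: "finite (partitions n)"
proof (rule finite_subset)
  have "length xs \<le> sum_list xs" if "\<forall>x\<in>set xs. 0 < x" for xs :: "nat list"
    using that by (induction xs) auto
  then show "partitions n \<subseteq> {xs. set xs \<subseteq> {..n} \<and> length xs \<le> n}"
    using member_le_sum_list by (fastforce simp: partitions_def)
  show "finite {xs. set xs \<subseteq> {..n} \<and> length xs \<le> n}"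
    by (rule finite_lists_length_le) simp
qed

lemma finite_young_diagram: "finite (young_diagram \<mu>)"
proof -
  have "young_diagram \<mu> = (SIGMA i:{..<length \<mu>}. {..<\<mu> ! i})"
    by (auto simp: young_diagram_def)
  then show ?thesis by simp
qed

end

theory Submission
  imports "HOL-Library.Poly_Mapping" "HOL-Computational_Algebra.Polynomial" Defs
begin

text \<open>
  Both sums are traces in the real group algebra of the symmetric group: with
  \<open>\<Theta> = \<Sum> g\<^sup>2\<close>, \<open>K = \<Sum> [g, h]\<close> and \<open>F = \<Sum> q\<^bsup>\<kappa>(w)\<^esup> w\<close>, they are the inner products of \<open>\<Theta>\<^sup>k\<close>
  and \<open>K\<^sup>g\<close> with \<open>F\<close>. All three elements are diagonalised by idempotents \<open>e\<^sub>T\<close> indexed by standard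
  tableaux, following Okounkov and Vershik.

  The \<open>e\<^sub>T\<close> are built one box at a time as Lagrange polynomials in the Jucys--Murphy elements.
  The degenerate Hecke relation determines by induction all moments of the next Jucys--Murphy
  element over \<open>e\<^sub>T\<close>. The resulting transition weights are quotients of hook products, so that
  \<open>e\<^sub>T\<close> has trace \<open>1 / H\<^sub>\<lambda>\<close>, and positivity of the trace form turns vanishing moments into the
  relations that make the \<open>e\<^sub>T\<close> orthogonal idempotents. Intertwiners show that \<open>e\<^sub>S\<close> and \<open>e\<^sub>T\<close> are linked by group
  algebra elements whenever \<open>S\<close> and \<open>T\<close> have the same shape. Since the squares of the numbers of tableaux
  of the shapes of size \<open>n\<close> add up to \<open>n!\<close>, this yields an orthonormal basis \<open>x\<^sub>S\<^sub>T\<close> of the group algebra.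
  Rewriting \<open>\<Theta>\<close> and \<open>K\<close> in this basis leaves only the diagonal terms, whence \<open>\<Theta> = \<Sum> H\<^sub>\<lambda> e\<^sub>T\<close> and
  \<open>K = \<Sum> H\<^sub>\<lambda>\<^sup>2 e\<^sub>T\<close>. Finally \<open>F\<close> is the product of the \<open>q + J\<^sub>i\<close>, which acts on \<open>e\<^sub>T\<close>
  as the product of the \<open>q + c(t)\<close>, and the hook length formula counts the tableaux.
\<close>

section \<open>Interpolation identities and hook products\<close>

text \<open>Neither modules nor characters occur. Their work is done by the coefficient at the
  identity, a positive trace over the reals; completeness comes from a count of tableaux rather than
  from semisimplicity. The transition weights form Kerov's transition measure of a diagram: a
  probability measure on the addable contents with mean 0. The heart of the proof is
  \<open>tab_idem_moment\<close>: cutting e_T p(J) down to the smaller symmetric group leaves e_T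
  times the expectation of p. Both sides obey the same recursion. When a box of content c is added,
  the new measure integrates ((x - c)^2 - 1) u as the old one integrates (x - c)^2 u, and the
  relation between neighbouring Jucys--Murphy elements does the same to the cut-down products.
  Modulo (x - c)^2 - 1 only linear polynomials remain, and these see no more than mass and mean. The
  exponents in the theorem arise as follows: the trace 1/H of an idempotent and the number n!/H of
  tableaux of a shape give the -2, while each square contributes a factor H and each commutator a
  factor H^2.\<close>

definition monic_roots :: "('i \<Rightarrow> real) \<Rightarrow> 'i set \<Rightarrow> real poly" where
  "monic_roots t I = (\<Prod>j\<in>I. [:- t j, 1:])"

lemma poly_monic_roots: "poly (monic_roots t I) x = (\<Prod>j\<in>I. x - t j)"
  by (simp add: monic_roots_def poly_prod)

lemma degree_monic_roots: "degree (monic_roots t I) = card I"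
proof -
  have "degree (monic_roots t I) = (\<Sum>j\<in>I. degree [:- t j, 1:])"
    unfolding monic_roots_def by (rule degree_prod_eq_sum_degree) auto
  then show ?thesis by simp
qed

text \<open>Up to sign these are the first elementary symmetric functions of the roots. Newton's
  identity rewrites the third, so that only power sums enter
  \<open>sum_removal_weights\<close>.\<close>

lemma coeff_monic_roots:
  assumes "finite I"
  shows "coeff (monic_roots t I) (card I) = 1"
    and "card I = Suc m \<Longrightarrow> coeff (monic_roots t I) m = - sum t I"
    and "card I = Suc (Suc k) \<Longrightarrow>
      coeff (monic_roots t I) k = ((sum t I)\<^sup>2 - (\<Sum>i\<in>I. (t i)\<^sup>2)) / 2"
  using assms
proof (induction I arbitrary: m k rule: finite_induct)
  case (insert x F)
  have [simp]: "coeff (monic_roots t (insert x F)) (Suc n)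
      = coeff (monic_roots t F) n - t x * coeff (monic_roots t F) (Suc n)" for n
    using insert.hyps by (simp add: monic_roots_def)
  have [simp]: "coeff (monic_roots t (insert x F)) 0 = - t x * coeff (monic_roots t F) 0"
    using insert.hyps by (simp add: monic_roots_def)
  have high: "coeff (monic_roots t F) (Suc (card F)) = 0"
    by (rule coeff_eq_0) (simp add: degree_monic_roots)
  have top: "coeff (monic_roots t F) (card F) = 1"
    by (rule insert.IH)
  { case 1 show ?case using insert.hyps by (simp add: high top) }
  { case 2 
    then have cF: "card F = m" using insert.hyps by simp
    show ?case
    proof (cases m)
      case 0
      then have "F = {}" using cF insert.hyps by simp
      then show ?thesis using 0 by (simp add: monic_roots_def)
    next
      case (Suc l)
      then show ?thesis
        using insert.hyps insert.IH(2)[of l] top cF by auto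
    qed }
  { case (3 k)
    then have cF: "card F = Suc k" using insert.hyps by simp
    have "\<exists>y. F = {y}" if "k = 0"
      using cF that card_1_singletonE by (metis One_nat_def)
    then show ?case
      using insert.hyps insert.IH(2)[of k] insert.IH(3)[of "k - 1"] cF
      by (cases k) (auto simp: power2_eq_square field_simps) }
qed (auto simp: monic_roots_def)

text \<open>A polynomial of degree at most \<open>m\<close> is its own Lagrange interpolant at
  \<open>m + 1\<close> nodes; the sum collects the coefficients of x^m.\<close>

lemma lagrange_leading_coeff:
  fixes t :: "'i \<Rightarrow> real"
  assumes "finite I" "inj_on t I" "card I = Suc m" "degree Q \<le> m"
  shows "(\<Sum>i\<in>I. poly Q (t i) / (\<Prod>j\<in>I-{i}. t i - t j)) = coeff Q m"
proof -
  define B where "B i = monic_roots t (I - {i})" for i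
  define c where "c i = poly Q (t i) / (\<Prod>j\<in>I-{i}. t i - t j)" for i
  define R where "R = (\<Sum>i\<in>I. smult (c i) (B i))"
  have card: "card (I - {i}) = m" if "i \<in> I" for i
    using assms that by simp
  have degB: "degree (B i) = m" if "i \<in> I" for i
    using card[OF that] by (simp add: B_def degree_monic_roots)
  have "poly R (t i) = poly Q (t i)" if "i \<in> I" for i
  proof -
    have "poly (B j) (t i) = (if j = i then (\<Prod>j\<in>I-{i}. t i - t j) else 0)" if "j \<in> I" for j
      using \<open>i \<in> I\<close> assms(1) that by (auto simp: B_def poly_monic_roots)
    then have "poly R (t i) = (\<Sum>j\<in>I. c j * (if j = i then (\<Prod>j\<in>I-{i}. t i - t j) else 0))"
      by (simp add: R_def poly_sum)
    also have "\<dots> = (\<Sum>j\<in>I. if j = i then c i * (\<Prod>j\<in>I-{i}. t i - t j) else 0)"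
      by (intro sum.cong) auto
    also have "\<dots> = c i * (\<Prod>j\<in>I-{i}. t i - t j)"
      using that assms(1) by (simp add: sum.delta)
    also have "(\<Prod>j\<in>I-{i}. t i - t j) \<noteq> 0"
      using assms(1,2) that by (auto simp: inj_on_def)
    then have "c i * (\<Prod>j\<in>I-{i}. t i - t j) = poly Q (t i)"
      by (simp add: c_def)
    finally show ?thesis .
  qed
  moreover have "degree R \<le> m"
    unfolding R_def using degB assms(1)
    by (intro degree_sum_le) (auto intro: order_trans[OF degree_smult_le])
  moreover have "card (t ` I) = Suc m"
    using assms by (simp add: card_image)
  ultimately have "R = Q"
    using assms(4) by (intro poly_eqI_degree[of "t ` I"]) auto
  then have "coeff Q m = (\<Sum>i\<in>I. c i * coeff (B i) m)"
    by (auto simp: R_def coeff_sum)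
  also have "\<dots> = (\<Sum>i\<in>I. c i)"
  proof (rule sum.cong)
    fix i assume "i \<in> I"
    then show "c i * coeff (B i) m = c i"
      using coeff_monic_roots(1)[of "I - {i}" t] assms(1) card by (simp add: B_def)
  qed simp
  finally show ?thesis by (simp add: c_def)
qed

text \<open>Subtracting a multiple of the node polynomial lowers the degree and keeps the values at
  the nodes, which reduces the claim to \<open>lagrange_leading_coeff\<close>.\<close>

lemma lagrange_second_coeff:
  fixes t :: "'i \<Rightarrow> real"
  assumes "finite I" "inj_on t I" "card I = Suc m" "degree Q \<le> Suc m"
  shows "(\<Sum>i\<in>I. poly Q (t i) / (\<Prod>j\<in>I-{i}. t i - t j)) = coeff Q m + coeff Q (Suc m) * sum t I"
proof -
  define D where "D = monic_roots t I"
  define R where "R = Q - smult (coeff Q (Suc m)) D"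
  have D: "coeff D (Suc m) = 1" "coeff D m = - sum t I" "degree D = Suc m"
    using coeff_monic_roots(1,2)[OF assms(1), where t=t] assms(3) by (auto simp: D_def degree_monic_roots)
  have "degree R \<le> m"
  proof (rule degree_le, intro allI impI)
    fix i assume "m < i"
    then show "coeff R i = 0"
      using D assms(4) by (cases "i = Suc m") (auto simp: R_def coeff_eq_0)
  qed
  then have "(\<Sum>i\<in>I. poly R (t i) / (\<Prod>j\<in>I-{i}. t i - t j)) = coeff R m"
    using assms by (intro lagrange_leading_coeff) auto
  moreover have "poly R (t i) = poly Q (t i)" if "i \<in> I" for i
    using that assms(1) by (auto simp: R_def D_def poly_monic_roots)
  ultimately have "(\<Sum>i\<in>I. poly Q (t i) / (\<Prod>j\<in>I-{i}. t i - t j)) = coeff R m"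
    by (simp cong: sum.cong)
  then show ?thesis
    using D by (simp add: R_def)
qed

text \<open>Lagrange summation for Q(x) = x (A(x) - D(x)), where D has the nodes as roots and A the
  nodes shifted by 1. At a node D vanishes and the factor \<open>j = i\<close> of A is -1, which
  gives the summands up to sign. The leading terms of A and D cancel, so the degree of Q does not
  exceed the number of nodes.\<close>

lemma sum_removal_weights:
  fixes m :: "'i \<Rightarrow> real"
  assumes "finite I" "inj_on m I"
  shows "(\<Sum>i\<in>I. m i * (\<Prod>j\<in>I-{i}. (m i - m j - 1) / (m i - m j)))
    = sum m I - real (card I) * (real (card I) - 1) / 2"
proof (cases "card I")
  case 0
  then show ?thesis using assms(1) by simp
next
  case N: (Suc k)
  define A where "A = monic_roots (\<lambda>i. m i + 1) I"
  define D where "D = monic_roots m I"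
  define Q where "Q = [:0, 1:] * (A - D)"
  note cA = coeff_monic_roots[OF assms(1), where t="\<lambda>i. m i + 1", folded A_def]
  note cD = coeff_monic_roots[OF assms(1), where t=m, folded D_def]
  have "coeff Q (Suc (Suc k)) = 0"
    using cA cD N by (simp add: Q_def)
  moreover have "degree Q \<le> Suc (Suc k)"
  proof -
    have "degree (A - D) \<le> Suc k"
      using N by (intro degree_diff_le) (auto simp: A_def D_def degree_monic_roots)
    then show ?thesis 
      unfolding Q_def by (intro order_trans[OF degree_mult_le]) simp
  qed
  ultimately have deg: "degree Q \<le> Suc k"
    by (metis le_Suc_eq leading_coeff_0_iff degree_0 zero_le)
  have "coeff Q (Suc k) = - real (card I)"
    using cA(2) cD(2) N by (simp add: Q_def sum.distrib)
  moreover have "coeff Q k = real (card I) * (real (card I) - 1) / 2 - sum m I + real (card I) * sum m I"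
  proof (cases k)
    case 0
    then show ?thesis using N by (simp add: Q_def)
  next
    case (Suc l)
    then have "card I = Suc (Suc l)" using N by simp
    then show ?thesis
      using Suc cA(3)[of l] cD(3)[of l] 
      by (simp add: Q_def sum.distrib power2_sum sum_distrib_left[symmetric])
         (simp add: algebra_simps power2_eq_square add_divide_distrib diff_divide_distrib)
  qed
  ultimately have "(\<Sum>i\<in>I. poly Q (m i) / (\<Prod>j\<in>I-{i}. m i - m j))
      = real (card I) * (real (card I) - 1) / 2 - sum m I"
    unfolding lagrange_second_coeff[OF assms N deg] by simp
  moreover have "poly Q (m i) / (\<Prod>j\<in>I-{i}. m i - m j)
      = - (m i * (\<Prod>j\<in>I-{i}. (m i - m j - 1) / (m i - m j)))" if "i \<in> I" for i
  proof -
    have "poly A (m i) = (\<Prod>j\<in>I. m i - m j - 1)"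
      by (simp add: A_def poly_monic_roots algebra_simps)
    also have "\<dots> = - (\<Prod>j\<in>I-{i}. m i - m j - 1)"
      using that assms(1) by (subst prod.remove[of I i]) auto
    finally have "poly A (m i) = - (\<Prod>j\<in>I-{i}. m i - m j - 1)" .
    moreover have "poly D (m i) = 0"
      using that assms(1) by (auto simp: D_def poly_monic_roots)
    ultimately show ?thesis
      by (simp add: Q_def prod_dividef)
  qed
  ultimately show ?thesis
    by (simp add: sum_negf)
qed

section \<open>Vandermonde products, hook products and transition weights\<close>

definition vandermonde :: "nat \<Rightarrow> (nat \<Rightarrow> real) \<Rightarrow> real" where
  "vandermonde N l = (\<Prod>(a, b)\<in>{(a, b). a < b \<and> b < N}. l a - l b)"

lemma finite_pairs: "finite {(a, b). a < b \<and> b < (N::nat)}"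
  by (rule finite_subset[of _ "{..<N} \<times> {..<N}"]) auto

text \<open>Only pairs containing \<open>i\<close> change. Reversing such a pair flips the sign of
  the new and of the old difference alike, so the quotient has the same form whether the other index
  is smaller or larger than \<open>i\<close>; \<open>min\<close> and \<open>max\<close> put the pair
  in order.\<close>

lemma vandermonde_upd:
  assumes "i < N" "inj_on l {..<N}"
  shows "vandermonde N (l(i := x))
    = vandermonde N l * (\<Prod>j\<in>{..<N}-{i}. (x - l j) / (l i - l j))"
proof -
  define P where "P = {(a, b). a < b \<and> b < N}"
  have finP: "finite P" unfolding P_def by (rule finite_pairs)
  define g where "g = (\<lambda>(a, b). ((l(i := x)) a - (l(i := x)) b) / (l a - l b))"
  have nz: "l a - l b \<noteq> 0" if "(a, b) \<in> P" for a b
    using that assms(2) by (auto simp: P_def inj_on_def)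
  have "vandermonde N (l(i := x)) = (\<Prod>p\<in>P. (case p of (a, b) \<Rightarrow> l a - l b) * g p)"
    unfolding vandermonde_def P_def[symmetric] using nz
    by (intro prod.cong) (auto simp: g_def)
  also have "\<dots> = vandermonde N l * prod g P"
    by (simp add: vandermonde_def P_def prod.distrib)
  also have "prod g P = prod g ((\<lambda>j. (min i j, max i j)) ` ({..<N} - {i}))"
  proof (rule prod.mono_neutral_right[OF finP])
    show "(\<lambda>j. (min i j, max i j)) ` ({..<N} - {i}) \<subseteq> P"
      using assms(1) by (auto simp: P_def min_def max_def)
    show "\<forall>p\<in>P - (\<lambda>j. (min i j, max i j)) ` ({..<N} - {i}). g p = 1"
    proof safe
      fix a b assume ab: "(a, b) \<in> P" "(a, b) \<notin> (\<lambda>j. (min i j, max i j)) ` ({..<N} - {i})"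
      have "a \<noteq> i"
      proof
        assume "a = i"
        with ab(1) have "(a, b) = (min i b, max i b)" "b \<in> {..<N} - {i}" by (auto simp: P_def)
        with ab(2) show False by blast
      qed
      moreover have "b \<noteq> i"
      proof
        assume "b = i"
        with ab(1) have "(a, b) = (min i a, max i a)" "a \<in> {..<N} - {i}" by (auto simp: P_def)
        with ab(2) show False by blast
      qed
      ultimately show "g (a, b) = 1" using nz[OF ab(1)] by (simp add: g_def)
    qed
  qed
  also have "\<dots> = (\<Prod>j\<in>{..<N}-{i}. g (min i j, max i j))"
    by (subst prod.reindex) (auto simp: inj_on_def min_def max_def split: if_splits)
  also have "\<dots> = (\<Prod>j\<in>{..<N}-{i}. (x - l j) / (l i - l j))"
  proof (rule prod.cong)
    fix j assume j: "j \<in> {..<N}-{i}"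
    then have "l i \<noteq> l j" using assms by (auto simp: inj_on_def)
    then show "g (min i j, max i j) = (x - l j) / (l i - l j)"
      using j by (auto simp: g_def min_def max_def field_simps)
  qed simp
  finally show ?thesis .
qed

lemma vandermonde_pos:
  assumes "\<And>a b. a < b \<Longrightarrow> b < N \<Longrightarrow> l b < l a"
  shows "vandermonde N l > 0"
  unfolding vandermonde_def using assms by (intro prod_pos) auto

text \<open>The content of the cell just beyond row \<open>i\<close>. For an antimonotone
  \<open>\<nu>\<close> these numbers strictly decrease, so they tell the rows apart and can serve as
  interpolation nodes.\<close>

definition row_end :: "(nat \<Rightarrow> nat) \<Rightarrow> nat \<Rightarrow> real" where
  "row_end \<nu> i = real (\<nu> i) - real i"

text \<open>Frobenius' form of the hook product of \<open>\<nu>\<close>, padded with zeros to \<open>N\<close> rows.\<close>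

definition frob_hook :: "nat \<Rightarrow> (nat \<Rightarrow> nat) \<Rightarrow> real" where
  "frob_hook N \<nu> = (\<Prod>i<N. fact (\<nu> i + N - 1 - i)) / vandermonde N (row_end \<nu>)"

text \<open>The residue of Kerov's transition function at the content \<open>row_end \<nu> i\<close> of the box next to
  row \<open>i\<close>. The last factor belongs to the pole at \<open>-N\<close>, the end of the first empty row after the
  padding.\<close>

definition growth_weight :: "nat \<Rightarrow> (nat \<Rightarrow> nat) \<Rightarrow> nat \<Rightarrow> real" where
  "growth_weight N \<nu> i =
    (\<Prod>j\<in>{..<N}-{i}. (row_end \<nu> i - row_end \<nu> j + 1) / (row_end \<nu> i - row_end \<nu> j))
      / (row_end \<nu> i + real N)"

lemma row_end_less:
  assumes "antimono \<nu>" "a < b"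
  shows "row_end \<nu> b < row_end \<nu> a"
  using antimonoD[OF assms(1), of a b] assms(2) by (simp add: row_end_def)

lemma row_end_inj: "antimono \<nu> \<Longrightarrow> inj_on (row_end \<nu>) A"
  unfolding inj_on_def by (metis less_irrefl linorder_neqE_nat row_end_less)

lemma row_end_eq_iff: "antimono \<nu> \<Longrightarrow> row_end \<nu> a = row_end \<nu> b \<longleftrightarrow> a = b"
  by (metis less_irrefl linorder_neqE_nat row_end_less)


lemma frob_hook_pos: "antimono \<nu> \<Longrightarrow> frob_hook N \<nu> > 0"
  unfolding frob_hook_def
  by (intro divide_pos_pos prod_pos vandermonde_pos row_end_less) auto

text \<open>A transition weight is the hook product before the new box divided by the one after it.
  The Vandermonde quotient comes from \<open>vandermonde_upd\<close>, and the factorial of row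
  \<open>i\<close> grows by exactly the denominator \<open>row_end \<nu> i + N\<close> of the
  weight.\<close>

lemma frob_hook_add:
  assumes "antimono \<nu>" "antimono (\<nu>(i := Suc (\<nu> i)))" "i < N"
  shows "growth_weight N \<nu> i * frob_hook N (\<nu>(i := Suc (\<nu> i))) = frob_hook N \<nu>"
proof -
  define \<nu>' where "\<nu>' = \<nu>(i := Suc (\<nu> i))"
  define p where "p = (\<Prod>j\<in>{..<N}-{i}. (row_end \<nu> i + 1 - row_end \<nu> j) / (row_end \<nu> i - row_end \<nu> j))"
  define V where "V = vandermonde N (row_end \<nu>)"
  have re': "row_end \<nu>' = (row_end \<nu>)(i := row_end \<nu> i + 1)"
    by (auto simp: \<nu>'_def row_end_def)
  have V': "vandermonde N (row_end \<nu>') = V * p"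
    unfolding re' p_def V_def using assms row_end_inj by (subst vandermonde_upd) auto
  have pos: "V > 0" "vandermonde N (row_end \<nu>') > 0"
    unfolding V_def using assms(1,2) row_end_less by (auto intro!: vandermonde_pos simp: \<nu>'_def)
  then have "p \<noteq> 0" using V' by auto
  have "growth_weight N \<nu> i = p / (row_end \<nu> i + N)"
    by (simp add: growth_weight_def p_def algebra_simps)
  moreover have "(\<Prod>i<N. fact (\<nu>' i + N - 1 - i)) = (\<Prod>i<N. fact (\<nu> i + N - 1 - i)) * (row_end \<nu> i + N)"
  proof -
    have "(\<Prod>i<N. fact (\<nu>' i + N - 1 - i)) = fact (\<nu>' i + N - 1 - i) * (\<Prod>i\<in>{..<N}-{i}. fact (\<nu>' i + N - 1 - i))"
      using assms(3) by (subst prod.remove[of _ i]) auto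
    also have "(\<Prod>i\<in>{..<N}-{i}. fact (\<nu>' i + N - 1 - i)) = (\<Prod>i\<in>{..<N}-{i}. fact (\<nu> i + N - 1 - i))"
      by (intro prod.cong) (auto simp: \<nu>'_def)
    also have "\<nu>' i + N - 1 - i = Suc (\<nu> i + N - 1 - i)"
      using assms(3) by (simp add: \<nu>'_def)
    also have "fact (Suc (\<nu> i + N - 1 - i)) = (row_end \<nu> i + N) * fact (\<nu> i + N - 1 - i)"
      using assms(3) by (simp add: row_end_def of_nat_diff)
    finally show ?thesis
      using assms(3) by (subst (2) prod.remove[of _ i]) auto
  qed
  moreover have "row_end \<nu> i + N > 0" using assms(3) by (simp add: row_end_def)
  ultimately show ?thesis
    unfolding frob_hook_def \<nu>'_def[symmetric] V' V_def[symmetric] using pos(1) \<open>p \<noteq> 0\<close> by simp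
qed


text \<open>A box cannot be added to row \<open>i\<close> only if row \<open>i - 1\<close> has the
  same length, and then the factor for \<open>j = i - 1\<close> is 0. Sums over addable rows may
  therefore run over all rows.\<close>

lemma growth_weight_nonaddable:
  assumes "antimono \<nu>" "\<not> antimono (\<nu>(i := Suc (\<nu> i)))" "i < N"
  shows "growth_weight N \<nu> i = 0"
proof -
  have "i > 0 \<and> \<nu> i = \<nu> (i - 1)"
  proof (rule ccontr)
    assume neg: "\<not> ?thesis"
    have "\<nu> i < \<nu> j" if "j < i" for j
      using neg antimonoD[OF assms(1), of j "i - 1"] antimonoD[OF assms(1), of "i - 1" i] that by fastforce
    then have "(\<nu>(i := Suc (\<nu> i))) b \<le> (\<nu>(i := Suc (\<nu> i))) a" if "a \<le> b" for a b
      using antimonoD[OF assms(1) that] that by (cases "a = i"; cases "b = i") (auto simp: Suc_le_eq le_SucI)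
    then have "antimono (\<nu>(i := Suc (\<nu> i)))"
      by (rule antimonoI)
    then show False using assms(2) by simp
  qed
  then have "row_end \<nu> i - row_end \<nu> (i - 1) + 1 = 0" "i - 1 \<in> {..<N} - {i}"
    using assms(3) by (auto simp: row_end_def of_nat_diff)
  then have "(\<Prod>j\<in>{..<N}-{i}. (row_end \<nu> i - row_end \<nu> j + 1) / (row_end \<nu> i - row_end \<nu> j)) = 0"
    by (intro prod_zero) (auto intro!: bexI[of _ "i - 1"])
  then show ?thesis
    by (simp add: growth_weight_def)
qed

text \<open>The transition measure has mass 1 and mean 0. Both are Lagrange sums over the
  \<open>N + 1\<close> nodes of the rows 0 to \<open>N\<close>, in which the additional node -N
  supplies the denominator of the weights.\<close>

lemma growth_weight_moments:
  assumes "antimono \<nu>" "\<nu> (N - 1) = 0" "N > 0"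
  shows "(\<Sum>i<N. growth_weight N \<nu> i) = 1"
    and "(\<Sum>i<N. growth_weight N \<nu> i * row_end \<nu> i) = 0"
proof -
  define t where "t = row_end \<nu>"
  define P where "P = monic_roots (\<lambda>j. t j - 1) {..<N}"
  have "\<nu> N = 0" using antimonoD[OF assms(1), of "N - 1" N] assms(2) by simp
  then have tN: "t N = - real N" by (simp add: t_def row_end_def)
  have inj: "inj_on t {..N}" using row_end_inj[OF assms(1)] by (simp add: t_def)
  \<comment> \<open>Row \<open>N - 1\<close> is empty, so the root \<open>t (N - 1) - 1\<close> of
    \<open>P\<close> coincides with the node \<open>t N\<close>, whose summand thus
    disappears.\<close>
  have PN: "poly P (t N) = 0"
  proof -
    have "t N - (t (N - 1) - 1) = 0"
      using assms(2,3) by (simp add: t_def row_end_def tN[unfolded t_def] of_nat_diff)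
         (simp add: \<open>\<nu> N = 0\<close>)
    then show ?thesis
      unfolding P_def poly_monic_roots using assms(3) by (intro prod_zero) (auto intro!: bexI[of _ "N - 1"])
  qed
  have Pt: "poly P (t i) / (\<Prod>j\<in>{..N}-{i}. t i - t j) = growth_weight N \<nu> i" if "i < N" for i
  proof -
    have "poly P (t i) = (\<Prod>j<N. t i - t j + 1)"
      by (simp add: P_def poly_monic_roots algebra_simps)
    also have "\<dots> = (\<Prod>j\<in>{..<N}-{i}. t i - t j + 1)"
      using that by (subst prod.remove[of _ i]) auto
    finally have *: "poly P (t i) = (\<Prod>j\<in>{..<N}-{i}. t i - t j + 1)" .
    have "{..N} - {i} = insert N ({..<N} - {i})" using that by auto
    then have "(\<Prod>j\<in>{..N}-{i}. t i - t j) = (t i + N) * (\<Prod>j\<in>{..<N}-{i}. t i - t j)"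
      by (simp add: tN)
    with * show ?thesis
      by (simp add: growth_weight_def prod_dividef t_def)
  qed
  have split: "(\<Sum>i\<le>N. f i) = (\<Sum>i<N. f i) + f N" for f :: "nat \<Rightarrow> real"
    by (simp add: lessThan_Suc_atMost[symmetric])
  have cP: "coeff P N = 1" "coeff P (N - 1) = - (\<Sum>i<N. t i - 1)" "degree P = N"
    using coeff_monic_roots(1)[of "{..<N}" "\<lambda>j. t j - 1"] assms(3)
      coeff_monic_roots(2)[where I="{..<N}" and t="\<lambda>j. t j - 1" and m="N - 1"]
    by (auto simp: P_def degree_monic_roots)
  have "(\<Sum>i\<le>N. poly P (t i) / (\<Prod>j\<in>{..N}-{i}. t i - t j)) = coeff P N"
    using cP inj by (intro lagrange_leading_coeff) auto
  then show "(\<Sum>i<N. growth_weight N \<nu> i) = 1"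
    using PN cP by (simp add: split Pt)
  have "coeff ([:0, 1:] * P) N = coeff P (N - 1)"
    using assms(3) by (cases N) auto
  moreover have "(\<Sum>i\<le>N. poly ([:0, 1:] * P) (t i) / (\<Prod>j\<in>{..N}-{i}. t i - t j))
     = coeff ([:0, 1:] * P) N + coeff ([:0, 1:] * P) (Suc N) * sum t {..N}"
    using cP inj by (intro lagrange_second_coeff) (auto intro: order_trans[OF degree_mult_le])
  ultimately have "(\<Sum>i\<le>N. poly ([:0, 1:] * P) (t i) / (\<Prod>j\<in>{..N}-{i}. t i - t j)) = 0"
    using cP tN by (simp add: split sum_subtractf)
  moreover have "poly ([:0, 1:] * P) (t i) / (\<Prod>j\<in>{..N}-{i}. t i - t j) = growth_weight N \<nu> i * t i" if "i < N" for i
    using Pt[OF that, symmetric] by simp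
  ultimately show "(\<Sum>i<N. growth_weight N \<nu> i * row_end \<nu> i) = 0"
    using PN by (simp add: split t_def)
qed

text \<open>With x the distance to the content of the new box, the factor for row \<open>k\<close>
  turns from (x + 1)/x into x/(x - 1), whence the quotient x^2/(x^2 - 1). Undivided, the equation
  also covers \<open>i = k\<close>, where \<open>f\<close> is evaluated at different points but both
  sides vanish. The algebraic twin is \<open>hecke_transfer\<close>.\<close>

lemma growth_weight_step:
  assumes "antimono \<nu>" "antimono (\<nu>(k := Suc (\<nu> k)))" "k < N" "i < N"
  defines "\<nu>' \<equiv> \<nu>(k := Suc (\<nu> k))"
  shows "growth_weight N \<nu>' i * ((row_end \<nu>' i - row_end \<nu> k)\<^sup>2 - 1) * f (row_end \<nu>' i)
    = growth_weight N \<nu> i * (row_end \<nu> i - row_end \<nu> k)\<^sup>2 * f (row_end \<nu> i)"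
proof (cases "i = k")
  case True
  then show ?thesis by (simp add: \<nu>'_def row_end_def power2_eq_square)
next
  case False
  define l where "l = row_end \<nu>"
  define c where "c = l k"
  have l': "row_end \<nu>' = l(k := c + 1)"
    by (auto simp: \<nu>'_def l_def c_def row_end_def)
  have "l i \<noteq> c" using False row_end_eq_iff[OF assms(1)] by (simp add: l_def c_def)
  have "l i \<noteq> c + 1"
    using False row_end_eq_iff[OF assms(2)[folded \<nu>'_def], of i k] by (simp add: l')
  define p where "p = (\<Prod>j\<in>{..<N}-{i}-{k}. (l i - l j + 1) / (l i - l j))"
  have k: "k \<in> {..<N} - {i}" using False assms(3) by auto
  have w: "growth_weight N \<nu> i = (l i - c + 1) / (l i - c) * p / (l i + N)"
    unfolding growth_weight_def l_def[symmetric] p_def c_def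
    using k by (subst prod.remove[of _ k]) auto
  have "(\<Prod>j\<in>{..<N}-{i}-{k}. (l i - (l(k := c + 1)) j + 1) / (l i - (l(k := c + 1)) j)) = p"
    unfolding p_def by (intro prod.cong) auto
  then have w': "growth_weight N \<nu>' i = (l i - (c + 1) + 1) / (l i - (c + 1)) * p / (l i + N)"
    unfolding growth_weight_def l' using k False by (subst prod.remove[of _ k]) auto
  define x where "x = l i - c"
  have x: "x \<noteq> 0" "x \<noteq> 1" using \<open>l i \<noteq> c\<close> \<open>l i \<noteq> c + 1\<close> by (auto simp: x_def)
  have "x / (x - 1) * (x\<^sup>2 - 1) = (x + 1) / x * x\<^sup>2"
    using x by (simp add: field_simps power2_eq_square)
  then have "(x / (x - 1) * p / (l i + N)) * (x\<^sup>2 - 1) = ((x + 1) / x * p / (l i + N)) * x\<^sup>2"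
    by (metis (no_types, lifting) mult.assoc mult.commute times_divide_eq_right)
  moreover have "growth_weight N \<nu>' i = x / (x - 1) * p / (l i + N)"
      "growth_weight N \<nu> i = (x + 1) / x * p / (l i + N)"
    unfolding w w' x_def by (simp_all add: algebra_simps)
  ultimately have "growth_weight N \<nu>' i * (x\<^sup>2 - 1) = growth_weight N \<nu> i * x\<^sup>2"
    by (simp only:)
  then show ?thesis
    using False by (simp add: l' l_def[symmetric] c_def[symmetric] x_def)
qed

lemma growth_weight_empty:
  assumes "i < N"
  shows "growth_weight N (\<lambda>_. 0) i = (if i = 0 then 1 else 0)"
proof -
  have zero: "growth_weight N (\<lambda>_. 0) i = 0" if "i > 0" "i < N" for i
  proof (rule growth_weight_nonaddable[OF _ _ that(2)])
    show "\<not> antimono ((\<lambda>_. 0)(i := Suc 0))"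
      using that(1) antimonoD[of "(\<lambda>_. 0)(i := Suc 0)" 0 i] by auto
  qed (simp add: antimono_def)
  have "1 = (\<Sum>i<N. growth_weight N (\<lambda>_. 0) i)"
    using assms by (subst growth_weight_moments(1)) (auto simp: antimono_def)
  also have "\<dots> = growth_weight N (\<lambda>_. 0) 0"
    using assms zero by (subst sum.remove[of _ 0]) auto
  finally show ?thesis using zero assms by simp
qed

section \<open>Standard tableaux and the hook length formula\<close>

text \<open>A tableau is the list of the rows of its entries, the largest entry first.\<close>

primrec standard :: "nat list \<Rightarrow> bool" where
  "standard [] \<longleftrightarrow> True"
| "standard (r # T) \<longleftrightarrow> standard T \<and> antimono (count_list (r # T))"

definition tableaux :: "nat \<Rightarrow> nat list set" where
  "tableaux n = {T. standard T \<and> length T = n}"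

definition tableaux_of :: "(nat \<Rightarrow> nat) \<Rightarrow> nat list set" where
  "tableaux_of \<nu> = {T. standard T \<and> count_list T = \<nu>}"

lemma count_list_Cons: "count_list (r # T) = (count_list T)(r := Suc (count_list T r))"
  by auto

lemma standard_antimono: "standard T \<Longrightarrow> antimono (count_list T)"
  by (cases T) (auto simp: antimono_def)

text \<open>If row \<open>r\<close> is nonempty, so are all rows above it, which takes at least
  \<open>r + 1\<close> entries.\<close>

lemma standard_row_less:
  assumes "standard T" "r \<in> set T"
  shows "r < length T"
proof -
  have "{..r} \<subseteq> set T"
  proof
    fix i assume "i \<in> {..r}"
    then have "count_list T r \<le> count_list T i"
      using antimonoD[OF standard_antimono[OF assms(1)], of i r] by simp
    then show "i \<in> set T"
      using assms(2) by (metis count_list_0_iff le_zero_eq)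
  qed
  then have "card {..r} \<le> card (set T)" by (intro card_mono) auto
  then show ?thesis using card_length[of T] by simp
qed

lemma standard_count_eq_0: "standard T \<Longrightarrow> length T \<le> i \<Longrightarrow> count_list T i = 0"
  using standard_row_less[of T i] by (fastforce simp: count_list_0_iff)

lemma finite_tableaux: "finite (tableaux n)"
proof (rule finite_subset)
  show "tableaux n \<subseteq> {T. set T \<subseteq> {..<n} \<and> length T = n}"
    using standard_row_less by (auto simp: tableaux_def)
  show "finite {T. set T \<subseteq> {..<n} \<and> length T = n}"
    by (rule finite_lists_length_eq) simp
qed

lemma length_eq_sum_count:
  fixes T :: "nat list"
  assumes "\<And>i. i \<ge> N \<Longrightarrow> count_list T i = 0"
  shows "length T = (\<Sum>i<N. count_list T i)"
proof -
  have "set T \<subseteq> {..<N}"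
  proof
    fix r assume "r \<in> set T"
    then have "count_list T r \<noteq> 0" by (simp add: count_list_0_iff)
    then show "r \<in> {..<N}" using assms[of r] by (cases "N \<le> r") auto
  qed
  then show ?thesis by (simp add: sum_count_set)
qed

lemma tableaux_of_subset:
  assumes "\<And>i. i \<ge> N \<Longrightarrow> \<nu> i = 0"
  shows "tableaux_of \<nu> \<subseteq> tableaux (\<Sum>i<N. \<nu> i)"
  using length_eq_sum_count[of N] assms by (auto simp: tableaux_def tableaux_of_def)

section \<open>Removing boxes and the hook length formula\<close>

lemma antimono_remove:
  fixes \<nu> :: "nat \<Rightarrow> nat"
  assumes "antimono \<nu>" "\<nu> (Suc r) < \<nu> r"
  shows "antimono (\<nu>(r := \<nu> r - 1))"
proof (rule antimonoI)
  fix a b :: nat assume "a \<le> b"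
  have 1: "\<nu> b \<le> \<nu> (Suc r)" if "r < b" using antimonoD[OF assms(1)] that by simp
  have 2: "\<nu> b \<le> \<nu> a" using antimonoD[OF assms(1) \<open>a \<le> b\<close>] .
  show "(\<nu>(r := \<nu> r - 1)) b \<le> (\<nu>(r := \<nu> r - 1)) a"
  proof (cases "a = r \<and> b \<noteq> r")
    case True
    then show ?thesis using 1 \<open>a \<le> b\<close> assms(2) by simp
  next
    case False
    then show ?thesis using 2 by (auto intro: le_trans[OF diff_le_self])
  qed
qed

lemma tableaux_of_rec:
  assumes "antimono \<nu>" "\<And>i. i \<ge> N \<Longrightarrow> \<nu> i = 0" "(\<Sum>i<N. \<nu> i) > 0"
  defines "R \<equiv> {r\<in>{..<N}. \<nu> (Suc r) < \<nu> r}"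
  shows "tableaux_of \<nu> = (\<Union>r\<in>R. (#) r ` tableaux_of (\<nu>(r := \<nu> r - 1)))"
proof (intro equalityI subsetI)
  fix T assume T: "T \<in> tableaux_of \<nu>"
  then have "T \<noteq> []"
    using assms(3) by (auto simp: tableaux_of_def)
  then obtain r S where rS: "T = r # S" by (cases T) auto
  have cT: "count_list T = \<nu>" and sT: "standard S" using T by (auto simp: tableaux_of_def rS)
  have cS: "count_list S = \<nu>(r := \<nu> r - 1)" unfolding cT[symmetric] by (auto simp: rS)
  have "\<nu> r > 0" unfolding cT[symmetric] by (simp add: rS)
  then have "r < N" using assms(2)[of r] by (cases "N \<le> r") auto
  have "count_list S (Suc r) \<le> count_list S r"
    using antimonoD[OF standard_antimono[OF sT]] by simp
  then have "\<nu> (Suc r) < \<nu> r" using \<open>\<nu> r > 0\<close> by (simp add: cS)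
  then have "r \<in> R" using \<open>r < N\<close> by (simp add: R_def)
  moreover have "S \<in> tableaux_of (\<nu>(r := \<nu> r - 1))" using cS sT by (simp add: tableaux_of_def)
  ultimately show "T \<in> (\<Union>r\<in>R. (#) r ` tableaux_of (\<nu>(r := \<nu> r - 1)))"
    using rS by auto
next
  fix T assume "T \<in> (\<Union>r\<in>R. (#) r ` tableaux_of (\<nu>(r := \<nu> r - 1)))"
  then obtain r S where rS: "T = r # S" "r \<in> R" "standard S" "count_list S = \<nu>(r := \<nu> r - 1)"
    by (auto simp: tableaux_of_def)
  then have "count_list T = \<nu>" by (auto simp: count_list_Cons R_def)
  then show "T \<in> tableaux_of \<nu>" using assms(1) rS by (simp add: tableaux_of_def)
qed

text \<open>The counterpart of \<open>frob_hook_add\<close> for removal, in the shifted coordinates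
  \<open>m\<close> that turn the quotient into a summand of
  \<open>sum_removal_weights\<close>.\<close>

lemma frob_hook_remove:
  assumes "antimono \<nu>" "r < N" "\<nu> (Suc r) < \<nu> r"
  defines "m \<equiv> \<lambda>i. row_end \<nu> i + real (N - 1)"
  shows "frob_hook N \<nu>
    = frob_hook N (\<nu>(r := \<nu> r - 1)) * (m r * (\<Prod>j\<in>{..<N}-{r}. (m r - m j - 1) / (m r - m j)))"
proof -
  define \<nu>' where "\<nu>' = \<nu>(r := \<nu> r - 1)"
  have anti': "antimono \<nu>'" unfolding \<nu>'_def by (rule antimono_remove) (use assms in auto)
  define p where "p = (\<Prod>j\<in>{..<N}-{r}. (m r - m j - 1) / (m r - m j))"
  define V where "V = vandermonde N (row_end \<nu>)"
  have re': "row_end \<nu>' = (row_end \<nu>)(r := row_end \<nu> r - 1)"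
    using assms(3) by (auto simp: \<nu>'_def row_end_def fun_eq_iff of_nat_diff)
  have V': "vandermonde N (row_end \<nu>') = V * p"
    unfolding re' p_def V_def using assms row_end_inj 
    by (subst vandermonde_upd) (auto simp: m_def algebra_simps intro!: prod.cong)
  have pos: "V > 0" "vandermonde N (row_end \<nu>') > 0"
    unfolding V_def using assms(1) anti' row_end_less by (auto intro!: vandermonde_pos)
  then have "p \<noteq> 0" using V' by auto
  have split: "(\<Prod>i<N. fact (\<eta> i + N - 1 - i)) = fact (\<eta> r + N - 1 - r) * (\<Prod>i\<in>{..<N}-{r}. fact (\<eta> i + N - 1 - i) :: real)" for \<eta>
    using assms(2) by (subst prod.remove[of _ r]) auto
  have "(\<Prod>i\<in>{..<N}-{r}. fact (\<nu>' i + N - 1 - i) :: real) = (\<Prod>i\<in>{..<N}-{r}. fact (\<nu> i + N - 1 - i))"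
    by (intro prod.cong) (auto simp: \<nu>'_def)
  moreover have "fact (\<nu> r + N - 1 - r) = m r * fact (\<nu>' r + N - 1 - r)"
  proof -
    have "\<nu> r + N - 1 - r = Suc (\<nu>' r + N - 1 - r)"
      using assms(2,3) by (simp add: \<nu>'_def)
    moreover have "real (Suc (\<nu>' r + N - 1 - r)) = m r"
      using assms(2,3) by (simp add: \<nu>'_def m_def row_end_def of_nat_diff)
    ultimately show ?thesis by (metis fact_Suc of_nat_fact of_nat_mult)
  qed
  ultimately have "(\<Prod>i<N. fact (\<nu> i + N - 1 - i)) = (\<Prod>i<N. fact (\<nu>' i + N - 1 - i)) * m r"
    unfolding split by simp
  then show ?thesis
    unfolding frob_hook_def \<nu>'_def[symmetric] V' V_def[symmetric] p_def[symmetric]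
    using pos(1) \<open>p \<noteq> 0\<close> by simp
qed

text \<open>This extends the sum over removable corners to all \<open>N\<close> rows. Either the
  next row has the same length and the factor for \<open>j = Suc r\<close> is 0, or \<open>r\<close>
  is the last row of the padding, is empty, and \<open>m r\<close> is 0.\<close>

lemma removal_weight_nonremovable:
  assumes "antimono \<nu>" "\<And>i. i \<ge> N \<Longrightarrow> \<nu> i = 0" "r < N" "\<not> \<nu> (Suc r) < \<nu> r"
  defines "m \<equiv> \<lambda>i. row_end \<nu> i + real (N - 1)"
  shows "m r * (\<Prod>j\<in>{..<N}-{r}. (m r - m j - 1) / (m r - m j)) = 0"
proof -
  have eq: "\<nu> (Suc r) = \<nu> r"
    using assms(4) antimonoD[OF assms(1), of r "Suc r"] by simp
  show ?thesis
  proof (cases "Suc r < N")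
    case True
    then have "(\<Prod>j\<in>{..<N}-{r}. (m r - m j - 1) / (m r - m j)) = 0"
      using eq by (intro prod_zero) (auto intro!: bexI[of _ "Suc r"] simp: m_def row_end_def)
    then show ?thesis by simp
  next
    case False
    then have "r = N - 1" using assms(3) by simp
    moreover have "\<nu> (Suc r) = 0" using assms(2) False by simp
    ultimately have "m r = 0" using eq by (simp add: m_def row_end_def)
    then show ?thesis by simp
  qed
qed

lemma sum_lessThan_of_nat_real: "(\<Sum>i<N. real i) = real N * (real N - 1) / 2"
  by (induction N) (auto simp: field_simps)

lemma frob_hook_empty: "frob_hook N (\<lambda>_. 0) = 1"
proof -
  have 1: "(\<Prod>i<N. fact (N - 1 - i) :: real) = (\<Prod>i<N. fact i)"
    by (rule prod.reindex_bij_witness[of _ "\<lambda>i. N - 1 - i" "\<lambda>i. N - 1 - i"]) auto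
  have 2: "vandermonde N (row_end (\<lambda>_. 0)) = (\<Prod>i<N. fact i)"
  proof -
    have "{(a, b). a < b \<and> b < N} = prod.swap ` (SIGMA b:{..<N}. {..<b})"
      by auto
    then have "vandermonde N (row_end (\<lambda>_. 0)) = (\<Prod>b<N. \<Prod>a<b. real b - real a)"
      unfolding vandermonde_def
      by (simp add: prod.reindex prod.Sigma row_end_def case_prod_unfold)
    also have "\<dots> = (\<Prod>b<N. fact b)"
    proof (rule prod.cong)
      fix b
      have "(\<Prod>a<b. real b - real a) = (\<Prod>a<b. real (Suc a))"
        by (rule prod.reindex_bij_witness[of _ "\<lambda>i. b - 1 - i" "\<lambda>i. b - 1 - i"]) (auto simp: of_nat_diff)
      also have "\<dots> = fact b" by (induction b) auto
      finally show "(\<Prod>a<b. real b - real a) = fact b" .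
    qed simp
    finally show ?thesis .
  qed
  have "(\<Prod>i<N. fact i :: real) > 0" by (intro prod_pos) auto
  then show ?thesis using 1 2 by (simp add: frob_hook_def)
qed

lemma finite_tableaux_of:
  assumes "\<And>i. i \<ge> N \<Longrightarrow> \<nu> i = 0"
  shows "finite (tableaux_of \<nu>)"
  using finite_subset[OF tableaux_of_subset finite_tableaux, of N \<nu>] assms by auto

text \<open>Sorting the tableaux by the row of the largest entry gives f H as the sum of f' H'
  (H/H') over the removable corners. Each f' H' is \<open>fact n\<close> by induction, and the
  quotients H/H' add up to \<open>Suc n\<close> by \<open>sum_removal_weights\<close>.\<close>

theorem hook_length_formula:
  assumes "antimono \<nu>" "\<And>i. i \<ge> N \<Longrightarrow> \<nu> i = 0" "(\<Sum>i<N. \<nu> i) = n"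
  shows "real (card (tableaux_of \<nu>)) * frob_hook N \<nu> = fact n"
  using assms
proof (induction n arbitrary: \<nu>)
  case 0
  then have "\<nu> i = 0" for i by (cases "i < N") auto
  then have "\<nu> = (\<lambda>_. 0)" by auto
  moreover have "tableaux_of (\<lambda>_. 0) = {[]}"
  proof -
    have "T = []" if "count_list T = (\<lambda>_. 0)" for T
      using that by (metis count_list_0_iff list.set_intros(1) neq_Nil_conv)
    then show ?thesis by (auto simp: tableaux_of_def)
  qed
  ultimately show ?case by (simp add: frob_hook_empty)
next
  case (Suc n)
  define R where "R = {r\<in>{..<N}. \<nu> (Suc r) < \<nu> r}"
  define m where "m i = row_end \<nu> i + real (N - 1)" for i
  define d where "d r = m r * (\<Prod>j\<in>{..<N}-{r}. (m r - m j - 1) / (m r - m j))" for r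
  define rem where "rem r = \<nu>(r := \<nu> r - 1)" for r
  have rem: "antimono (rem r)" "\<And>i. i \<ge> N \<Longrightarrow> rem r i = 0" "(\<Sum>i<N. rem r i) = n" if "r \<in> R" for r
  proof -
    show "antimono (rem r)"
      using antimono_remove[OF Suc.prems(1)] that unfolding rem_def R_def by blast
    show "\<And>i. i \<ge> N \<Longrightarrow> rem r i = 0" using Suc.prems by (auto simp: rem_def)
    have r: "r \<in> {..<N}" "\<nu> r > 0" using that by (auto simp: R_def)
    have "(\<Sum>i\<in>{..<N}-{r}. rem r i) = (\<Sum>i\<in>{..<N}-{r}. \<nu> i)"
      by (intro sum.cong) (auto simp: rem_def)
    then show "(\<Sum>i<N. rem r i) = n"
      using Suc.prems(3) r by (simp add: sum.remove[of _ r] rem_def)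
  qed
  have IH: "real (card (tableaux_of (rem r))) * frob_hook N (rem r) = fact n" if "r \<in> R" for r
    using Suc.IH rem that by blast
  have "card (tableaux_of \<nu>) = (\<Sum>r\<in>R. card ((#) r ` tableaux_of (rem r)))"
    unfolding rem_def using Suc.prems finite_tableaux_of[of N "rem r" for r] rem
    by (subst tableaux_of_rec[of \<nu> N])
       (auto simp: R_def[symmetric] rem_def intro!: card_UN_disjoint simp: R_def)
  then have "card (tableaux_of \<nu>) = (\<Sum>r\<in>R. card (tableaux_of (rem r)))"
    by (simp add: card_image)
  then have "real (card (tableaux_of \<nu>)) * frob_hook N \<nu>
      = (\<Sum>r\<in>R. real (card (tableaux_of (rem r))) * frob_hook N \<nu>)"
    by (simp add: sum_distrib_right)
  also have "\<dots> = (\<Sum>r\<in>R. fact n * d r)"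
  proof (rule sum.cong)
    fix r assume r: "r \<in> R"
    then have "frob_hook N \<nu> = frob_hook N (rem r) * d r"
      using frob_hook_remove[of \<nu> r N] Suc.prems by (simp add: R_def rem_def d_def m_def)
    then show "real (card (tableaux_of (rem r))) * frob_hook N \<nu> = fact n * d r"
      using IH[OF r] by simp
  qed simp
  also have "\<dots> = fact n * (\<Sum>r\<in>R. d r)"
    by (simp add: sum_distrib_left)
  also have "(\<Sum>r\<in>R. d r) = (\<Sum>r<N. d r)"
    using removal_weight_nonremovable[of \<nu> N] Suc.prems
    by (intro sum.mono_neutral_left) (auto simp: R_def d_def m_def)
  also have "(\<Sum>r<N. d r) = sum m {..<N} - real N * (real N - 1) / 2"
    unfolding d_def
    by (subst sum_removal_weights) (use row_end_inj[OF Suc.prems(1)] in \<open>auto simp: m_def inj_on_def\<close>)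
  also have "\<dots> = real (Suc n)"
  proof -
    have "(\<Sum>i<N. real (\<nu> i)) = real (Suc n)"
      using Suc.prems(3) by (metis of_nat_sum)
    moreover have "N > 0" using Suc.prems(3) by (cases N) auto
    ultimately show ?thesis
      by (simp add: m_def row_end_def sum.distrib sum_subtractf sum_lessThan_of_nat_real of_nat_diff field_simps)
  qed
  finally show ?case by simp
qed

section \<open>Partitions, Young diagrams and their hook and content products\<close>

definition rows :: "nat list \<Rightarrow> nat \<Rightarrow> nat" where
  "rows \<mu> i = (if i < length \<mu> then \<mu> ! i else 0)"

lemma young_diagram_rows:
  assumes "length \<mu> \<le> N"
  shows "young_diagram \<mu> = (SIGMA i:{..<N}. {..<rows \<mu> i})"
  using assms by (auto simp: young_diagram_def rows_def split: if_splits)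

lemma rows_antimono: "\<mu> \<in> partitions n \<Longrightarrow> antimono (rows \<mu>)"
  by (intro antimonoI) (auto simp: partitions_def rows_def sorted_wrt_iff_nth_less le_less)

lemma rows_sum:
  assumes "length \<mu> \<le> N"
  shows "(\<Sum>i<N. rows \<mu> i) = sum_list \<mu>"
proof -
  have "(\<Sum>i<N. rows \<mu> i) = (\<Sum>i<length \<mu>. rows \<mu> i)"
    using assms by (intro sum.mono_neutral_right) (auto simp: rows_def)
  also have "\<dots> = sum_list \<mu>"
    by (simp add: rows_def sum_list_sum_nth atLeast0LessThan)
  finally show ?thesis .
qed

lemma partition_length_le: "\<mu> \<in> partitions n \<Longrightarrow> length \<mu> \<le> n"
proof -
  have "length xs \<le> sum_list xs" if "\<forall>x\<in>set xs. 0 < x" for xs :: "nat list"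
    using that by (induction xs) auto
  then show "\<mu> \<in> partitions n \<Longrightarrow> length \<mu> \<le> n" by (auto simp: partitions_def)
qed

lemma rows_inj: "inj_on rows (partitions n)"
proof (rule inj_onI)
  fix \<mu> \<eta> assume \<mu>: "\<mu> \<in> partitions n" and \<eta>: "\<eta> \<in> partitions n" and eq: "rows \<mu> = rows \<eta>"
  have pos: "rows \<xi> i > 0 \<longleftrightarrow> i < length \<xi>" if "\<xi> \<in> partitions n" for \<xi> i
    using that by (auto simp: partitions_def rows_def)
  have "i < length \<mu> \<longleftrightarrow> i < length \<eta>" for i
    using pos[OF \<mu>] pos[OF \<eta>] eq by metis
  then have "length \<mu> = length \<eta>" by (metis linorder_neqE_nat less_irrefl)
  then show "\<mu> = \<eta>"
    using fun_cong[OF eq] by (intro nth_equalityI) (auto simp: rows_def, metis)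
qed

lemma rows_surj:
  assumes "antimono \<nu>" "\<nu> N = 0" "(\<Sum>i<N. \<nu> i) = n"
  obtains \<mu> where "\<mu> \<in> partitions n" "rows \<mu> = \<nu>"
proof -
  define l where "l = (LEAST i. \<nu> i = 0)"
  have l0: "\<nu> l = 0" unfolding l_def by (rule LeastI[of _ N]) (rule assms)
  have pos: "\<nu> i > 0" if "i < l" for i using not_less_Least[of i "\<lambda>i. \<nu> i = 0"] that by (auto simp: l_def)
  have "l \<le> N" unfolding l_def by (rule Least_le) (rule assms)
  have zero: "\<nu> i = 0" if "l \<le> i" for i using antimonoD[OF assms(1) that] l0 by simp
  define \<mu> where "\<mu> = map \<nu> [0..<l]"
  have 1: "rows \<mu> = \<nu>" using zero by (auto simp: rows_def \<mu>_def)
  have "sum_list \<mu> = n"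
    using rows_sum[of \<mu> N] 1 assms(3) \<open>l \<le> N\<close> by (simp add: \<mu>_def)
  then have "\<mu> \<in> partitions n"
    using pos antimonoD[OF assms(1)] by (auto simp: partitions_def \<mu>_def sorted_wrt_iff_nth_less)
  with 1 that show ?thesis by blast
qed

lemma sum_tableaux_by_shape:
  fixes F :: "(nat \<Rightarrow> nat) \<Rightarrow> real"
  shows "(\<Sum>T\<in>tableaux n. F (count_list T))
    = (\<Sum>\<mu>\<in>partitions n. real (card (tableaux_of (rows \<mu>))) * F (rows \<mu>))"
proof -
  have zero: "rows \<mu> i = 0" if "\<mu> \<in> partitions n" "i \<ge> n" for \<mu> i
    using partition_length_le[OF that(1)] that(2) by (simp add: rows_def)
  have sub: "tableaux_of (rows \<mu>) \<subseteq> tableaux n" if "\<mu> \<in> partitions n" for \<mu>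
    using tableaux_of_subset[of n "rows \<mu>"] zero[OF that] rows_sum[OF partition_length_le[OF that]] that
    by (auto simp: partitions_def)
  have "tableaux n = (\<Union>\<mu>\<in>partitions n. tableaux_of (rows \<mu>))"
  proof (intro equalityI subsetI)
    fix T assume T: "T \<in> tableaux n"
    then have "standard T" "length T = n" by (auto simp: tableaux_def)
    then obtain \<mu> where "\<mu> \<in> partitions n" "rows \<mu> = count_list T"
      using rows_surj[OF standard_antimono, of T n n] length_eq_sum_count[of n T] standard_count_eq_0[of T]
      by (metis le_refl)
    then show "T \<in> (\<Union>\<mu>\<in>partitions n. tableaux_of (rows \<mu>))"
      using \<open>standard T\<close> by (auto simp: tableaux_of_def intro!: bexI[of _ \<mu>])
  qed (use sub in auto)
  then have "(\<Sum>T\<in>tableaux n. F (count_list T))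
      = (\<Sum>\<mu>\<in>partitions n. \<Sum>T\<in>tableaux_of (rows \<mu>). F (count_list T))"
    using finite_partitions inj_onD[OF rows_inj] finite_subset[OF sub finite_tableaux]
    by (simp only:, intro sum.UNION_disjoint) (auto simp: tableaux_of_def)
  also have "\<dots> = (\<Sum>\<mu>\<in>partitions n. \<Sum>T\<in>tableaux_of (rows \<mu>). F (rows \<mu>))"
    by (intro sum.cong) (auto simp: tableaux_of_def)
  finally show ?thesis by simp
qed

text \<open>The hook lengths in row \<open>i\<close> and the differences \<open>m i - m k\<close>
  for the lower rows together are exactly the numbers from 1 to \<open>m i\<close>: both families
  are injective and lie in this range, they are disjoint, and there are \<open>m i\<close> of
  them.\<close>

lemma row_hooks_fact:
  fixes \<nu> :: "nat \<Rightarrow> nat"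
  assumes "antimono \<nu>" "i < N"
  defines "m \<equiv> \<lambda>i. \<nu> i + N - 1 - i"
  defines "h \<equiv> \<lambda>j. \<nu> i - j + card {k. i < k \<and> k < N \<and> j < \<nu> k}"
  shows "(\<Prod>j<\<nu> i. h j) * (\<Prod>k\<in>{i<..<N}. m i - m k) = fact (m i)"
proof -
  define leg where "leg j = card {k. i < k \<and> k < N \<and> j < \<nu> k}" for j
  have leg_mono: "leg j' \<le> leg j" if "j \<le> j'" for j j'
    unfolding leg_def using that by (intro card_mono) auto
  have leg_bound: "leg j \<le> N - 1 - i" for j
  proof -
    have "leg j \<le> card {i<..<N}" unfolding leg_def by (intro card_mono) auto
    then show ?thesis by simp
  qed
  have h_less: "h j' < h j" if "j < j'" "j' < \<nu> i" for j j'
    using leg_mono[of j j'] that unfolding h_def leg_def by linarith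
  then have inj_h: "inj_on h {..<\<nu> i}"
    by (metis (no_types, lifting) inj_onI lessThan_iff less_irrefl linorder_neqE_nat)
  have m_less: "m k' < m k" if "k < k'" "k' < N" for k k'
    using antimonoD[OF assms(1), of k k'] that by (auto simp: m_def)
  have inj_d: "inj_on (\<lambda>k. m i - m k) {i<..<N}"
  proof (rule inj_onI)
    fix k k' assume k: "k \<in> {i<..<N}" "k' \<in> {i<..<N}" "m i - m k = m i - m k'"
    then have "m k = m k'" using m_less[of i k] m_less[of i k'] by auto
    then show "k = k'" using m_less[of k k'] m_less[of k' k] k by (cases k k' rule: linorder_cases) auto
  qed
  have disj: "h ` {..<\<nu> i} \<inter> (\<lambda>k. m i - m k) ` {i<..<N} = {}"
  proof -
    \<comment> \<open>If row \<open>k\<close> reaches column \<open>j\<close>, the leg is at least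
      \<open>k - i\<close> and the hook exceeds the difference; otherwise the leg is shorter than
      \<open>k - i\<close> and the hook falls short of it.\<close>
    have "h j \<noteq> m i - m k" if j: "j < \<nu> i" and k: "i < k" "k < N" for j k
    proof -
      have mm: "m i - m k = \<nu> i - \<nu> k + (k - i)"
        using antimonoD[OF assms(1), of i k] k by (simp add: m_def)
      show ?thesis
      proof (cases "j < \<nu> k")
        case True
        have "j < \<nu> k'" if "k' \<le> k" for k' using True antimonoD[OF assms(1) that] by simp
        then have "{i<..k} \<subseteq> {k. i < k \<and> k < N \<and> j < \<nu> k}" using k by auto
        then have "card {i<..k} \<le> leg j" unfolding leg_def by (intro card_mono) auto
        then show ?thesis using mm True antimonoD[OF assms(1), of i k] k j by (simp add: h_def leg_def)
      next
        case False
        have "\<nu> k' \<le> j" if "k \<le> k'" for k' using False antimonoD[OF assms(1) that] by simp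
        then have "{k. i < k \<and> k < N \<and> j < \<nu> k} \<subseteq> {i<..<k}" 
          by (force simp flip: not_le)
        then have "leg j \<le> card {i<..<k}" unfolding leg_def by (intro card_mono) auto
        then show ?thesis using mm False k j by (simp add: h_def leg_def)
      qed
    qed
    then show ?thesis by auto
  qed
  have sub: "h ` {..<\<nu> i} \<union> (\<lambda>k. m i - m k) ` {i<..<N} \<subseteq> {1..m i}"
  proof -
    have "h j \<in> {1..m i}" if "j < \<nu> i" for j
      using that leg_bound[of j] assms(2) unfolding h_def leg_def[symmetric] m_def by auto
    moreover have "m i - m k \<in> {1..m i}" if "k \<in> {i<..<N}" for k
      using m_less[of i k] that by auto
    ultimately show ?thesis by auto
  qed
  have "card (h ` {..<\<nu> i} \<union> (\<lambda>k. m i - m k) ` {i<..<N}) = \<nu> i + (N - 1 - i)"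
    by (subst card_Un_disjoint[OF _ _ disj]) (auto simp: card_image[OF inj_h] card_image[OF inj_d])
  also have "\<dots> = m i"
    using assms(2) by (simp add: m_def)
  finally have "card (h ` {..<\<nu> i} \<union> (\<lambda>k. m i - m k) ` {i<..<N}) = m i" .
  then have eq: "h ` {..<\<nu> i} \<union> (\<lambda>k. m i - m k) ` {i<..<N} = {1..m i}"
    using sub by (intro card_subset_eq) auto
  have "fact (m i) = \<Prod>(h ` {..<\<nu> i} \<union> (\<lambda>k. m i - m k) ` {i<..<N})"
    by (simp add: eq fact_prod)
  also have "\<dots> = \<Prod>(h ` {..<\<nu> i}) * \<Prod>((\<lambda>k. m i - m k) ` {i<..<N})"
    by (rule prod.union_disjoint) (auto simp: disj)
  also have "\<dots> = (\<Prod>j<\<nu> i. h j) * (\<Prod>k\<in>{i<..<N}. m i - m k)"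
    by (simp add: prod.reindex inj_h inj_d)
  finally show ?thesis by simp
qed

lemma card_hook:
  assumes "length \<mu> \<le> N" "j < rows \<mu> i"
  shows "card (hook \<mu> (i, j)) = rows \<mu> i - j + card {k. i < k \<and> k < N \<and> j < rows \<mu> k}"
proof -
  define L where "L = {k. i < k \<and> k < N \<and> j < rows \<mu> k}"
  have "hook \<mu> (i, j) = Pair i ` {j..<rows \<mu> i} \<union> (\<lambda>k. (k, j)) ` L"
    using assms unfolding L_def
    by (force simp: hook_def young_diagram_rows[OF assms(1)] rows_def le_less split: if_splits)
  moreover have "card (Pair i ` {j..<rows \<mu> i} \<union> (\<lambda>k. (k, j)) ` L)
      = card (Pair i ` {j..<rows \<mu> i}) + card ((\<lambda>k. (k, j)) ` L)"
    by (rule card_Un_disjoint) (auto simp: L_def)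
  ultimately show ?thesis
    by (simp add: card_image inj_on_def L_def[symmetric])
qed

text \<open>Multiply \<open>row_hooks_fact\<close> over all rows: the differences assemble to the
  Vandermonde product, the denominator of \<open>frob_hook\<close>.\<close>

theorem hook_product_eq:
  assumes "\<mu> \<in> partitions n" "length \<mu> \<le> N"
  shows "real (hook_product \<mu>) = frob_hook N (rows \<mu>)"
proof -
  define \<nu> where "\<nu> = rows \<mu>"
  have anti: "antimono \<nu>" unfolding \<nu>_def by (rule rows_antimono[OF assms(1)])
  define m where "m = (\<lambda>i. \<nu> i + N - 1 - i)"
  define h where "h i j = \<nu> i - j + card {k. i < k \<and> k < N \<and> j < \<nu> k}" for i j
  have "hook_product \<mu> = (\<Prod>i<N. \<Prod>j<\<nu> i. card (hook \<mu> (i, j)))"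
    unfolding hook_product_def young_diagram_rows[OF assms(2)] \<nu>_def
    by (subst prod.Sigma) auto
  also have "\<dots> = (\<Prod>i<N. \<Prod>j<\<nu> i. h i j)"
    using card_hook[OF assms(2)] by (intro prod.cong) (auto simp: h_def \<nu>_def)
  finally have hp: "real (hook_product \<mu>) = (\<Prod>i<N. \<Prod>j<\<nu> i. real (h i j))"
    by simp
  have "{(a, b). a < b \<and> b < N} = (SIGMA a:{..<N}. {a<..<N})" by auto
  then have "vandermonde N (row_end \<nu>) = (\<Prod>a<N. \<Prod>b\<in>{a<..<N}. row_end \<nu> a - row_end \<nu> b)"
    unfolding vandermonde_def by (simp add: prod.Sigma)
  also have "\<dots> = (\<Prod>a<N. \<Prod>b\<in>{a<..<N}. real (m a - m b))"
  proof (intro prod.cong refl)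
    fix a b assume "a \<in> {..<N}" "b \<in> {a<..<N}"
    then show "row_end \<nu> a - row_end \<nu> b = real (m a - m b)"
      using antimonoD[OF anti, of a b] by (simp add: m_def row_end_def of_nat_diff)
  qed
  finally have "real (hook_product \<mu>) * vandermonde N (row_end \<nu>)
      = (\<Prod>i<N. real ((\<Prod>j<\<nu> i. h i j) * (\<Prod>k\<in>{i<..<N}. m i - m k)))"
    unfolding hp by (simp add: prod.distrib)
  also have "\<dots> = (\<Prod>i<N. real (fact (m i)))"
    using row_hooks_fact[OF anti, of _ N] unfolding m_def h_def by (intro prod.cong) auto
  finally have "real (hook_product \<mu>) * vandermonde N (row_end \<nu>) = (\<Prod>i<N. fact (m i))"
    by simp
  moreover have "vandermonde N (row_end \<nu>) > 0"
    using row_end_less[OF anti] by (intro vandermonde_pos) auto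
  ultimately show ?thesis
    by (simp add: frob_hook_def \<nu>_def[symmetric] m_def field_simps)
qed

text \<open>Built along the tableau so that each factor meets the Jucys--Murphy element of the same
  box in \<open>JM_prod_tab_idem\<close>; by \<open>content_prod_eq\<close> it depends on the shape
  alone.\<close>

primrec content_prod :: "real \<Rightarrow> nat list \<Rightarrow> real" where
  "content_prod q [] = 1"
| "content_prod q (r # T) = content_prod q T * (q + row_end (count_list T) r)"

lemma content_prod_eq:
  assumes "set T \<subseteq> {..<N}"
  shows "content_prod q T = (\<Prod>i<N. \<Prod>j<count_list T i. q + (real j - real i))"
  using assms
proof (induction T)
  case (Cons r T)
  have r: "r \<in> {..<N}" using Cons.prems by simp
  have "(\<Prod>i\<in>{..<N}-{r}. \<Prod>j<count_list (r # T) i. q + (real j - real i))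
      = (\<Prod>i\<in>{..<N}-{r}. \<Prod>j<count_list T i. q + (real j - real i))"
    by (intro prod.cong) auto
  then show ?case
    using Cons r by (simp add: prod.remove[of _ r] row_end_def algebra_simps)
qed simp

lemma young_content_prod:
  assumes "length \<mu> \<le> N"
  shows "(\<Prod>t\<in>young_diagram \<mu>. q + of_int (content t)) = (\<Prod>i<N. \<Prod>j<rows \<mu> i. q + (real j - real i))"
  unfolding young_diagram_rows[OF assms]
  by (subst prod.Sigma) (auto simp: content_def case_prod_unfold)

section \<open>The group algebra and the Jucys--Murphy elements\<close>

text \<open>Finitely supported functions form a convolution ring over an additive monoid, so composition of
  permutations has to be written as addition.\<close>

instantiation Perm.perm :: (type) group_add
begin

definition zero_perm :: "'a perm" where "zero_perm = 1"
definition plus_perm :: "'a perm \<Rightarrow> 'a perm \<Rightarrow> 'a perm" where "plus_perm a b = a * b"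
definition uminus_perm :: "'a perm \<Rightarrow> 'a perm" where "uminus_perm a = inverse a"
definition minus_perm :: "'a perm \<Rightarrow> 'a perm \<Rightarrow> 'a perm" where "minus_perm a b = a * inverse b"

instance
  by standard (simp_all add: zero_perm_def plus_perm_def uminus_perm_def minus_perm_def mult.assoc)

end

unbundle permutation_syntax

lemma apply_zero: "apply (0::'a perm) = id"
  by (simp add: zero_perm_def)

lemma apply_plus: "apply (a + b) = apply a \<circ> apply b"
  by (simp add: plus_perm_def apply_times)

lemma apply_uminus: "apply (- a) = inv (apply a)"
  by (simp add: uminus_perm_def apply_inverse)

lemma uminus_swap: "- \<langle>a \<leftrightarrow> b\<rangle> = \<langle>a \<leftrightarrow> b\<rangle>"
  by (simp add: uminus_perm_def)

lemma swap_plus_swap: "\<langle>a \<leftrightarrow> b\<rangle> + \<langle>a \<leftrightarrow> b\<rangle> = 0"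
  by (simp add: zero_perm_def plus_perm_def)

lemma apply_swap: "\<langle>a \<leftrightarrow> b\<rangle> \<langle>$\<rangle> c = transpose a b c"
  by (simp add: swap.rep_eq)

lemma apply_eq_iff: "g \<langle>$\<rangle> a = g \<langle>$\<rangle> b \<longleftrightarrow> a = b"
  by (rule apply_inj)

text \<open>All symmetric groups are subgroups of one group of finitely supported permutations, so
  that elements of different levels multiply without embeddings.\<close>

definition symgrp :: "nat \<Rightarrow> nat perm set" where
  "symgrp n = {g. affected g \<subseteq> {1..n}}"

lemma symgrp_iff: "g \<in> symgrp n \<longleftrightarrow> (\<forall>a. a \<notin> {1..n} \<longrightarrow> g \<langle>$\<rangle> a = a)"
  by (auto simp: symgrp_def in_affected)

lemma symgrp_permutes: "g \<in> symgrp n \<longleftrightarrow> apply g permutes {1..n}"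
  using bij_apply[of g] by (auto simp: symgrp_iff permutes_def bij_iff)

lemma symgrp_bij: "bij_betw apply (symgrp n) {p. p permutes {1..n}}"
proof (rule bij_betwI')
  fix p assume "p \<in> {p. p permutes {1..n}}"
  then have p: "p permutes {1..n}" by simp
  then have "{a. p a \<noteq> a} \<subseteq> {1..n}" using permutes_not_in[OF p] by blast
  then have "bij p \<and> finite {a. p a \<noteq> a}"
    using permutes_bij[OF p] finite_subset by blast
  then have "apply (Perm p) = p" by (simp add: Perm_inverse)
  then show "\<exists>g\<in>symgrp n. p = apply g"
    using p by (intro bexI[of _ "Perm p"]) (auto simp: symgrp_permutes)
qed (auto simp: symgrp_permutes apply_inject)

lemma finite_symgrp [simp]: "finite (symgrp n)"
  using bij_betw_finite[OF symgrp_bij] finite_permutations[of "{1..n}"] by simp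

lemma card_symgrp: "card (symgrp n) = fact n"
  using bij_betw_same_card[OF symgrp_bij] card_permutations[of "{1..n}" n] by simp

lemma symgrp_zero [simp]: "0 \<in> symgrp n"
  by (simp add: symgrp_iff apply_zero)

lemma symgrp_plus: "g \<in> symgrp n \<Longrightarrow> h \<in> symgrp n \<Longrightarrow> g + h \<in> symgrp n"
  by (simp add: symgrp_iff apply_plus)

lemma symgrp_uminus_iff [simp]: "- g \<in> symgrp n \<longleftrightarrow> g \<in> symgrp n"
  by (simp add: symgrp_def uminus_perm_def)

lemma symgrp_mono: "m \<le> n \<Longrightarrow> symgrp m \<subseteq> symgrp n"
  by (auto simp: symgrp_iff)

lemma symgrp_plus_iff:
  assumes "g \<in> symgrp n"
  shows "g + h \<in> symgrp n \<longleftrightarrow> h \<in> symgrp n" "h + g \<in> symgrp n \<longleftrightarrow> h \<in> symgrp n"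
proof -
  have "g + h \<in> symgrp n \<Longrightarrow> - g + (g + h) \<in> symgrp n"
    "h + g \<in> symgrp n \<Longrightarrow> (h + g) + - g \<in> symgrp n"
    using assms by (blast intro: symgrp_plus symgrp_uminus_iff[THEN iffD2])+
  then show "g + h \<in> symgrp n \<longleftrightarrow> h \<in> symgrp n" "h + g \<in> symgrp n \<longleftrightarrow> h \<in> symgrp n"
    using assms by (auto simp: add.assoc[symmetric] intro: symgrp_plus)
qed

section \<open>The real group algebra, its involution and its trace form\<close>

type_synonym galg = "nat perm \<Rightarrow>\<^sub>0 real"

abbreviation coeffg :: "galg \<Rightarrow> nat perm \<Rightarrow> real" where
  "coeffg \<equiv> Poly_Mapping.lookup"

definition basis_elt :: "nat perm \<Rightarrow> galg" where "basis_elt g = Poly_Mapping.single g 1"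

text \<open>Real multiples are written as ring products with multiples of the unit, so that scaling
  obeys the ring laws together with centrality, \<open>scalar_commute\<close>.\<close>

definition scalar :: "real \<Rightarrow> galg" where "scalar c = Poly_Mapping.single 0 c"

lemma basis_elt_zero: "basis_elt 0 = 1" by (simp add: basis_elt_def)
lemma basis_elt_plus: "basis_elt (g + h) = basis_elt g * basis_elt h" by (simp add: basis_elt_def mult_single)
lemma scalar_0 [simp]: "scalar 0 = 0" by (simp add: scalar_def)
lemma scalar_1 [simp]: "scalar 1 = 1" by (simp add: scalar_def)
lemma scalar_add: "scalar (a + b) = scalar a + scalar b" by (simp add: scalar_def single_add)
lemma scalar_diff: "scalar (a - b) = scalar a - scalar b" by (simp add: scalar_def single_diff)
lemma scalar_uminus: "scalar (- a) = - scalar a" by (simp add: scalar_def single_uminus)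
lemma scalar_mult: "scalar (a * b) = scalar a * scalar b" by (simp add: scalar_def mult_single)

lemma scalar_sum: "scalar (sum f I) = (\<Sum>i\<in>I. scalar (f i))"
  by (induction I rule: infinite_finite_induct) (auto simp: scalar_add)


lemma scalar_basis_elt: "scalar c * basis_elt g = Poly_Mapping.single g c"
  by (simp add: scalar_def basis_elt_def mult_single)

lemma coeffg_basis_elt: "coeffg (basis_elt g) h = (if g = h then 1 else 0)"
  by (simp add: basis_elt_def lookup_single when_def)

lemma coeffg_scalar_mult [simp]: "coeffg (scalar c * x) g = c * coeffg x g"
  unfolding scalar_def mult_map_scale_conv_mult[symmetric]
  by (simp add: Poly_Mapping.map.rep_eq when_def)


lemma galg_expand:
  assumes "finite S" "Poly_Mapping.keys x \<subseteq> S"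
  shows "x = (\<Sum>g\<in>S. scalar (coeffg x g) * basis_elt g)"
proof (rule poly_mapping_eqI)
  fix h
  have "coeffg (\<Sum>g\<in>S. scalar (coeffg x g) * basis_elt g) h = (\<Sum>g\<in>S. if g = h then coeffg x g else 0)"
    by (auto simp: lookup_sum coeffg_basis_elt intro!: sum.cong)
  also have "\<dots> = coeffg x h"
    using assms by (auto simp: sum.delta in_keys_iff)
  finally show "coeffg x h = coeffg (\<Sum>g\<in>S. scalar (coeffg x g) * basis_elt g) h" by simp
qed

lemma scalar_commute: "x * scalar c = scalar c * (x :: galg)"
proof -

  define y where "y = (\<Sum>g\<in>Poly_Mapping.keys x. scalar (coeffg x g) * basis_elt g)"
  have "x = y" unfolding y_def by (rule galg_expand) auto
  moreover have "y * scalar c = scalar c * y"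
    unfolding y_def sum_distrib_left sum_distrib_right
    by (intro sum.cong refl) (simp only: scalar_basis_elt, simp add: scalar_def mult_single mult.commute)
  ultimately show ?thesis by simp
qed

lemma scalar_left_commute: "x * (scalar c * y) = scalar c * (x * (y :: galg))"
  by (metis mult.assoc scalar_commute)

lemma coeffg_basis_elt_mult: "coeffg (basis_elt g * x) h = coeffg x (- g + h)"
proof -
  have "h = g + q \<longleftrightarrow> q = - g + h" for q
    by (metis add.assoc add.left_neutral left_minus right_minus)
  moreover have "coeffg (basis_elt g * x) h = (\<Sum>l. coeffg (basis_elt g) l * (\<Sum>q. coeffg x q when h = l + q))"
    by (rule lookup_mult)
  moreover have "\<dots> = (\<Sum>l. (\<Sum>q. coeffg x q when h = l + q) when l = g)"
    by (rule Sum_any.cong) (auto simp: coeffg_basis_elt when_def)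
  ultimately show ?thesis by simp
qed

definition grp_alg :: "nat \<Rightarrow> galg set" where "grp_alg n = {x. Poly_Mapping.keys x \<subseteq> symgrp n}"

lemma grp_alg_iff: "x \<in> grp_alg n \<longleftrightarrow> (\<forall>g. g \<notin> symgrp n \<longrightarrow> coeffg x g = 0)"
  by (auto simp: grp_alg_def in_keys_iff)

lemma grp_alg_0 [simp]: "0 \<in> grp_alg n" and grp_alg_1 [simp]: "1 \<in> grp_alg n" and grp_alg_scalar [simp]: "scalar c \<in> grp_alg n"
  by (auto simp: grp_alg_def scalar_def)

lemma grp_alg_basis_elt: "g \<in> symgrp n \<Longrightarrow> basis_elt g \<in> grp_alg n"
  by (auto simp: grp_alg_def basis_elt_def)

lemma grp_alg_add: "x \<in> grp_alg n \<Longrightarrow> y \<in> grp_alg n \<Longrightarrow> x + y \<in> grp_alg n"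
  by (simp add: grp_alg_iff lookup_add)

lemma grp_alg_diff: "x \<in> grp_alg n \<Longrightarrow> y \<in> grp_alg n \<Longrightarrow> x - y \<in> grp_alg n"
  by (simp add: grp_alg_iff lookup_minus)

lemma grp_alg_mult: "x \<in> grp_alg n \<Longrightarrow> y \<in> grp_alg n \<Longrightarrow> x * y \<in> grp_alg n"
  unfolding grp_alg_def using keys_mult[of x y] symgrp_plus by fastforce

lemma grp_alg_sum: "(\<And>i. i \<in> I \<Longrightarrow> f i \<in> grp_alg n) \<Longrightarrow> sum f I \<in> grp_alg n"
  by (induction I rule: infinite_finite_induct) (auto intro: grp_alg_add)

lemma grp_alg_mono: "m \<le> n \<Longrightarrow> x \<in> grp_alg m \<Longrightarrow> x \<in> grp_alg n"
  using symgrp_mono by (auto simp: grp_alg_def)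

lemma grp_alg_expand: "x \<in> grp_alg n \<Longrightarrow> x = (\<Sum>g\<in>symgrp n. scalar (coeffg x g) * basis_elt g)"
  by (rule galg_expand) (auto simp: grp_alg_def)

lemma grp_alg_commuteI:
  assumes "x \<in> grp_alg n" "\<And>g. g \<in> symgrp n \<Longrightarrow> basis_elt g * y = y * basis_elt g"
  shows "x * y = y * x"
proof -
  have "(\<Sum>g\<in>symgrp n. scalar (coeffg x g) * basis_elt g) * y = y * (\<Sum>g\<in>symgrp n. scalar (coeffg x g) * basis_elt g)"
    unfolding sum_distrib_left sum_distrib_right
    by (intro sum.cong refl) (simp add: mult.assoc assms(2) scalar_left_commute)
  then show ?thesis using grp_alg_expand[OF assms(1)] by simp
qed

definition star :: "galg \<Rightarrow> galg" where "star x = Poly_Mapping.map_key uminus x"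

lemma coeffg_star: "coeffg (star x) g = coeffg x (- g)"
proof -
  have "inj (uminus :: nat perm \<Rightarrow> nat perm)" by (simp add: inj_def)
  then show ?thesis by (simp add: star_def map_key.rep_eq)
qed

lemma star_star [simp]: "star (star x) = x"
  by (rule poly_mapping_eqI) (simp add: coeffg_star)

lemma star_add: "star (x + y) = star x + star y"
  by (rule poly_mapping_eqI) (simp add: coeffg_star lookup_add)

lemma star_0 [simp]: "star 0 = 0"
  by (rule poly_mapping_eqI) (simp add: coeffg_star)

lemma star_sum: "star (sum f I) = (\<Sum>i\<in>I. star (f i))"
  by (induction I rule: infinite_finite_induct) (auto simp: star_add)

lemma star_basis_elt: "star (basis_elt g) = basis_elt (- g)"
  by (rule poly_mapping_eqI) (auto simp: coeffg_star coeffg_basis_elt)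

lemma star_scalar_mult: "star (scalar c * x) = scalar c * star x"
  by (rule poly_mapping_eqI) (simp add: coeffg_star)

lemma star_1 [simp]: "star 1 = 1"
  using star_basis_elt[of 0] by (simp add: basis_elt_zero)

lemma star_scalar [simp]: "star (scalar c) = scalar c"
  using star_scalar_mult[of c 1] by simp

lemma star_mult: "star (x * y) = star y * star x"
proof -
  define K L where "K = Poly_Mapping.keys x" and "L = Poly_Mapping.keys y"
  have x: "x = (\<Sum>g\<in>K. scalar (coeffg x g) * basis_elt g)" and y: "y = (\<Sum>h\<in>L. scalar (coeffg y h) * basis_elt h)"
    by (rule galg_expand; simp add: K_def L_def)+
  have *: "star (scalar a * basis_elt g * (scalar b * basis_elt h)) = scalar b * star (basis_elt h) * (scalar a * star (basis_elt g))" for a b g h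
  proof -
    have "scalar a * basis_elt g * (scalar b * basis_elt h) = scalar (a * b) * basis_elt (g + h)"
      by (simp add: scalar_basis_elt mult_single)
    then have "star (scalar a * basis_elt g * (scalar b * basis_elt h)) = scalar (b * a) * basis_elt (- h + - g)"
      by (simp add: star_scalar_mult star_basis_elt minus_add mult.commute)
    also have "\<dots> = scalar b * star (basis_elt h) * (scalar a * star (basis_elt g))"
      by (simp add: star_basis_elt scalar_basis_elt mult_single)
    finally show ?thesis .
  qed
  have "star (x * y) = (\<Sum>g\<in>K. \<Sum>h\<in>L. star (scalar (coeffg x g) * basis_elt g * (scalar (coeffg y h) * basis_elt h)))"
    by (subst x, subst y) (simp only: sum_product star_sum)
  also have "\<dots> = (\<Sum>h\<in>L. \<Sum>g\<in>K. scalar (coeffg y h) * star (basis_elt h) * (scalar (coeffg x g) * star (basis_elt g)))"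
    unfolding * by (rule sum.swap)
  also have "\<dots> = star y * star x"
    by (subst (2) x, subst (2) y) (simp only: sum_product star_sum star_scalar_mult)
  finally show ?thesis .
qed

lemma grp_alg_star: "x \<in> grp_alg n \<Longrightarrow> star x \<in> grp_alg n"
  by (simp add: grp_alg_iff coeffg_star)

text \<open>In this form an inner product vanishes as soon as the product \<open>x * star y\<close>
  does, while \<open>inner_eq\<close> identifies it with the dot product of coefficients, hence
  symmetric and positive definite on each \<open>grp_alg n\<close>.\<close>

definition inner :: "galg \<Rightarrow> galg \<Rightarrow> real" where "inner x y = coeffg (x * star y) 0"

lemma inner_eq:
  assumes "x \<in> grp_alg n"
  shows "inner x y = (\<Sum>g\<in>symgrp n. coeffg x g * coeffg y g)"
proof -
  have "inner x y = coeffg ((\<Sum>g\<in>symgrp n. scalar (coeffg x g) * basis_elt g) * star y) 0"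
    unfolding inner_def using grp_alg_expand[OF assms] by simp
  also have "\<dots> = (\<Sum>g\<in>symgrp n. coeffg x g * coeffg y g)"
    by (simp add: sum_distrib_right lookup_sum mult.assoc coeffg_basis_elt_mult coeffg_star)
  finally show ?thesis .
qed

lemma inner_self_eq_0:
  assumes "x \<in> grp_alg n" "inner x x = 0"
  shows "x = 0"
proof (rule poly_mapping_eqI)
  fix g
  have "(\<Sum>g\<in>symgrp n. coeffg x g * coeffg x g) = 0" using inner_eq[OF assms(1)] assms(2) by simp
  then have "\<forall>g\<in>symgrp n. coeffg x g * coeffg x g = 0"
    by (subst (asm) sum_nonneg_eq_0_iff) auto
  then show "coeffg x g = coeffg 0 g"
    using assms(1) by (cases "g \<in> symgrp n") (auto simp: grp_alg_iff)
qed

lemma inner_self_nonneg: "x \<in> grp_alg n \<Longrightarrow> inner x x \<ge> 0"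
  by (auto simp: inner_eq intro!: sum_nonneg)

definition poly_at :: "real poly \<Rightarrow> galg \<Rightarrow> galg" where
  "poly_at p x = fold_coeffs (\<lambda>c acc. scalar c + x * acc) p 0"

lemma poly_at_0 [simp]: "poly_at 0 x = 0"
  by (simp add: poly_at_def)

lemma poly_at_pCons [simp]: "poly_at (pCons c p) x = scalar c + x * poly_at p x"
  by (cases "c = 0 \<and> p = 0") (auto simp: poly_at_def)

lemma poly_at_1 [simp]: "poly_at 1 x = 1"
  by (simp add: one_pCons)

lemma poly_at_add: "poly_at (p + q) x = poly_at p x + poly_at q x"
  by (induction p q rule: poly_induct2) (auto simp: scalar_add algebra_simps)

lemma poly_at_smult: "poly_at (smult c p) x = scalar c * poly_at p x"
  by (induction p) (auto simp: scalar_mult distrib_left scalar_left_commute)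

lemma poly_at_diff: "poly_at (p - q) x = poly_at p x - poly_at q x"
  by (induction p q rule: poly_induct2) (auto simp: scalar_diff right_diff_distrib)

lemma poly_at_mult: "poly_at (p * q) x = poly_at p x * poly_at q x"
  by (induction p) (auto simp: poly_at_add poly_at_smult algebra_simps)

lemma poly_at_commute: "x * y = y * x \<Longrightarrow> poly_at p x * y = y * poly_at p x"
proof (induction p)
  case (pCons c p)
  then have "x * poly_at p x * y = y * (x * poly_at p x)" by (metis mult.assoc)
  then show ?case by (simp add: distrib_left distrib_right scalar_commute[of y])
qed simp

lemma poly_at_grp_alg: "x \<in> grp_alg n \<Longrightarrow> poly_at p x \<in> grp_alg n"
  by (induction p) (auto intro!: grp_alg_add grp_alg_mult)

lemma star_poly_at: "star x = x \<Longrightarrow> star (poly_at p x) = poly_at p x"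
proof (induction p)
  case (pCons c p)
  then show ?case using poly_at_commute[of x x p] by (simp add: star_add star_mult)
qed simp

lemma poly_at_eigen:
  assumes "y * x = scalar c * y"
  shows "y * poly_at p x = scalar (poly p c) * y"
proof (induction p)
  case (pCons a p)
  have "y * (x * poly_at p x) = scalar c * (y * poly_at p x)" 
    using assms by (metis mult.assoc)
  then show ?case
    using pCons.IH by (simp add: distrib_left distrib_right scalar_commute[of y] scalar_add scalar_mult mult.assoc)
qed simp

section \<open>Jucys--Murphy elements and the degenerate Hecke relation\<close>

definition JM :: "nat \<Rightarrow> galg" where "JM n = (\<Sum>i\<in>{1..<n}. basis_elt \<langle>i \<leftrightarrow> n\<rangle>)"

definition simple_refl :: "nat \<Rightarrow> galg" where "simple_refl n = basis_elt \<langle>n \<leftrightarrow> Suc n\<rangle>"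

lemma swap_in_symgrp: "1 \<le> i \<Longrightarrow> 1 \<le> j \<Longrightarrow> i \<le> n \<Longrightarrow> j \<le> n \<Longrightarrow> \<langle>i \<leftrightarrow> j\<rangle> \<in> symgrp n"
  by (auto simp: symgrp_iff apply_swap transpose_def)

lemma JM_grp_alg: "n \<le> m \<Longrightarrow> JM n \<in> grp_alg m"
  unfolding JM_def by (intro grp_alg_sum grp_alg_basis_elt swap_in_symgrp) auto

lemma star_JM: "star (JM n) = JM n"
  by (simp add: JM_def star_sum star_basis_elt uminus_swap)

lemma simple_refl_simple_refl: "simple_refl n * simple_refl n = 1"
  by (simp add: simple_refl_def flip: basis_elt_plus) (simp add: swap_plus_swap basis_elt_zero)

text \<open>Conjugation by \<open>g\<close> permutes the summands of \<open>JM (Suc n)\<close>,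
  since \<open>g\<close> fixes \<open>Suc n\<close> and permutes the points below it.\<close>

lemma basis_elt_JM_commute:
  assumes "g \<in> symgrp n"
  shows "basis_elt g * JM (Suc n) = JM (Suc n) * basis_elt g"
proof -
  have perm: "apply g permutes {1..n}" using assms by (simp add: symgrp_permutes)
  have fix': "g \<langle>$\<rangle> (Suc n) = Suc n" using assms by (simp add: symgrp_iff)
  have "g + \<langle>i \<leftrightarrow> Suc n\<rangle> = \<langle>g \<langle>$\<rangle> i \<leftrightarrow> Suc n\<rangle> + g" for i
    by (rule perm_eqI) (auto simp: apply_plus apply_swap transpose_def fix' apply_eq_iff,
      metis fix' apply_eq_iff)
  then have "basis_elt g * JM (Suc n) = (\<Sum>i\<in>{1..n}. basis_elt (\<langle>g \<langle>$\<rangle> i \<leftrightarrow> Suc n\<rangle> + g))"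
    by (simp add: JM_def sum_distrib_left atLeastLessThanSuc_atLeastAtMost flip: basis_elt_plus)
  also have "\<dots> = (\<Sum>i\<in>{1..n}. basis_elt (\<langle>i \<leftrightarrow> Suc n\<rangle> + g))"
    using sum.permute[OF perm, of "\<lambda>i. basis_elt (\<langle>i \<leftrightarrow> Suc n\<rangle> + g)"] by (simp add: o_def)
  finally show ?thesis
    by (simp add: JM_def sum_distrib_right atLeastLessThanSuc_atLeastAtMost flip: basis_elt_plus)
qed

lemma JM_commute: "x \<in> grp_alg n \<Longrightarrow> x * JM (Suc n) = JM (Suc n) * x"
  by (rule grp_alg_commuteI) (auto simp: basis_elt_JM_commute)

lemma simple_refl_commute:
  assumes "x \<in> grp_alg n"
  shows "x * simple_refl (Suc n) = simple_refl (Suc n) * x"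
proof (rule grp_alg_commuteI[OF assms])
  fix g assume g: "g \<in> symgrp n"
  have fix': "g \<langle>$\<rangle> (Suc n) = Suc n" "g \<langle>$\<rangle> (Suc (Suc n)) = Suc (Suc n)" using g by (auto simp: symgrp_iff)
  have "g + \<langle>Suc n \<leftrightarrow> Suc (Suc n)\<rangle> = \<langle>Suc n \<leftrightarrow> Suc (Suc n)\<rangle> + g"
    by (rule perm_eqI) (auto simp: apply_plus apply_swap transpose_def fix', metis fix' apply_eq_iff, metis fix' apply_eq_iff)
  then show "basis_elt g * simple_refl (Suc n) = simple_refl (Suc n) * basis_elt g"
    by (simp add: simple_refl_def flip: basis_elt_plus)
qed

text \<open>The degenerate affine Hecke relation. Conjugation by the simple transposition carries
  the summands of \<open>JM n\<close> to those of \<open>JM (Suc n)\<close> other than the simple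
  transposition itself, which squares to 1.\<close>

lemma JM_simple_refl:
  assumes "n \<ge> 1"
  shows "JM (Suc n) * simple_refl n = simple_refl n * JM n + 1"
proof -
  have J: "JM (Suc n) = (\<Sum>i\<in>{1..<n}. basis_elt \<langle>i \<leftrightarrow> Suc n\<rangle>) + simple_refl n"
    using assms by (simp add: JM_def simple_refl_def)
  have "\<langle>i \<leftrightarrow> Suc n\<rangle> + \<langle>n \<leftrightarrow> Suc n\<rangle> = \<langle>n \<leftrightarrow> Suc n\<rangle> + \<langle>i \<leftrightarrow> n\<rangle>" if "i \<in> {1..<n}" for i
    by (rule perm_eqI) (use that in \<open>auto simp: apply_plus apply_swap transpose_def\<close>)
  then have "(\<Sum>i\<in>{1..<n}. basis_elt \<langle>i \<leftrightarrow> Suc n\<rangle>) * simple_refl n = simple_refl n * JM n"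
    by (simp add: JM_def simple_refl_def sum_distrib_left sum_distrib_right flip: basis_elt_plus)
  then show ?thesis
    by (simp add: J distrib_right simple_refl_simple_refl)
qed

lemma JM_1: "JM (Suc 0) = 0"
  by (simp add: JM_def)

section \<open>Idempotents indexed by standard tableaux\<close>

lemma keys_multE:
  assumes "coeffg (x * y) h \<noteq> 0"
  obtains g k where "h = g + k" "coeffg x g \<noteq> 0" "coeffg y k \<noteq> 0"
  using assms keys_mult[of x y] by (fastforce simp: in_keys_iff subset_iff)

lemma swap_notin_symgrp: "n \<ge> 1 \<Longrightarrow> \<langle>n \<leftrightarrow> Suc n\<rangle> \<notin> symgrp n"
  by (auto simp: symgrp_iff apply_swap intro!: exI[of _ "Suc n"])

lemma coeffg_mult_basis_elt: "coeffg (x * basis_elt g) h = coeffg x (h + - g)"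
proof -
  have "x * basis_elt g = star (basis_elt (- g) * star x)"
    by (simp add: star_mult star_basis_elt)
  then show ?thesis
    by (simp add: coeffg_star coeffg_basis_elt_mult minus_add)
qed

lemma grp_alg_coeffg: "x \<in> grp_alg n \<Longrightarrow> coeffg x g \<noteq> 0 \<Longrightarrow> g \<in> symgrp n"
  by (auto simp: grp_alg_iff)

text \<open>The product is supported on the double coset of the simple transposition, which is
  disjoint from the subgroup.\<close>

lemma coeffg_simple_refl_sandwich:
  assumes "x \<in> grp_alg n" "y \<in> grp_alg n" "h \<in> symgrp n" "n \<ge> 1"
  shows "coeffg (x * simple_refl n * y) h = 0"
proof (rule ccontr)
  define t where "t = \<langle>n \<leftrightarrow> Suc n\<rangle>"
  assume "coeffg (x * simple_refl n * y) h \<noteq> 0"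
  then obtain g k where gk: "h = g + k" "coeffg (x * simple_refl n) g \<noteq> 0" "coeffg y k \<noteq> 0"
    by (rule keys_multE)
  then have "coeffg x (g + - t) \<noteq> 0" by (simp add: simple_refl_def t_def coeffg_mult_basis_elt)
  then have "g + - t \<in> symgrp n" "k \<in> symgrp n"
    using assms(1,2) gk grp_alg_coeffg by blast+
  moreover have "g \<in> symgrp n"
    using gk(1) assms(3) symgrp_plus_iff(2)[OF \<open>k \<in> symgrp n\<close>] by simp
  ultimately have "t \<in> symgrp n"
    using symgrp_plus_iff(1)[of g n "- t"] by simp
  then have "\<langle>n \<leftrightarrow> Suc n\<rangle> \<in> symgrp n" by (simp add: t_def)
  then show False using swap_notin_symgrp[OF assms(4)] by simp
qed

text \<open>Conjugating a permutation that moves \<open>Suc m\<close> by the simple transposition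
  gives one that moves \<open>Suc (Suc m)\<close>. Hence only the part of \<open>y\<close> on
  \<open>symgrp m\<close> could reach \<open>symgrp (Suc m)\<close>, and that part is 0.\<close>

lemma coeffg_simple_refl_conj:
  assumes "x \<in> grp_alg (Suc m)" "y \<in> grp_alg (Suc m)" "\<And>k. k \<in> symgrp m \<Longrightarrow> coeffg y k = 0" "h \<in> symgrp (Suc m)"
  shows "coeffg (x * simple_refl (Suc m) * y * simple_refl (Suc m)) h = 0"
proof (rule ccontr)
  define t where "t = \<langle>Suc m \<leftrightarrow> Suc (Suc m)\<rangle>"
  assume "coeffg (x * simple_refl (Suc m) * y * simple_refl (Suc m)) h \<noteq> 0"
  then have "coeffg (x * simple_refl (Suc m) * y) (h + - t) \<noteq> 0"
    by (simp add: simple_refl_def t_def coeffg_mult_basis_elt)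
  then obtain g' k where g'k: "h + - t = g' + k" "coeffg (x * simple_refl (Suc m)) g' \<noteq> 0" and k: "coeffg y k \<noteq> 0"
    by (rule keys_multE)
  then have g': "h + - t = g' + k" "coeffg x (g' + - t) \<noteq> 0"
    by (simp_all add: simple_refl_def t_def coeffg_mult_basis_elt)
  define g where "g = g' + - t"
  have "h = (h + - t) + t" by (simp add: add.assoc)
  also have "\<dots> = g + t + k + t" unfolding g'(1) by (simp add: g_def add.assoc)
  finally have "h = g + t + k + t" .
  moreover have "g \<in> symgrp (Suc m)" "k \<in> symgrp (Suc m)"
    using g' k assms(1,2) grp_alg_coeffg by (auto simp: g_def)
  ultimately have gk: "h = g + t + k + t" "g \<in> symgrp (Suc m)" "k \<in> symgrp (Suc m)" "coeffg y k \<noteq> 0"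
    using k by auto
  then have "g + (t + k + t) \<in> symgrp (Suc m)"
    using assms(4) by (simp add: add.assoc)
  then have "t + k + t \<in> symgrp (Suc m)"
    using symgrp_plus_iff(1)[OF gk(2)] by blast
  then have "(t + k + t) \<langle>$\<rangle> (Suc (Suc m)) = Suc (Suc m)"
    by (auto simp: symgrp_iff)
  then have "t \<langle>$\<rangle> (k \<langle>$\<rangle> (Suc m)) = Suc (Suc m)"
    by (simp add: apply_plus t_def)
  then have "k \<langle>$\<rangle> (Suc m) = Suc m"
    unfolding t_def by simp
  moreover have "k \<langle>$\<rangle> a = a" if "a \<notin> {1..Suc m}" for a
    using gk(3) that by (auto simp: symgrp_iff)
  ultimately have "k \<in> symgrp m"
    by (auto simp: symgrp_iff) (metis Suc_leI le_SucE not_less_eq_eq)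
  with assms(3) gk(4) show False by blast
qed

text \<open>In general f(J) s is s f(a) plus the divided difference (f(J) - f(a)) / (J - a).
  Directly after \<open>e\<close> the element \<open>a\<close> counts as \<open>c\<close>, so for f
  = (x - c) u the divided difference becomes u(J). The induction on \<open>u\<close> proves this
  without a notion of divided difference.\<close>

lemma hecke_shift:
  assumes eJ: "e * J = J * e" and ea: "e * a = scalar c * e" and Js: "J * s = s * a + (1 :: galg)"
  shows "e * ((J - scalar c) * poly_at u J) * s = e * s * ((a - scalar c) * poly_at u a) + e * poly_at u J"
proof (induction u)
  case (pCons b v)
  define C where "C = scalar c"
  define V where "V = poly_at v J"
  define W where "W = (a - C) * poly_at v a"
  have comm: "x * C = C * x" for x unfolding C_def by (rule scalar_commute)
  have lcomm: "x * (C * y) = C * (x * y)" for x y unfolding C_def by (rule scalar_left_commute)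
  have "e * ((J - C) * scalar b) * s = scalar b * (e * (J * s) - C * (e * s))"
  proof -
    have "e * ((J - C) * scalar b) * s = scalar b * (e * (J - C) * s)"
      by (simp only: scalar_commute[of "J - C"] scalar_left_commute[of e] mult.assoc)
    also have "e * (J - C) * s = e * (J * s) - C * (e * s)"
      by (simp add: right_diff_distrib left_diff_distrib mult.assoc[symmetric] comm[of e])
    finally show ?thesis .
  qed
  also have "\<dots> = scalar b * (e * s * (a - C) + e)"
    by (simp add: Js distrib_left right_diff_distrib mult.assoc comm[of s] lcomm[of e])
  finally have "e * ((J - C) * scalar b) * s = scalar b * (e * s * (a - C) + e)" .
  then have 1: "e * ((J - C) * scalar b) * s = e * s * ((a - C) * scalar b) + e * scalar b"
  proof -
    have "e * s * ((a - C) * scalar b) = scalar b * (e * s * (a - C))"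
      by (simp only: scalar_commute[of "a - C"] scalar_left_commute)
    moreover have "e * scalar b = scalar b * e" by (rule scalar_commute)
    ultimately show ?thesis using \<open>e * ((J - C) * scalar b) * s = scalar b * (e * s * (a - C) + e)\<close>
      by (simp only: distrib_left)
  qed
  have W0: "e * W = 0"
    unfolding W_def by (simp add: right_diff_distrib mult.assoc[symmetric] ea C_def scalar_commute[of e])
  have "(J - C) * (J * V) = J * ((J - C) * V)"
    by (simp add: left_diff_distrib right_diff_distrib mult.assoc lcomm[of J])
  then have "e * ((J - C) * (J * V)) * s = J * (e * ((J - C) * V) * s)"
    by (metis eJ mult.assoc)
  also have "\<dots> = J * (e * s * W + e * V)"
    using pCons.IH by (simp add: V_def W_def C_def)
  also have "\<dots> = e * (J * s) * W + e * (J * V)"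
    by (simp add: distrib_left mult.assoc[symmetric] eJ[symmetric])
  also have "\<dots> = e * s * (a * W) + e * (J * V)"
    using W0 by (simp add: Js distrib_left distrib_right mult.assoc)
  also have "a * W = (a - C) * (a * poly_at v a)"
    by (simp add: W_def left_diff_distrib right_diff_distrib mult.assoc lcomm[of a])
  finally have 2: "e * ((J - C) * (J * V)) * s = e * s * ((a - C) * (a * poly_at v a)) + e * (J * V)" .
  show ?case
    using 1 2 by (simp add: distrib_left distrib_right V_def C_def)
qed simp

text \<open>Insert \<open>s * s = 1\<close> and move (x - c)^2 u past \<open>s\<close> by two
  applications of \<open>hecke_shift\<close>. A term \<open>e * poly_at u J\<close> is left over,
  and bringing it to the other side produces (x - c)^2 - 1.\<close>

lemma hecke_transfer:
  assumes "e * J = J * e" "e * a = scalar c * e" "J * s = s * a + (1 :: galg)" "s * s = 1"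
  shows "e * poly_at ([:c\<^sup>2 - 1, - 2 * c, 1:] * u) J
    = e * s * poly_at ([:- c, 1:] * ([:- c, 1:] * u)) a * s + e * s * poly_at ([:- c, 1:] * u) a"
proof -
  define q where "q = [:- c, 1:] * u"
  have lin: "poly_at ([:- c, 1:] * v) x = (x - scalar c) * poly_at v x" for v x
    by (simp only: poly_at_mult) (simp add: scalar_uminus)
  have "[:c\<^sup>2 - 1, - 2 * c, 1:] = [:- c, 1:] * [:- c, 1:] - 1"
    by (simp add: power2_eq_square one_pCons)
  then have D: "[:c\<^sup>2 - 1, - 2 * c, 1:] * u = [:- c, 1:] * q - u"
    by (simp only: q_def left_diff_distrib mult.assoc mult_1)
  have "e * poly_at ([:- c, 1:] * q) J = e * ((J - scalar c) * poly_at q J) * s * s"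
    by (simp only: lin mult.assoc assms(4) mult_1_right)
  also have "\<dots> = e * s * poly_at ([:- c, 1:] * q) a * s + e * poly_at q J * s"
    by (simp only: hecke_shift[OF assms(1-3)] lin distrib_right)
  also have "e * poly_at q J * s = e * s * poly_at q a + e * poly_at u J"
    unfolding q_def lin by (rule hecke_shift[OF assms(1-3)])
  finally show ?thesis
    unfolding D poly_at_diff right_diff_distrib q_def by simp
qed

section \<open>Lagrange idempotents and the moments of the next Jucys--Murphy element\<close>

abbreviation next_content :: "nat list \<Rightarrow> nat \<Rightarrow> real" where
  "next_content T \<equiv> row_end (count_list T)"

text \<open>The bound keeps the set finite for every list; by \<open>addable_rows_iff\<close> all
  rows that a standard tableau can extend lie within it.\<close>

definition addable_rows :: "nat list \<Rightarrow> nat set" where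
  "addable_rows T = {r\<in>{..length T}. antimono (count_list (r # T))}"

lemma finite_addable_rows [simp]: "finite (addable_rows T)"
  by (simp add: addable_rows_def)

lemma standard_Cons_iff: "standard (r # T) \<longleftrightarrow> standard T \<and> r \<in> addable_rows T"
  using standard_row_less[of "r # T" r] by (auto simp: addable_rows_def)

lemmas standard_ConsD = standard_Cons_iff[THEN iffD1]

lemma addable_rows_iff: "standard T \<Longrightarrow> r \<in> addable_rows T \<longleftrightarrow> antimono (count_list (r # T))"
  using standard_Cons_iff[of r T] by auto

definition content_lagrange :: "nat list \<Rightarrow> nat \<Rightarrow> real poly" where
  "content_lagrange T r = (\<Prod>s\<in>addable_rows T - {r}. smult (1 / (next_content T r - next_content T s)) [:- next_content T s, 1:])"

lemma poly_content_lagrange: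
  assumes "standard T" "r \<in> addable_rows T" "s \<in> addable_rows T"
  shows "poly (content_lagrange T r) (next_content T s) = (if s = r then 1 else 0)"
proof (cases "s = r")
  case True
  have "next_content T r \<noteq> next_content T k" if "k \<noteq> r" for k
    using row_end_eq_iff[OF standard_antimono[OF assms(1)]] that by simp
  then have "poly (content_lagrange T r) (next_content T r) = (\<Prod>s\<in>addable_rows T - {r}. 1)"
    unfolding content_lagrange_def poly_prod
    by (intro prod.cong) (auto simp flip: diff_divide_distrib)
  then show ?thesis using True by simp
next
  case False
  then show ?thesis
    unfolding content_lagrange_def poly_prod using assms(3) by (auto intro!: prod_zero bexI[of _ s])
qed

text \<open>Young's seminormal idempotents. Each factor interpolates the projection to one
  eigenvalue of the next Jucys--Murphy element; that the addable contents exhaust these eigenvalues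
  is the content of \<open>tab_idem_vanish\<close>.\<close>

primrec tab_idem :: "nat list \<Rightarrow> galg" where
  "tab_idem [] = 1"
| "tab_idem (r # T) = tab_idem T * poly_at (content_lagrange T r) (JM (Suc (length T)))"

lemma tab_idem_grp_alg: "tab_idem T \<in> grp_alg (length T)"
proof (induction T)
  case (Cons r T)
  then have "tab_idem T \<in> grp_alg (Suc (length T))" by (rule grp_alg_mono[rotated]) simp
  then show ?case by (auto intro!: grp_alg_mult poly_at_grp_alg JM_grp_alg)
qed simp

lemma tab_idem_commute: "poly_at p (JM (Suc (length T))) * tab_idem T = tab_idem T * poly_at p (JM (Suc (length T)))"
  using JM_commute[OF tab_idem_grp_alg] by (intro poly_at_commute) simp

lemma star_tab_idem: "star (tab_idem T) = tab_idem T"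
  by (induction T) (auto simp: star_mult star_poly_at star_JM tab_idem_commute)

text \<open>The expectation of \<open>p\<close> under the transition measure of the shape of
  \<open>T\<close>. Rows that admit no box have weight 0, so the sum may run over all
  \<open>i < N\<close>.\<close>

definition trans_moment :: "nat \<Rightarrow> nat list \<Rightarrow> real poly \<Rightarrow> real" where
  "trans_moment N T p = (\<Sum>i<N. growth_weight N (count_list T) i * poly p (next_content T i))"

lemma trans_moment_cong:
  assumes "standard T" "\<And>s. s \<in> addable_rows T \<Longrightarrow> poly p (next_content T s) = poly q (next_content T s)"
  shows "trans_moment N T p = trans_moment N T q"
  unfolding trans_moment_def
proof (rule sum.cong)
  fix i assume i: "i \<in> {..<N}"
  show "growth_weight N (count_list T) i * poly p (next_content T i) = growth_weight N (count_list T) i * poly q (next_content T i)"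
  proof (cases "i \<in> addable_rows T")
    case True
    then show ?thesis using assms(2) by simp
  next
    case False
    then have "growth_weight N (count_list T) i = 0"
      using growth_weight_nonaddable[OF standard_antimono[OF assms(1)], of i N] i
      by (simp add: addable_rows_iff[OF assms(1)] count_list_Cons)
    then show ?thesis by simp
  qed
qed simp

lemma trans_moment_add: "trans_moment N T (p + q) = trans_moment N T p + trans_moment N T q"
  by (simp add: trans_moment_def algebra_simps sum.distrib)

lemma trans_moment_linear:
  assumes "standard T" "length T < N"
  shows "trans_moment N T [:b, d:] = b"
proof -
  have w: "(\<Sum>i<N. growth_weight N (count_list T) i) = 1"
      "(\<Sum>i<N. growth_weight N (count_list T) i * next_content T i) = 0"
    using growth_weight_moments[OF standard_antimono[OF assms(1)], of N] assms
      standard_count_eq_0[OF assms(1), of "N - 1"] by auto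
  have "trans_moment N T [:b, d:] = (\<Sum>i<N. growth_weight N (count_list T) i * b + d * (growth_weight N (count_list T) i * next_content T i))"
    unfolding trans_moment_def by (intro sum.cong) (auto simp: algebra_simps)
  also have "\<dots> = b" 
    by (simp add: sum.distrib sum_distrib_left[symmetric] sum_distrib_right[symmetric] w)
  finally show ?thesis .
qed

text \<open>The recursion of \<open>hecke_transfer\<close> on the side of the measure, namely
  \<open>growth_weight_step\<close> summed over the rows.\<close>

lemma trans_moment_step:
  assumes "standard (r # T)" "length T < N"
  defines "c \<equiv> next_content T r"
  shows "trans_moment N (r # T) ([:c\<^sup>2 - 1, - 2 * c, 1:] * u) = trans_moment N T ([:- c, 1:] * ([:- c, 1:] * u))"
proof -
  have r: "r < N" using assms(1,2) standard_row_less[of "r # T" r] by simp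
  show ?thesis
    unfolding trans_moment_def
  proof (rule sum.cong)
    fix i assume "i \<in> {..<N}"
    moreover have "antimono (count_list T)" "antimono ((count_list T)(r := Suc (count_list T r)))"
      using assms(1) standard_antimono by (auto simp: count_list_Cons[symmetric])
    ultimately show "growth_weight N (count_list (r # T)) i * poly ([:c\<^sup>2 - 1, - 2 * c, 1:] * u) (next_content (r # T) i)
      = growth_weight N (count_list T) i * poly ([:- c, 1:] * ([:- c, 1:] * u)) (next_content T i)"
      using growth_weight_step[of "count_list T" r N i "poly u"] r
      by (simp add: count_list_Cons c_def) (simp add: algebra_simps power2_eq_square)
  qed simp
qed

text \<open>The trace of \<open>star y * y\<close> is governed by the moment of
  \<open>q * q\<close>, which is 0; positivity then forces \<open>y = 0\<close>. The moment formula
  enters as a hypothesis because the lemma is applied inside the very induction that proves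
  it.\<close>

lemma tab_idem_vanish_aux:
  assumes main: "\<And>p h. h \<in> symgrp (length T) \<Longrightarrow>
      coeffg (tab_idem T * poly_at p (JM (Suc (length T)))) h = trans_moment N T p * coeffg (tab_idem T) h"
    and "standard T" "\<And>s. s \<in> addable_rows T \<Longrightarrow> poly q (next_content T s) = 0"
  shows "tab_idem T * poly_at q (JM (Suc (length T))) = 0"
proof -
  define J where "J = JM (Suc (length T))"
  define y where "y = poly_at q J * tab_idem T"
  have y: "y = tab_idem T * poly_at q J"
    unfolding y_def J_def by (rule tab_idem_commute)
  have yA: "y \<in> grp_alg (Suc (length T))"
    unfolding y_def J_def by (intro grp_alg_mult poly_at_grp_alg JM_grp_alg grp_alg_mono[OF _ tab_idem_grp_alg]) auto
  have "star y = tab_idem T * poly_at q J"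
    unfolding y_def J_def by (simp add: star_mult star_tab_idem star_poly_at star_JM)
  then have "star y * y = tab_idem T * poly_at q J * (poly_at q J * tab_idem T)" by (simp add: y_def)
  also have "\<dots> = tab_idem T * (poly_at (q * q) J * tab_idem T)" by (simp add: poly_at_mult mult.assoc)
  also have "poly_at (q * q) J * tab_idem T = tab_idem T * poly_at (q * q) J"
    unfolding J_def by (rule tab_idem_commute)
  finally have "star y * star (star y) = tab_idem T * (tab_idem T * poly_at (q * q) J)" by simp
  \<comment> \<open>Idempotence is not yet available to merge the two copies of
    \<open>tab_idem T\<close>. The identity coefficient, however, sees the right factor only on
    \<open>symgrp (length T)\<close>, where \<open>main\<close> applies.\<close>
  moreover have "coeffg (tab_idem T * (tab_idem T * poly_at (q * q) J)) 0 = 0"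
  proof -
    have 0: "trans_moment N T (q * q) = 0"
      using trans_moment_cong[OF assms(2), of "q * q" 0 N] assms(3) by (simp add: trans_moment_def)
    have "coeffg (tab_idem T * poly_at (q * q) J) h = 0" if "h \<in> symgrp (length T)" for h
      using main[OF that] 0 by (simp add: J_def)
    moreover have "coeffg (tab_idem T * (tab_idem T * poly_at (q * q) J)) 0 = inner (tab_idem T) (star (tab_idem T * poly_at (q * q) J))"
      by (simp add: inner_def)
    ultimately show ?thesis
      unfolding inner_eq[OF tab_idem_grp_alg] by (simp add: coeffg_star)
  qed
  ultimately have "inner (star y) (star y) = 0" by (simp add: inner_def)
  then have "star y = 0" using inner_self_eq_0 grp_alg_star[OF yA] by blast
  then have "y = 0" by (metis star_star star_0)
  then show ?thesis using y J_def by simp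
qed

text \<open>The Lagrange polynomial times x - \<open>next_content T r\<close> vanishes at every
  addable content.\<close>

lemma tab_idem_eigen_aux:
  assumes vanish: "\<And>q. (\<And>s. s \<in> addable_rows T \<Longrightarrow> poly q (next_content T s) = 0) \<Longrightarrow> tab_idem T * poly_at q (JM (Suc (length T))) = 0"
    and "standard (r # T)"
  shows "tab_idem (r # T) * JM (Suc (length T)) = scalar (next_content T r) * tab_idem (r # T)"
proof -
  define J where "J = JM (Suc (length T))"
  have "tab_idem T * poly_at ([:- next_content T r, 1:] * content_lagrange T r) J = 0"
    unfolding J_def using poly_content_lagrange[of T r] standard_ConsD[OF assms(2)] by (intro vanish) auto
  moreover have "poly_at ([:- next_content T r, 1:] * content_lagrange T r) J = poly_at (content_lagrange T r) J * poly_at [:- next_content T r, 1:] J"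
    by (simp only: poly_at_mult[symmetric] mult.commute)
  moreover have "poly_at [:- next_content T r, 1:] J = J - scalar (next_content T r)"
    by (simp add: scalar_uminus)
  ultimately have "tab_idem T * (poly_at (content_lagrange T r) J * (J - scalar (next_content T r))) = 0" by simp
  then show ?thesis
    by (simp add: J_def right_diff_distrib mult.assoc scalar_commute[of "poly_at _ _"] scalar_left_commute)
qed

text \<open>With c the content of the last box, division by (x - c)^2 - 1 leaves linear polynomials,
  settled by mass 1 and mean 0, and multiples of the divisor, which \<open>hecke_transfer\<close>
  moves one level down. The claim covers all of \<open>symgrp (length T)\<close> and not only the
  identity, because \<open>coeffg_simple_refl_conj\<close> asks for vanishing on the whole
  subgroup.\<close>

theorem tab_idem_moment:
  assumes "standard T" "length T < N" "h \<in> symgrp (length T)"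
  shows "coeffg (tab_idem T * poly_at p (JM (Suc (length T)))) h = trans_moment N T p * coeffg (tab_idem T) h"
  using assms
proof (induction T arbitrary: p h)
  case Nil
  have "1 * poly_at p 0 = scalar (poly p 0) * 1" by (rule poly_at_eigen) simp
  then have "coeffg (poly_at p 0) h = poly p 0 * coeffg 1 h"
    using coeffg_scalar_mult[of "poly p 0" 1 h] by simp
  moreover have "trans_moment N [] p = poly p 0"
  proof -
    have 0: "count_list [] = (\<lambda>_. 0)" by auto
    have "trans_moment N [] p = (\<Sum>i<N. if i = 0 then poly p 0 else 0)"
      unfolding trans_moment_def 0 by (intro sum.cong) (auto simp: growth_weight_empty row_end_def)
    then show ?thesis using Nil by (simp add: sum.delta)
  qed
  ultimately show ?case by (simp add: JM_1)
next
  case (Cons r T)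
  define m where "m = length T"
  define e where "e = tab_idem (r # T)"
  define a where "a = JM (Suc m)"
  define J where "J = JM (Suc (Suc m))"
  define s where "s = simple_refl (Suc m)"
  define c where "c = next_content T r"
  have std: "standard T" and len: "length T < N" and h: "h \<in> symgrp (Suc m)"
    using Cons.prems by (auto simp: m_def)
  note IH = Cons.IH[OF std len, folded m_def a_def]
  \<comment> \<open>The eigenvalue of \<open>a\<close> on \<open>e\<close> rests on moments over
    \<open>T\<close> alone, which the induction hypothesis provides.\<close>
  have vanish: "tab_idem T * poly_at q (JM (Suc (length T))) = 0"
    if "\<And>s. s \<in> addable_rows T \<Longrightarrow> poly q (next_content T s) = 0" for q
    using tab_idem_vanish_aux[of T N q] IH std that by (simp add: m_def a_def)
  have ea: "e * a = scalar c * e"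
    unfolding e_def a_def c_def m_def by (rule tab_idem_eigen_aux[OF vanish Cons.prems(1)])
  have eA: "e \<in> grp_alg (Suc m)" using tab_idem_grp_alg[of "r # T"] by (simp add: e_def m_def)
  have eJ: "e * J = J * e" unfolding J_def by (rule JM_commute[OF eA])
  have Js: "J * s = s * a + 1" unfolding J_def s_def a_def by (rule JM_simple_refl) simp
  have ss: "s * s = 1" unfolding s_def by (rule simple_refl_simple_refl)
  have linear: "coeffg (e * poly_at [:b, d:] J) h = trans_moment N (r # T) [:b, d:] * coeffg e h" for b d
  proof -
    \<comment> \<open>Every summand of \<open>J\<close> moves \<open>Suc (Suc m)\<close>, so
      \<open>e * J\<close> is supported off \<open>symgrp (Suc m)\<close>. This matches the mean 0
      of the weights.\<close>
    have "coeffg (e * J) h = 0"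
    proof -
      have "e * J = (\<Sum>i\<in>{1..Suc m}. e * basis_elt \<langle>i \<leftrightarrow> Suc (Suc m)\<rangle>)"
        by (simp only: J_def JM_def sum_distrib_left atLeastLessThanSuc_atLeastAtMost)
      moreover have "coeffg (e * basis_elt \<langle>i \<leftrightarrow> Suc (Suc m)\<rangle>) h = 0" if i: "i \<in> {1..Suc m}" for i
      proof (rule ccontr)
        assume "coeffg (e * basis_elt \<langle>i \<leftrightarrow> Suc (Suc m)\<rangle>) h \<noteq> 0"
        then have "h + - \<langle>i \<leftrightarrow> Suc (Suc m)\<rangle> \<in> symgrp (Suc m)"
          using eA grp_alg_coeffg by (simp add: coeffg_mult_basis_elt)
        then have "\<langle>i \<leftrightarrow> Suc (Suc m)\<rangle> \<in> symgrp (Suc m)"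
          using symgrp_plus_iff(1)[OF h] by (simp add: uminus_swap)
        then have "\<langle>i \<leftrightarrow> Suc (Suc m)\<rangle> \<langle>$\<rangle> (Suc (Suc m)) = Suc (Suc m)"
          by (auto simp: symgrp_iff simp del: apply_swap_simp apply_swap_eq_iff)
        then show False using i by simp
      qed
      ultimately show ?thesis by (simp add: lookup_sum lookup_add)
    qed
    moreover have "e * poly_at [:b, d:] J = scalar b * e + scalar d * (e * J)"
      by (simp add: distrib_left scalar_commute[of e] scalar_commute[of J] scalar_left_commute)
    ultimately show ?thesis
      using trans_moment_linear[OF Cons.prems(1,2)] by (simp add: lookup_add)
  qed
  have quadratic: "coeffg (e * poly_at ([:c\<^sup>2 - 1, - 2 * c, 1:] * u) J) h
      = trans_moment N (r # T) ([:c\<^sup>2 - 1, - 2 * c, 1:] * u) * coeffg e h" for u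
  proof -
    define P where "P = [:- c, 1:] * ([:- c, 1:] * u)"
    define L where "L = trans_moment N T P"
    define l where "l = poly_at (content_lagrange T r) a"
    \<comment> \<open>The deviation from the mean. By induction it vanishes on
      \<open>symgrp m\<close>, so between two copies of \<open>s\<close> it contributes nothing on
      \<open>symgrp (Suc m)\<close>, and only the mean \<open>L\<close> survives.\<close>
    define y where "y = tab_idem T * poly_at P a - scalar L * tab_idem T"
    have aA: "poly_at p a \<in> grp_alg (Suc m)" for p unfolding a_def by (intro poly_at_grp_alg JM_grp_alg) simp
    have EA: "tab_idem T \<in> grp_alg (Suc m)" using tab_idem_grp_alg[of T] by (rule grp_alg_mono[rotated]) (simp add: m_def)
    have el: "e = l * tab_idem T" unfolding e_def l_def a_def m_def using tab_idem_commute[of "content_lagrange T r" T] by simp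
    have Es: "tab_idem T * s = s * tab_idem T" unfolding s_def by (rule simple_refl_commute) (use tab_idem_grp_alg[of T] in \<open>simp add: m_def\<close>)
    have yA: "y \<in> grp_alg (Suc m)" unfolding y_def by (intro grp_alg_diff grp_alg_mult aA EA grp_alg_scalar)
    have "coeffg y k = 0" if "k \<in> symgrp m" for k
      using IH[of k P] that by (simp add: y_def L_def lookup_minus a_def)
    then have 1: "coeffg (l * s * y * s) h = 0"
      unfolding s_def l_def by (intro coeffg_simple_refl_conj aA yA h)
    have "e * s * poly_at P a * s = l * s * (tab_idem T * poly_at P a) * s"
      unfolding el by (metis Es mult.assoc)
    also have "\<dots> = l * s * y * s + l * s * (scalar L * tab_idem T) * s"
      by (simp add: y_def right_diff_distrib left_diff_distrib)
    also have "l * s * (scalar L * tab_idem T) * s = scalar L * (l * (s * (tab_idem T * s)))"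
      by (simp add: mult.assoc scalar_left_commute)
    also have "\<dots> = scalar L * e"
      by (simp only: Es el mult.assoc[of s s, symmetric] ss mult_1)
    finally have "coeffg (e * s * poly_at P a * s) h = L * coeffg e h"
      using 1 by (simp add: lookup_add)
    moreover have "coeffg (e * s * poly_at ([:- c, 1:] * u) a) h = 0"
      unfolding s_def by (rule coeffg_simple_refl_sandwich[OF eA aA h]) simp
    moreover have "L = trans_moment N (r # T) ([:c\<^sup>2 - 1, - 2 * c, 1:] * u)"
      unfolding L_def P_def c_def using trans_moment_step[OF Cons.prems(1) len] by simp
    ultimately show ?thesis
      unfolding hecke_transfer[OF eJ ea Js ss] by (simp add: lookup_add P_def)
  qed
  define D where "D = [:c\<^sup>2 - 1, - 2 * c, 1:]"
  have "degree (p mod D) < 2"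
    using degree_mod_less[of D p] by (auto simp: D_def)
  then have "p mod D = [:coeff (p mod D) 0, coeff (p mod D) 1:]"
    by (intro poly_eqI) (auto simp: coeff_pCons coeff_eq_0 split: nat.splits)
  then obtain b d where "p = D * (p div D) + [:b, d:]"
    by (metis mult_div_mod_eq)
  then obtain u where p: "p = D * u + [:b, d:]" by blast
  have "coeffg (e * poly_at p J) h = trans_moment N (r # T) p * coeffg e h"
    unfolding p poly_at_add trans_moment_add distrib_left lookup_add
    using quadratic[of u] linear[of b d] by (simp add: D_def distrib_right)
  then show ?case by (simp add: e_def J_def m_def)
qed

section \<open>Eigenvalues, orthogonality and traces of the idempotents\<close>

theorem tab_idem_vanish:
  assumes "standard T" "\<And>s. s \<in> addable_rows T \<Longrightarrow> poly q (next_content T s) = 0"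
  shows "tab_idem T * poly_at q (JM (Suc (length T))) = 0"
  using tab_idem_vanish_aux[OF tab_idem_moment[of T "Suc (length T)"]] assms by simp

lemma tab_idem_cong:
  assumes "standard T" "\<And>s. s \<in> addable_rows T \<Longrightarrow> poly p (next_content T s) = poly q (next_content T s)"
  shows "tab_idem T * poly_at p (JM (Suc (length T))) = tab_idem T * poly_at q (JM (Suc (length T)))"
  using tab_idem_vanish[of T "p - q"] assms by (simp add: poly_at_diff right_diff_distrib)

lemma tab_idem_eigen:
  assumes "standard (r # T)"
  shows "tab_idem (r # T) * JM (Suc (length T)) = scalar (next_content T r) * tab_idem (r # T)"
  using tab_idem_eigen_aux[OF tab_idem_vanish] assms by auto

text \<open>A Lagrange polynomial and its square agree at all addable contents.\<close>

lemma tab_idem_idem: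
  assumes "standard T"
  shows "tab_idem T * tab_idem T = tab_idem T"
  using assms
proof (induction T)
  case (Cons r T)
  define x where "x = poly_at (content_lagrange T r) (JM (Suc (length T)))"
  have "tab_idem (r # T) * tab_idem (r # T) = tab_idem T * (x * tab_idem T) * x"
    by (simp add: x_def mult.assoc)
  also have "x * tab_idem T = tab_idem T * x" unfolding x_def by (rule tab_idem_commute)
  also have "tab_idem T * (tab_idem T * x) * x = (tab_idem T * tab_idem T) * poly_at (content_lagrange T r * content_lagrange T r) (JM (Suc (length T)))"
    by (simp add: x_def poly_at_mult mult.assoc)
  also have "tab_idem T * tab_idem T = tab_idem T" using Cons by simp
  also have "tab_idem T * poly_at (content_lagrange T r * content_lagrange T r) (JM (Suc (length T))) = tab_idem (r # T)"
    using poly_content_lagrange[of T r] standard_ConsD[OF Cons.prems] by (simp, intro tab_idem_cong) auto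
  finally show ?case .
qed simp

text \<open>Two tableaux differ either before the last box or only in that box; in the latter case
  the product of their Lagrange polynomials vanishes at every addable content.\<close>

lemma tab_idem_orthogonal:
  assumes "standard S" "standard T" "length S = length T" "S \<noteq> T"
  shows "tab_idem S * tab_idem T = 0"
  using assms
proof (induction S arbitrary: T)
  case (Cons r S)
  then obtain s T' where T: "T = s # T'" "length T' = length S" by (cases T) auto
  define J where "J = JM (Suc (length S))"
  have "tab_idem (r # S) * tab_idem T = tab_idem S * (poly_at (content_lagrange S r) J * tab_idem T') * poly_at (content_lagrange T' s) J"
    by (simp add: T J_def mult.assoc)
  also have "poly_at (content_lagrange S r) J * tab_idem T' = tab_idem T' * poly_at (content_lagrange S r) J"
    using tab_idem_commute[of _ T'] by (simp add: J_def T)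
  finally have eq: "tab_idem (r # S) * tab_idem T = (tab_idem S * tab_idem T') * poly_at (content_lagrange S r * content_lagrange T' s) J"
    by (simp add: poly_at_mult mult.assoc)
  show ?case
  proof (cases "S = T'")
    case True
    then have "r \<noteq> s" using Cons.prems(4) T(1) by blast
    have "tab_idem S * tab_idem T' = tab_idem S" using True tab_idem_idem Cons.prems(1) by simp
    moreover have "tab_idem S * poly_at (content_lagrange S r * content_lagrange S s) J = 0"
    proof -
      have "standard (r # S)" "standard (s # S)" using Cons.prems(1,2) T(1) True by auto
      then have std: "standard S" "r \<in> addable_rows S" "s \<in> addable_rows S"
        using standard_ConsD by blast+
      show ?thesis
        unfolding J_def using poly_content_lagrange[OF std(1)] std \<open>r \<noteq> s\<close>
        by (intro tab_idem_vanish) auto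
    qed
    ultimately show ?thesis using eq True by simp
  next
    case False
    then have "tab_idem S * tab_idem T' = 0"
      using Cons.prems(1,2) T by (intro Cons.IH) (auto simp del: count_list.simps)
    then show ?thesis using eq by simp
  qed
qed simp

text \<open>Each box multiplies the trace by its transition weight, which is the moment of its
  Lagrange polynomial; by \<open>frob_hook_add\<close> these weights telescope.\<close>

theorem tab_idem_trace:
  assumes "standard T" "length T \<le> N"
  shows "coeffg (tab_idem T) 0 * frob_hook N (count_list T) = 1"
  using assms
proof (induction T)
  case Nil
  have "count_list [] = (\<lambda>_. 0)" by auto
  then show ?case by (simp add: frob_hook_empty)
next
  case (Cons r T)
  have r: "r < N" using Cons.prems standard_row_less[of "r # T" r] by auto
  have std: "standard T" "r \<in> addable_rows T" using standard_ConsD[OF Cons.prems(1)] by auto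
  have "trans_moment N T (content_lagrange T r) = (\<Sum>i<N. if i = r then growth_weight N (count_list T) r else 0)"
    unfolding trans_moment_def
  proof (rule sum.cong)
    fix i assume i: "i \<in> {..<N}"
    show "growth_weight N (count_list T) i * poly (content_lagrange T r) (next_content T i) = (if i = r then growth_weight N (count_list T) r else 0)"
    proof (cases "i \<in> addable_rows T")
      case True
      then show ?thesis using poly_content_lagrange[OF std True] by simp
    next
      case False
      then have "growth_weight N (count_list T) i = 0"
        using growth_weight_nonaddable[OF standard_antimono[OF std(1)], of i N] i
        by (simp add: addable_rows_iff[OF std(1)] count_list_Cons)
      then show ?thesis using std False by auto
    qed
  qed simp
  also have "\<dots> = growth_weight N (count_list T) r" using r by simp
  finally have "coeffg (tab_idem (r # T)) 0 = growth_weight N (count_list T) r * coeffg (tab_idem T) 0"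
    using tab_idem_moment[OF std(1), of N 0 "content_lagrange T r"] Cons.prems by simp
  moreover have "growth_weight N (count_list T) r * frob_hook N (count_list (r # T)) = frob_hook N (count_list T)"
    unfolding count_list_Cons using Cons.prems r
    by (intro frob_hook_add standard_antimono) (auto simp: count_list_Cons[symmetric])
  moreover have "coeffg (tab_idem T) 0 * frob_hook N (count_list T) = 1"
    using Cons.IH std Cons.prems(2) by simp
  ultimately show ?case
    by (simp only: mult.assoc mult.left_commute)
qed

section \<open>Tableaux of the same shape\<close>

lemma poly_at_eigen_left:
  assumes "x * y = scalar c * y"
  shows "poly_at p x * y = scalar (poly p c) * y"
proof -
  have "star y * star x = scalar c * star y"
    using arg_cong[OF assms, of star] by (simp add: star_mult scalar_commute)
  then have *: "star y * poly_at p (star x) = scalar (poly p c) * star y" by (rule poly_at_eigen)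
  have "star (poly_at p (star x)) = poly_at p x"
  proof (induction p)
    case (pCons a p)
    have "poly_at p x * x = x * poly_at p x" by (rule poly_at_commute) simp
    then show ?case using pCons.IH by (simp add: star_add star_mult)
  qed simp
  then show ?thesis
    using arg_cong[OF *, of star] by (simp add: star_mult scalar_commute)
qed

lemma tab_idem_eigen_left:
  assumes "standard (r # T)"
  shows "JM (Suc (length T)) * tab_idem (r # T) = scalar (next_content T r) * tab_idem (r # T)"
  using arg_cong[OF tab_idem_eigen[OF assms], of star]
  by (simp only: star_mult star_JM star_tab_idem star_scalar) (simp only: scalar_commute)

lemma JM_JM_commute: "JM (Suc n) * JM (Suc (Suc n)) = JM (Suc (Suc n)) * JM (Suc n)"
  by (intro JM_commute JM_grp_alg) simp

text \<open>\<open>\<phi>\<close> is the commutator \<open>a * s - s * a\<close> in disguise, the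
  intertwiner of the degenerate affine Hecke algebra. It exchanges the eigenvalues of
  \<open>a\<close> and \<open>J\<close>, and on a joint eigenvector its square is a nonzero scalar
  unless the two eigenvalues differ by 1.\<close>

lemma intertwiner:
  assumes Js: "J * s = s * a + (1 :: galg)" and ss: "s * s = 1" and aJ: "a * J = J * a"
  defines "\<phi> \<equiv> s * (J - a) - 1"
  shows "\<phi> * a = J * \<phi>" and "\<phi> * J = a * \<phi>" and "\<phi> * \<phi> = 1 - (J - a) * (J - a)"
proof -
  have "s * (J * s) * s = s * J"
    by (simp only: mult.assoc ss mult_1_right)
  moreover have "s * (J * s) * s = (s * s) * a * s + s * s"
    by (simp only: Js distrib_left distrib_right mult.assoc mult_1_right)
  ultimately have sJ: "s * J = a * s + 1" by (simp add: ss)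
  have sa: "s * a = J * s - 1" using Js by simp
  define d where "d = J - a"
  have da: "d * a = a * d" and dJ: "d * J = J * d"
    by (simp_all add: d_def left_diff_distrib right_diff_distrib aJ)
  have \<phi>: "\<phi> = s * d - 1" by (simp add: \<phi>_def d_def)
  have "\<phi> * a = s * (d * a) - a" by (simp add: \<phi> left_diff_distrib mult.assoc)
  also have "\<dots> = (s * a) * d - a" by (simp add: da mult.assoc)
  also have "\<dots> = J * (s * d) - d - a" by (simp add: sa left_diff_distrib mult.assoc)
  also have "\<dots> = J * \<phi>" by (simp add: \<phi> right_diff_distrib d_def)
  finally show "\<phi> * a = J * \<phi>" .
  have "\<phi> * J = s * (d * J) - J" by (simp add: \<phi> left_diff_distrib mult.assoc)
  also have "\<dots> = (s * J) * d - J" by (simp add: dJ mult.assoc)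
  also have "\<dots> = a * (s * d) + d - J" by (simp add: sJ distrib_right mult.assoc)
  also have "\<dots> = a * \<phi>" by (simp add: \<phi> right_diff_distrib d_def)
  finally show "\<phi> * J = a * \<phi>" .
  have sd: "s * d = 2 - d * s"
    by (simp add: d_def right_diff_distrib left_diff_distrib sJ sa)
  have "\<phi> * s = s - d"
  proof -
    have "\<phi> * s = (2 - d * s) * s - s" by (simp add: \<phi> left_diff_distrib sd)
    also have "\<dots> = 2 * s - d * (s * s) - s" by (simp add: left_diff_distrib mult.assoc)
    finally show ?thesis by (simp add: ss mult_2)
  qed
  then have "\<phi> * s * d = s * d - d * d" by (simp add: left_diff_distrib)
  then show "\<phi> * \<phi> = 1 - (J - a) * (J - a)"
    unfolding d_def[symmetric] by (subst (2) \<phi>) (simp add: right_diff_distrib mult.assoc \<phi>)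
qed

text \<open>Ring-theoretic equivalence of idempotents: the two generate isomorphic left ideals,
  expressed without modules.\<close>

definition linked :: "nat list \<Rightarrow> nat list \<Rightarrow> bool" where
  "linked S T \<longleftrightarrow> (\<exists>x\<in>grp_alg (length S). \<exists>y\<in>grp_alg (length S). x * y = tab_idem S \<and> y * x = tab_idem T)"

lemma linked_refl: "standard S \<Longrightarrow> linked S S"
  unfolding linked_def using tab_idem_grp_alg tab_idem_idem by blast


lemma linked_trans:
  assumes "linked S T" "linked T U" "length S = length T" "standard S" "standard U"
  shows "linked S U"
proof -
  obtain x y where xy: "x \<in> grp_alg (length S)" "y \<in> grp_alg (length S)" "x * y = tab_idem S" "y * x = tab_idem T"
    using assms(1) by (auto simp: linked_def)
  obtain u v where uv: "u \<in> grp_alg (length S)" "v \<in> grp_alg (length S)" "u * v = tab_idem T" "v * u = tab_idem U"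
    using assms(2,3) by (auto simp: linked_def)
  have "(x * u) * (v * y) = x * (u * v) * y" by (simp add: mult.assoc)
  also have "\<dots> = (x * y) * (x * y)" by (simp add: uv(3) xy(4)[symmetric] mult.assoc)
  finally have 1: "(x * u) * (v * y) = tab_idem S" using tab_idem_idem assms(4) by (simp add: xy)
  have "(v * y) * (x * u) = v * (y * x) * u" by (simp add: mult.assoc)
  also have "\<dots> = (v * u) * (v * u)" by (simp add: xy(4) uv(3)[symmetric] mult.assoc)
  finally have 2: "(v * y) * (x * u) = tab_idem U" using tab_idem_idem assms(5) by (simp add: uv)
  show ?thesis
    unfolding linked_def using 1 2 xy uv grp_alg_mult by blast
qed

text \<open>Tableaux of the same shape receive the same Lagrange factor, a polynomial in
  \<open>JM (Suc n)\<close>, and it commutes with the linking elements, which lie in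
  \<open>grp_alg n\<close>.\<close>

lemma linked_Cons:
  assumes "linked S T" "count_list S = count_list T" "length S = length T"
    "standard (r # S)" "standard (r # T)"
  shows "linked (r # S) (r # T)"
proof -
  define n where "n = length S"
  obtain x y where xy: "x \<in> grp_alg n" "y \<in> grp_alg n" "x * y = tab_idem S" "y * x = tab_idem T"
    using assms(1) by (auto simp: linked_def n_def)
  have addable_rows: "addable_rows S = addable_rows T" unfolding addable_rows_def count_list_Cons assms(2,3) ..
  then have content_lagrange: "content_lagrange S r = content_lagrange T r" using assms(2) by (simp add: content_lagrange_def)
  define p where "p = poly_at (content_lagrange S r) (JM (Suc n))"
  have pc: "p * z = z * p" if "z \<in> grp_alg n" for z
    unfolding p_def using JM_commute[OF that] by (intro poly_at_commute) simp
  have pA: "p \<in> grp_alg (Suc n)" unfolding p_def by (intro poly_at_grp_alg JM_grp_alg) simp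
  have idem: "tab_idem U * p * p = tab_idem (r # U)" if "U = S \<or> U = T" for U
  proof -
    have U: "tab_idem (r # U) = tab_idem U * p" "tab_idem U * p = p * tab_idem U" "standard (r # U)" "standard U"
      using that assms(3-5) content_lagrange tab_idem_commute[of _ U] standard_ConsD by (auto simp: p_def n_def)
    have "tab_idem (r # U) = tab_idem (r # U) * tab_idem (r # U)" using tab_idem_idem[OF U(3)] by (rule sym)
    also have "\<dots> = tab_idem U * (p * tab_idem U) * p" by (simp only: U(1) mult.assoc)
    also have "\<dots> = (tab_idem U * tab_idem U) * p * p" using U(2) by (simp add: mult.assoc)
    finally show ?thesis using tab_idem_idem[OF U(4)] by simp
  qed
  have "(x * p) * (y * p) = tab_idem S * p * p"
    using pc[OF xy(2)] xy(3) by (metis mult.assoc)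
  moreover have "(y * p) * (x * p) = tab_idem T * p * p"
    using pc[OF xy(1)] xy(4) by (metis mult.assoc)
  ultimately have "(x * p) * (y * p) = tab_idem (r # S)" "(y * p) * (x * p) = tab_idem (r # T)"
    using idem by auto
  moreover have "x * p \<in> grp_alg (Suc n)" "y * p \<in> grp_alg (Suc n)"
    using xy pA by (auto intro!: grp_alg_mult intro: grp_alg_mono[of n "Suc n"])
  ultimately show ?thesis unfolding linked_def n_def by force
qed

text \<open>Two addable rows differ in length as well as in index, and the content counts both
  differences. In \<open>linked_swap\<close> this keeps the square of the intertwiner away from
  0.\<close>

lemma next_content_gap:
  assumes "standard T" "r \<in> addable_rows T" "s \<in> addable_rows T" "r < s"
  shows "next_content T r - next_content T s > 1"
proof -
  have le: "Suc (count_list T s) \<le> count_list T r"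
    using antimonoD[of "count_list (s # T)" r s] assms by (simp add: addable_rows_def)
  then show ?thesis using assms(4) by (simp add: row_end_def)
qed

text \<open>Since \<open>\<phi>\<close> exchanges the eigenvalues of the last two Jucys--Murphy
  elements, the Lagrange factors of \<open>tab_idem (s # r # V)\<close> act as 1 on
  \<open>\<phi> * tab_idem (r # s # V)\<close>. The scalar is the value of
  \<open>\<phi> * \<phi>\<close> found in \<open>intertwiner\<close>.\<close>

lemma swap_intertwines:
  fixes r s :: nat
  assumes "standard (r # s # V)" "standard (s # r # V)" "r \<noteq> s"
  defines "n \<equiv> length V"
  defines "\<phi> \<equiv> simple_refl (Suc n) * (JM (Suc (Suc n)) - JM (Suc n)) - 1"
  shows "tab_idem (s # r # V) * (\<phi> * tab_idem (r # s # V)) = \<phi> * tab_idem (r # s # V)"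
    and "scalar (1 - (next_content V r - next_content V s)\<^sup>2) * tab_idem (r # s # V) = \<phi> * \<phi> * tab_idem (r # s # V)"
proof -
  define a J e where "a = JM (Suc n)" and "J = JM (Suc (Suc n))" and "e = tab_idem (r # s # V)"
  have \<phi>: "\<phi> = simple_refl (Suc n) * (J - a) - 1" by (simp add: \<phi>_def a_def J_def)
  have Js: "J * simple_refl (Suc n) = simple_refl (Suc n) * a + 1" unfolding J_def a_def by (rule JM_simple_refl) simp
  have aJ: "a * J = J * a" unfolding a_def J_def by (rule JM_JM_commute)
  note tw = intertwiner[OF Js simple_refl_simple_refl aJ, folded \<phi>]
  have std: "standard (s # V)" "standard V" "standard (r # V)" "r \<in> addable_rows V" "s \<in> addable_rows V" "s \<in> addable_rows (r # V)"
    using assms(1,2) standard_ConsD by blast+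
  have next_content: "next_content (s # V) r = next_content V r" "next_content (r # V) s = next_content V s"
    using assms(3) by (auto simp: row_end_def)
  have Je: "J * e = scalar (next_content V r) * e"
    using tab_idem_eigen_left[OF assms(1)] next_content by (simp add: J_def e_def n_def del: tab_idem.simps)
  have ae: "a * e = scalar (next_content V s) * e"
  proof -
    define l where "l = poly_at (content_lagrange (s # V) r) J"
    have "e = tab_idem (s # V) * l" by (simp add: e_def l_def J_def n_def)
    then show ?thesis
      using tab_idem_eigen_left[OF std(1)] by (simp only: a_def n_def mult.assoc[symmetric])
  qed
  have a\<phi>: "a * (\<phi> * e) = scalar (next_content V r) * (\<phi> * e)"
    by (simp only: mult.assoc[symmetric] tw(2)[symmetric]) (simp only: mult.assoc Je scalar_left_commute)
  have J\<phi>: "J * (\<phi> * e) = scalar (next_content V s) * (\<phi> * e)"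
    by (simp only: mult.assoc[symmetric] tw(1)[symmetric]) (simp only: mult.assoc ae scalar_left_commute)
  have EV: "tab_idem V \<in> grp_alg n" "tab_idem V \<in> grp_alg (Suc n)" using tab_idem_grp_alg[of V] grp_alg_mono[of n "Suc n"] by (auto simp: n_def)
  have c1: "tab_idem V * simple_refl (Suc n) = simple_refl (Suc n) * tab_idem V" by (rule simple_refl_commute[OF EV(1)])
  have c2: "tab_idem V * J = J * tab_idem V" unfolding J_def by (rule JM_commute[OF EV(2)])
  have c3: "tab_idem V * a = a * tab_idem V" unfolding a_def by (rule JM_commute[OF EV(1)])
  have "tab_idem V * (J - a) = (J - a) * tab_idem V"
    by (simp add: right_diff_distrib left_diff_distrib c2 c3)
  then have "tab_idem V * (simple_refl (Suc n) * (J - a)) = (simple_refl (Suc n) * (J - a)) * tab_idem V"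
    using c1 by (metis mult.assoc)
  then have c4: "tab_idem V * \<phi> = \<phi> * tab_idem V"
    by (simp add: \<phi> right_diff_distrib left_diff_distrib)
  have "tab_idem V * e = e"
    using tab_idem_idem[OF std(2)] by (simp add: e_def mult.assoc[symmetric])
  then have EV\<phi>: "tab_idem V * (\<phi> * e) = \<phi> * e"
    using c4 by (metis mult.assoc)
  have 1: "poly_at (content_lagrange (r # V) s) J * (\<phi> * e) = \<phi> * e"
    using poly_at_eigen_left[OF J\<phi>, of "content_lagrange (r # V) s"] poly_content_lagrange[OF std(3) std(6) std(6)] next_content by simp
  have 2: "poly_at (content_lagrange V r) a * (\<phi> * e) = \<phi> * e"
    using poly_at_eigen_left[OF a\<phi>, of "content_lagrange V r"] poly_content_lagrange[OF std(2) std(4) std(4)] by simp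
  have "tab_idem (s # r # V) * (\<phi> * e) = tab_idem V * (poly_at (content_lagrange V r) a * (poly_at (content_lagrange (r # V) s) J * (\<phi> * e)))"
    by (simp add: a_def J_def n_def mult.assoc)
  then have "tab_idem (s # r # V) * (\<phi> * e) = \<phi> * e"
    by (simp only: 1 2 EV\<phi>)
  then show "tab_idem (s # r # V) * (\<phi> * tab_idem (r # s # V)) = \<phi> * tab_idem (r # s # V)"
    by (simp only: e_def)
  define c where "c = next_content V r - next_content V s"
  have de: "(J - a) * e = scalar c * e"
    by (simp add: left_diff_distrib Je ae c_def scalar_diff)
  then have "(J - a) * ((J - a) * e) = scalar (c\<^sup>2) * e"
    by (simp only: scalar_left_commute[of "J - a"]) (simp add: power2_eq_square scalar_mult mult.assoc)
  then have "\<phi> * \<phi> * e = e - scalar (c\<^sup>2) * e"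
    unfolding tw(3) by (simp add: left_diff_distrib mult.assoc)
  then show "scalar (1 - (next_content V r - next_content V s)\<^sup>2) * tab_idem (r # s # V) = \<phi> * \<phi> * tab_idem (r # s # V)"
    unfolding c_def[symmetric] e_def[symmetric] by (simp add: scalar_diff left_diff_distrib)
qed

lemma linked_swap:
  assumes "standard (r # s # V)" "standard (s # r # V)" "r \<noteq> s"
  shows "linked (r # s # V) (s # r # V)"
proof -
  define n where "n = length V"
  define \<phi> where "\<phi> = simple_refl (Suc n) * (JM (Suc (Suc n)) - JM (Suc n)) - 1"
  define e f where "e = tab_idem (r # s # V)" and "f = tab_idem (s # r # V)"
  define c where "c = 1 - (next_content V r - next_content V s)\<^sup>2"
  have std: "standard V" "r \<in> addable_rows V" "s \<in> addable_rows V"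
    using assms(1,2) standard_ConsD by blast+
  have "\<bar>next_content V r - next_content V s\<bar> > 1"
    using next_content_gap[OF std(1)] std assms(3) by (cases r s rule: linorder_cases) fastforce+
  then have "(next_content V r - next_content V s)\<^sup>2 > 1"
    using power_strict_mono[of 1 "\<bar>next_content V r - next_content V s\<bar>" 2] by simp
  then have c: "c \<noteq> 0" by (simp add: c_def)
  have fe: "f * (\<phi> * e) = \<phi> * e" and \<phi>e: "\<phi> * \<phi> * e = scalar c * e"
    using swap_intertwines[OF assms(1,2,3)] by (simp_all only: \<phi>_def n_def e_def f_def c_def)
  have ef: "e * (\<phi> * f) = \<phi> * f" and \<phi>f: "\<phi> * \<phi> * f = scalar c * f"
    using swap_intertwines[OF assms(2,1) assms(3)[symmetric]] 
    by (simp_all only: \<phi>_def n_def e_def f_def c_def power2_commute)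
  \<comment> \<open>Each carries one idempotent into the other, and the factor \<open>1 / c\<close>
    undoes \<open>\<phi> * \<phi>\<close>.\<close>
  define x y where "x = \<phi> * f" and "y = scalar (1 / c) * (\<phi> * e)"
  have cc: "scalar (1 / c) * (scalar c * z) = z" for z
    using c by (simp add: mult.assoc[symmetric] flip: scalar_mult)
  have "x * y = scalar (1 / c) * (\<phi> * (f * (\<phi> * e)))"
    by (simp only: x_def y_def scalar_left_commute mult.assoc)
  also have "\<dots> = scalar (1 / c) * (\<phi> * \<phi> * e)"
    by (simp only: fe mult.assoc)
  also have "\<dots> = e"
    by (simp only: \<phi>e cc)
  finally have xy: "x * y = e" .
  have "y * x = scalar (1 / c) * (\<phi> * (e * (\<phi> * f)))"
    by (simp only: x_def y_def mult.assoc)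
  also have "\<dots> = scalar (1 / c) * (\<phi> * \<phi> * f)"
    by (simp only: ef mult.assoc)
  also have "\<dots> = f"
    by (simp only: \<phi>f cc)
  finally have yx: "y * x = f" .
  have \<phi>grp_alg: "\<phi> \<in> grp_alg (Suc (Suc n))"
    unfolding \<phi>_def simple_refl_def by (intro grp_alg_diff grp_alg_mult grp_alg_basis_elt swap_in_symgrp JM_grp_alg grp_alg_1) auto
  have "e \<in> grp_alg (Suc (Suc n))" "f \<in> grp_alg (Suc (Suc n))"
    using tab_idem_grp_alg[of "r # s # V"] tab_idem_grp_alg[of "s # r # V"] by (simp_all only: e_def f_def n_def list.size) auto
  then have "x \<in> grp_alg (Suc (Suc n))" "y \<in> grp_alg (Suc (Suc n))"
    unfolding x_def y_def using \<phi>grp_alg by (auto intro!: grp_alg_mult)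
  then show ?thesis
    unfolding linked_def using xy yx by (auto simp: e_def f_def n_def simp del: tab_idem.simps)
qed

lemma antimono_remove_two:
  fixes \<nu> :: "nat \<Rightarrow> nat"
  assumes "antimono (\<nu>(r := \<nu> r - 1))" "antimono (\<nu>(s := \<nu> s - 1))" "r \<noteq> s"
  shows "antimono (\<nu>(r := \<nu> r - 1, s := \<nu> s - 1))"
proof -
  define \<eta> where "\<eta> = \<nu>(r := \<nu> r - 1, s := \<nu> s - 1)"
  have "\<eta> (Suc i) \<le> \<eta> i" for i
  proof (cases "i = s")
    case True
    have "\<eta> (Suc i) \<le> (\<nu>(s := \<nu> s - 1)) (Suc i)" by (simp add: \<eta>_def)
    also have "\<dots> \<le> (\<nu>(s := \<nu> s - 1)) i" using antimonoD[OF assms(2), of i "Suc i"] by simp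
    finally show ?thesis using True by (simp add: \<eta>_def)
  next
    case False
    have "\<eta> (Suc i) \<le> (\<nu>(r := \<nu> r - 1)) (Suc i)" using assms(3) by (simp add: \<eta>_def)
    also have "\<dots> \<le> (\<nu>(r := \<nu> r - 1)) i" using antimonoD[OF assms(1), of i "Suc i"] by simp
    finally show ?thesis using False by (simp add: \<eta>_def)
  qed
  then have "antimono \<eta>" using lift_Suc_antimono_le[of \<eta>] by (intro antimonoI) blast
  then show ?thesis by (simp add: \<eta>_def)
qed

text \<open>Existence is read off from the hook length formula, where the number of tableaux is a
  factor of a positive number.\<close>

lemma ex_standard:
  assumes "antimono \<nu>" "\<And>i. i \<ge> N \<Longrightarrow> \<nu> i = 0"
  obtains V where "standard V" "count_list V = \<nu>"
proof -
  have "real (card (tableaux_of \<nu>)) * frob_hook N \<nu> > 0"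
    using hook_length_formula[OF assms] by simp
  then have "tableaux_of \<nu> \<noteq> {}" by fastforce
  then show ?thesis using that by (auto simp: tableaux_of_def)
qed

text \<open>If the largest entries of \<open>S\<close> and \<open>T\<close> lie in different rows
  \<open>r\<close> and \<open>s\<close>, both boxes can be removed together. A tableau
  \<open>V\<close> of the remaining shape gives the chain \<open>S\<close>,
  \<open>r # s # V\<close>, \<open>s # r # V\<close>, \<open>T\<close>: the outer pairs agree in the
  largest entry and fall to the induction hypothesis, the middle pair is a swap.\<close>

theorem linked_same_shape:
  assumes "standard S" "standard T" "length S = n" "length T = n" "count_list S = count_list T"
  shows "linked S T"
  using assms
proof (induction n arbitrary: S T)
  case 0
  then show ?case by (simp add: linked_refl)
next
  case (Suc n)
  obtain r S' where S: "S = r # S'" "length S' = n" using Suc.prems(3) by (cases S) auto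
  obtain s T' where T: "T = s # T'" "length T' = n" using Suc.prems(4) by (cases T) auto
  have std: "standard S'" "standard T'" using Suc.prems S T by auto
  define \<nu> where "\<nu> = count_list S"
  have cS: "count_list S' = \<nu>(r := \<nu> r - 1)" by (auto simp: \<nu>_def S)
  have cT: "count_list T' = \<nu>(s := \<nu> s - 1)" unfolding \<nu>_def Suc.prems(5) by (auto simp: T)
  have anti: "antimono \<nu>" using standard_antimono[OF Suc.prems(1)] by (simp add: \<nu>_def)
  show ?case
  proof (cases "r = s")
    case True
    then have "count_list S' = count_list T'" using cS cT by simp
    then show ?thesis
      using Suc.IH[OF std S(2) T(2)] Suc.prems(1,2) linked_Cons[of S' T' r] S T True by simp
  next
    case False
    define \<eta> where "\<eta> = \<nu>(r := \<nu> r - 1, s := \<nu> s - 1)"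
    have pos: "\<nu> r > 0" "\<nu> s > 0"
      by (simp add: \<nu>_def S) (simp add: \<nu>_def Suc.prems(5) T)
    have "antimono \<eta>"
      unfolding \<eta>_def using standard_antimono[OF std(1)] standard_antimono[OF std(2)] False
      by (intro antimono_remove_two) (simp_all only: cS cT not_False_eq_True)
    moreover have "\<eta> i = 0" if "i \<ge> Suc n" for i
      using standard_count_eq_0[OF Suc.prems(1), of i] Suc.prems(3) that by (auto simp: \<eta>_def \<nu>_def)
    ultimately obtain V where V: "standard V" "count_list V = \<eta>"
      by (rule ex_standard)
    have cV: "count_list (s # V) = count_list S'" "count_list (r # V) = count_list T'"
      using pos False unfolding count_list_Cons V(2) cS cT \<eta>_def by auto
    then have sV: "standard (s # V)" "standard (r # V)"
      using V(1) standard_antimono[OF std(1)] standard_antimono[OF std(2)] by simp_all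
    have c2: "count_list (r # s # V) = \<nu>" "count_list (s # r # V) = \<nu>"
      unfolding count_list_Cons[of r "s # V"] count_list_Cons[of s "r # V"] cV cS cT using pos by auto
    then have s2: "standard (r # s # V)" "standard (s # r # V)"
      using sV anti by (simp_all only: standard.simps)
    have len: "length (s # V) = n" "length (r # V) = n"
    proof -
      have "length (s # V) = (\<Sum>i<Suc n. count_list (s # V) i)"
        using standard_count_eq_0[OF std(1)] S(2) cV(1) by (intro length_eq_sum_count) simp
      also have "\<dots> = length S'"
        unfolding cV(1) using standard_count_eq_0[OF std(1)] S(2) by (intro length_eq_sum_count[symmetric]) auto
      finally show "length (s # V) = n" using S by simp
      then show "length (r # V) = n" by simp
    qed
    have "linked S (r # s # V)"
      unfolding S(1)
      by (rule linked_Cons) (use Suc.IH[OF std(1) sV(1) S(2) len(1)] cV Suc.prems(1) s2 S len in \<open>auto simp del: standard.simps count_list.simps\<close>)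
    moreover have "linked (r # s # V) (s # r # V)"
      by (rule linked_swap[OF s2 False])
    moreover have "linked (s # r # V) T"
      unfolding T(1)
      by (rule linked_Cons) (use Suc.IH[OF sV(2) std(2) len(2) T(2)] cV Suc.prems(2) s2 T len in \<open>auto simp del: standard.simps count_list.simps\<close>)
    ultimately show ?thesis
      using linked_trans Suc.prems(1-4) s2 len
      by (metis length_Cons)
  qed
qed

section \<open>An orthonormal basis of the group algebra\<close>

lemma inner_diff_left: "inner (x - y) z = inner x z - inner y z"
  by (simp add: inner_def left_diff_distrib lookup_minus)

lemma inner_sum_left: "inner (sum f I) z = (\<Sum>i\<in>I. inner (f i) z)"
  by (simp add: inner_def sum_distrib_right lookup_sum)

lemma inner_scalar_left: "inner (scalar c * x) z = c * inner x z"
  by (simp add: inner_def mult.assoc)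

lemma inner_commute:
  assumes "x \<in> grp_alg n" "y \<in> grp_alg n"
  shows "inner x y = inner y x"
  using inner_eq[OF assms(1)] inner_eq[OF assms(2)] by (simp add: mult.commute)

lemma inner_star_star:
  assumes "x \<in> grp_alg n"
  shows "inner (star x) (star y) = inner x y"
proof -
  have "inner (star x) (star y) = (\<Sum>g\<in>symgrp n. coeffg x (- g) * coeffg y (- g))"
    using inner_eq[OF grp_alg_star[OF assms]] by (simp add: coeffg_star)
  also have "\<dots> = (\<Sum>g\<in>symgrp n. coeffg x g * coeffg y g)"
    by (rule sum.reindex_bij_witness[of _ uminus uminus]) auto
  finally show ?thesis using inner_eq[OF assms] by simp
qed

lemma inner_basis_elt_left: "inner (basis_elt g) x = coeffg x g"
  by (simp add: inner_def coeffg_basis_elt_mult coeffg_star)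

definition orthonormal_basis :: "nat \<Rightarrow> 'i set \<Rightarrow> ('i \<Rightarrow> galg) \<Rightarrow> bool" where
  "orthonormal_basis n I b \<longleftrightarrow> finite I \<and> card I = fact n \<and> (\<forall>i\<in>I. b i \<in> grp_alg n) \<and>
    (\<forall>i\<in>I. \<forall>j\<in>I. inner (b i) (b j) = (if i = j then 1 else 0))"

text \<open>Summed over all \<open>g\<close>, Bessel's inequality becomes an equality, because there are \<open>n!\<close> vectors.\<close>

lemma orthonormal_expand:
  assumes "orthonormal_basis n I b" "g \<in> symgrp n"
  shows "basis_elt g = (\<Sum>i\<in>I. scalar (coeffg (b i) g) * b i)"
proof -
  have fin: "finite I" and card: "card I = fact n" and bA: "\<And>i. i \<in> I \<Longrightarrow> b i \<in> grp_alg n"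
    and on: "\<And>i j. i \<in> I \<Longrightarrow> j \<in> I \<Longrightarrow> inner (b i) (b j) = (if i = j then 1 else 0)"
    using assms(1) by (auto simp: orthonormal_basis_def)
  define p where "p g = (\<Sum>i\<in>I. scalar (coeffg (b i) g) * b i)" for g
  define r where "r g = basis_elt g - p g" for g
  have pA: "p g \<in> grp_alg n" for g
    unfolding p_def by (intro grp_alg_sum grp_alg_mult bA grp_alg_scalar)
  have rA: "r g \<in> grp_alg n" if "g \<in> symgrp n" for g
    unfolding r_def by (intro grp_alg_diff grp_alg_basis_elt pA that)
  have pb: "inner (p g) (b j) = coeffg (b j) g" if "j \<in> I" for g j
  proof -
    have "inner (p g) (b j) = (\<Sum>i\<in>I. if i = j then coeffg (b j) g else 0)"
      unfolding p_def inner_sum_left inner_scalar_left using on that by (intro sum.cong) auto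
    then show ?thesis using fin that by (simp add: sum.delta)
  qed
  have norm: "inner (r g) (r g) = 1 - (\<Sum>i\<in>I. (coeffg (b i) g)\<^sup>2)" if g: "g \<in> symgrp n" for g
  proof -
    have rb: "inner (r g) (b j) = 0" if "j \<in> I" for j
      using pb[OF that] by (simp add: r_def inner_diff_left inner_basis_elt_left)
    have "inner (p g) (r g) = (\<Sum>i\<in>I. coeffg (b i) g * inner (b i) (r g))"
      by (simp add: p_def inner_sum_left inner_scalar_left)
    also have "\<dots> = 0"
      using rb inner_commute[OF bA rA[OF g]] by (intro sum.neutral) auto
    finally have pr: "inner (p g) (r g) = 0" .
    have "inner (r g) (r g) = inner (basis_elt g) (r g) - inner (p g) (r g)"
      using inner_diff_left[of "basis_elt g" "p g" "r g"] by (simp add: r_def)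
    also have "\<dots> = 1 - coeffg (p g) g"
      using pr by (simp add: inner_basis_elt_left) (simp add: r_def lookup_minus coeffg_basis_elt)
    also have "coeffg (p g) g = (\<Sum>i\<in>I. (coeffg (b i) g)\<^sup>2)"
      by (simp add: p_def lookup_sum power2_eq_square)
    finally show ?thesis .
  qed
  have "(\<Sum>g\<in>symgrp n. inner (r g) (r g)) = (\<Sum>g\<in>symgrp n. 1) - (\<Sum>g\<in>symgrp n. \<Sum>i\<in>I. (coeffg (b i) g)\<^sup>2)"
    using norm by (simp add: sum_subtractf)
  also have "(\<Sum>g\<in>symgrp n. \<Sum>i\<in>I. (coeffg (b i) g)\<^sup>2) = (\<Sum>i\<in>I. \<Sum>g\<in>symgrp n. coeffg (b i) g * coeffg (b i) g)"
    by (subst sum.swap) (simp add: power2_eq_square)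
  also have "\<dots> = (\<Sum>i\<in>I. 1)"
    using inner_eq[OF bA] on by (intro sum.cong) auto
  finally have "(\<Sum>g\<in>symgrp n. inner (r g) (r g)) = 0"
    by (simp add: card card_symgrp)
  then have "inner (r g) (r g) = 0"
    using assms(2) inner_self_nonneg[OF rA] by (subst (asm) sum_nonneg_eq_0_iff) auto
  then have "r g = 0" using inner_self_eq_0 rA[OF assms(2)] by blast
  then show ?thesis by (simp add: r_def p_def)
qed

text \<open>The sum of all g \<otimes> g is the same for every orthonormal basis in place of the
  group elements. \<open>\<sigma>\<close> stands for any linear map: the identity yields squares,
  \<open>star\<close> yields conjugations.\<close>

lemma orthonormal_sandwich:
  fixes b :: "'i \<Rightarrow> galg"
  assumes b: "orthonormal_basis n I b"
    and \<sigma>: "\<And>f (J :: 'i set). \<sigma> (sum f J) = (\<Sum>j\<in>J. \<sigma> (f j :: galg))" "\<And>c z. \<sigma> (scalar c * z) = scalar c * (\<sigma> z :: galg)"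
  shows "(\<Sum>g\<in>symgrp n. basis_elt g * x * \<sigma> (basis_elt g)) = (\<Sum>i\<in>I. b i * x * \<sigma> (b i))"
proof -
  have fin: "finite I" and bA: "\<And>i. i \<in> I \<Longrightarrow> b i \<in> grp_alg n"
    and on: "\<And>i j. i \<in> I \<Longrightarrow> j \<in> I \<Longrightarrow> inner (b i) (b j) = (if i = j then 1 else 0)"
    using b by (auto simp: orthonormal_basis_def)
  have "basis_elt g * x * \<sigma> (basis_elt g) = (\<Sum>i\<in>I. \<Sum>j\<in>I. scalar (coeffg (b i) g * coeffg (b j) g) * (b i * x * \<sigma> (b j)))"
    if "g \<in> symgrp n" for g
  proof -
    have "basis_elt g * x * \<sigma> (basis_elt g) = (\<Sum>i\<in>I. scalar (coeffg (b i) g) * b i) * x * \<sigma> (\<Sum>j\<in>I. scalar (coeffg (b j) g) * b j)"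
      using orthonormal_expand[OF b that] by simp
    also have "\<dots> = (\<Sum>i\<in>I. \<Sum>j\<in>I. (scalar (coeffg (b i) g) * b i * x) * (scalar (coeffg (b j) g) * \<sigma> (b j)))"
      by (simp only: \<sigma> sum_distrib_right[of _ _ x] sum_product)
    also have "\<dots> = (\<Sum>i\<in>I. \<Sum>j\<in>I. scalar (coeffg (b i) g * coeffg (b j) g) * (b i * x * \<sigma> (b j)))"
    proof (intro sum.cong refl)
      fix i j
      have "(scalar (coeffg (b i) g) * b i * x) * (scalar (coeffg (b j) g) * \<sigma> (b j))
          = scalar (coeffg (b j) g) * (scalar (coeffg (b i) g) * b i * x * \<sigma> (b j))"
        by (rule scalar_left_commute)
      also have "\<dots> = scalar (coeffg (b j) g * coeffg (b i) g) * (b i * x * \<sigma> (b j))"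
        by (simp only: scalar_mult mult.assoc)
      finally show "(scalar (coeffg (b i) g) * b i * x) * (scalar (coeffg (b j) g) * \<sigma> (b j))
          = scalar (coeffg (b i) g * coeffg (b j) g) * (b i * x * \<sigma> (b j))"
        by (simp only: mult.commute[of "coeffg (b j) g"])
    qed
    finally show ?thesis .
  qed
  then have "(\<Sum>g\<in>symgrp n. basis_elt g * x * \<sigma> (basis_elt g))
      = (\<Sum>g\<in>symgrp n. \<Sum>i\<in>I. \<Sum>j\<in>I. scalar (coeffg (b i) g * coeffg (b j) g) * (b i * x * \<sigma> (b j)))"
    by simp
  also have "\<dots> = (\<Sum>i\<in>I. \<Sum>g\<in>symgrp n. \<Sum>j\<in>I. scalar (coeffg (b i) g * coeffg (b j) g) * (b i * x * \<sigma> (b j)))"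
    by (rule sum.swap)
  also have "\<dots> = (\<Sum>i\<in>I. \<Sum>j\<in>I. \<Sum>g\<in>symgrp n. scalar (coeffg (b i) g * coeffg (b j) g) * (b i * x * \<sigma> (b j)))"
    by (intro sum.cong refl sum.swap)
  also have "\<dots> = (\<Sum>i\<in>I. \<Sum>j\<in>I. scalar (inner (b i) (b j)) * (b i * x * \<sigma> (b j)))"
    using inner_eq[OF bA] by (intro sum.cong refl) (simp add: scalar_sum sum_distrib_right)
  also have "\<dots> = (\<Sum>i\<in>I. \<Sum>j\<in>I. if i = j then b i * x * \<sigma> (b i) else 0)"
    using on by (intro sum.cong refl) auto
  also have "\<dots> = (\<Sum>i\<in>I. b i * x * \<sigma> (b i))"
    using fin by (simp add: sum.delta)
  finally show ?thesis .
qed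

text \<open>The Lagrange polynomials add up to 1 at every addable content.\<close>

lemma tab_idem_sum_children:
  assumes "standard T"
  shows "(\<Sum>r\<in>addable_rows T. tab_idem (r # T)) = tab_idem T"
proof -
  define J where "J = JM (Suc (length T))"
  have "(\<Sum>r\<in>addable_rows T. tab_idem (r # T)) = tab_idem T * poly_at (\<Sum>r\<in>addable_rows T. content_lagrange T r) J"
  proof -
    have "poly_at (sum f I) J = (\<Sum>i\<in>I. poly_at (f i) J)" for f and I :: "nat set"
      by (induction I rule: infinite_finite_induct) (auto simp: poly_at_add)
    then show ?thesis by (simp add: sum_distrib_left J_def)
  qed
  also have "\<dots> = tab_idem T * poly_at 1 J"
    unfolding J_def
  proof (rule tab_idem_cong[OF assms])
    fix s assume "s \<in> addable_rows T"
    then show "poly (\<Sum>r\<in>addable_rows T. content_lagrange T r) (next_content T s) = poly 1 (next_content T s)"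
      using poly_content_lagrange[OF assms] by (simp add: poly_sum sum.delta')
  qed
  finally show ?thesis by simp
qed

lemma sum_tab_idem: "(\<Sum>T\<in>tableaux n. tab_idem T) = 1"
proof (induction n)
  case 0
  have "tableaux 0 = {[]}" by (auto simp: tableaux_def)
  then show ?case by simp
next
  case (Suc n)
  have "tableaux (Suc n) = (\<lambda>(T, r). r # T) ` (SIGMA T:tableaux n. addable_rows T)"
  proof (intro equalityI subsetI)
    fix U assume "U \<in> tableaux (Suc n)"
    then obtain r T where "U = r # T" "standard (r # T)" "length T = n"
      by (cases U) (auto simp: tableaux_def)
    then show "U \<in> (\<lambda>(T, r). r # T) ` (SIGMA T:tableaux n. addable_rows T)"
      using standard_ConsD[of r T] by (auto simp: tableaux_def)
  next
    fix U assume "U \<in> (\<lambda>(T, r). r # T) ` (SIGMA T:tableaux n. addable_rows T)"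
    then show "U \<in> tableaux (Suc n)"
      using standard_Cons_iff by (auto simp: tableaux_def simp del: standard.simps)
  qed
  then have "(\<Sum>T\<in>tableaux (Suc n). tab_idem T) = (\<Sum>(T, r)\<in>(SIGMA T:tableaux n. addable_rows T). tab_idem (r # T))"
    by (simp only:, subst sum.reindex) (auto simp: inj_on_def case_prod_unfold)
  also have "\<dots> = (\<Sum>T\<in>tableaux n. \<Sum>r\<in>addable_rows T. tab_idem (r # T))"
    by (rule sum.Sigma[symmetric]) (auto simp: finite_tableaux)
  also have "\<dots> = (\<Sum>T\<in>tableaux n. tab_idem T)"
    using tab_idem_sum_children by (intro sum.cong) (auto simp: tableaux_def)
  finally show ?case using Suc.IH by simp
qed

section \<open>Normalised matrix units and the two central sums\<close>

abbreviation hooks :: "nat list \<Rightarrow> real" where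
  "hooks T \<equiv> frob_hook (length T) (count_list T)"

lemma hooks_pos: "standard T \<Longrightarrow> hooks T > 0"
  by (intro frob_hook_pos standard_antimono)

lemma tab_idem_trace': "standard T \<Longrightarrow> coeffg (tab_idem T) 0 = 1 / hooks T"
  using tab_idem_trace[of T "length T"] hooks_pos[of T] by (simp add: field_simps)

definition tab_pairs :: "nat \<Rightarrow> (nat list \<times> nat list) set" where
  "tab_pairs n = {(S, T). S \<in> tableaux n \<and> T \<in> tableaux n \<and> count_list S = count_list T}"

lemma tableaux_of_count:
  assumes "S \<in> tableaux n"
  shows "tableaux_of (count_list S) = {T \<in> tableaux n. count_list S = count_list T}"
proof -
  have S: "standard S" "length S = n" using assms by (auto simp: tableaux_def)
  have "tableaux_of (count_list S) \<subseteq> tableaux n"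
    using tableaux_of_subset[of n "count_list S"] standard_count_eq_0[OF S(1)] length_eq_sum_count[of n S] S(2) by simp
  then show ?thesis by (auto simp: tableaux_of_def tableaux_def)
qed

lemma card_tableaux_of:
  assumes "S \<in> tableaux n"
  shows "real (card (tableaux_of (count_list S))) = fact n / hooks S"
proof -
  have S: "standard S" "length S = n" using assms by (auto simp: tableaux_def)
  have "real (card (tableaux_of (count_list S))) * hooks S = fact n"
  proof (rule hook_length_formula[OF standard_antimono[OF S(1)] standard_count_eq_0[OF S(1)]])
    show "(\<Sum>i<length S. count_list S i) = n"
      using length_eq_sum_count[of "length S" S] standard_count_eq_0[OF S(1)] S(2) by simp
  qed
  then show ?thesis using hooks_pos[OF S(1)] by (simp add: field_simps)
qed

text \<open>A trace computation in place of the Robinson--Schensted bijection: the shape of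
  \<open>S\<close> has n!/H tableaux, which is n! times the trace of \<open>tab_idem S\<close>, and
  the idempotents add up to 1, whose trace is 1.\<close>

lemma card_tab_pairs: "card (tab_pairs n) = fact n"
proof -
  have "tab_pairs n = (SIGMA S:tableaux n. tableaux_of (count_list S))"
    using tableaux_of_count by (auto simp: tab_pairs_def)
  moreover have "finite (tableaux_of (count_list S))" if "S \<in> tableaux n" for S
    using finite_tableaux[of n] by (simp add: tableaux_of_count[OF that])
  ultimately have "card (tab_pairs n) = (\<Sum>S\<in>tableaux n. card (tableaux_of (count_list S)))"
    using finite_tableaux by (simp add: card_SigmaI)
  then have "real (card (tab_pairs n)) = (\<Sum>S\<in>tableaux n. real (card (tableaux_of (count_list S))))"
    by simp
  also have "\<dots> = (\<Sum>S\<in>tableaux n. fact n * coeffg (tab_idem S) 0)"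
    using card_tableaux_of tab_idem_trace' by (intro sum.cong) (auto simp: tableaux_def)
  also have "\<dots> = fact n * coeffg (\<Sum>S\<in>tableaux n. tab_idem S) 0"
    by (simp add: sum_distrib_left lookup_sum)
  also have "\<dots> = fact n" by (simp add: sum_tab_idem)
  finally show ?thesis by (metis of_nat_eq_iff of_nat_fact)
qed

text \<open>Off the diagonal any vector of length 1 between the two idempotents will do, since those
  products cancel in the final sums. The diagonal is explicit because its squares are what
  remains.\<close>

definition unit_matrix :: "nat \<Rightarrow> nat list \<times> nat list \<Rightarrow> galg" where
  "unit_matrix n = (\<lambda>(S, T). if S = T then scalar (sqrt (hooks S)) * tab_idem S
    else (SOME x. x \<in> grp_alg n \<and> tab_idem S * x = x \<and> x * tab_idem T = x \<and> inner x x = 1))"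

lemma unit_matrix:
  assumes "(S, T) \<in> tab_pairs n"
  defines "x \<equiv> unit_matrix n (S, T)"
  shows "x \<in> grp_alg n \<and> tab_idem S * x = x \<and> x * tab_idem T = x \<and> inner x x = 1"
proof -
  have ST: "standard S" "standard T" "length S = n" "length T = n" "count_list S = count_list T"
    using assms(1) by (auto simp: tab_pairs_def tableaux_def)
  have EA: "tab_idem S \<in> grp_alg n" "tab_idem T \<in> grp_alg n" using tab_idem_grp_alg[of S] tab_idem_grp_alg[of T] ST by auto
  note id = tab_idem_idem[OF ST(1)] tab_idem_idem[OF ST(2)]
  show ?thesis
  proof (cases "S = T")
    case True
    have "inner x x = sqrt (hooks S) * (sqrt (hooks S) * coeffg (tab_idem S * tab_idem S) 0)"
      by (simp add: x_def True unit_matrix_def inner_def star_scalar_mult star_tab_idem mult.assoc scalar_left_commute[of "tab_idem _"])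
    also have "\<dots> = (sqrt (hooks S) * sqrt (hooks S)) * (1 / hooks S)"
      by (simp only: id tab_idem_trace'[OF ST(1)] mult.assoc)
    also have "\<dots> = 1" using hooks_pos[OF ST(1)] by simp
    finally have "inner x x = 1" .
    then show ?thesis
      using EA id True by (auto simp: x_def unit_matrix_def mult.assoc scalar_left_commute[of "tab_idem _"] intro!: grp_alg_mult)
  next
    case False
    obtain u v where uv: "u \<in> grp_alg n" "v \<in> grp_alg n" "u * v = tab_idem S" "v * u = tab_idem T"
      using linked_same_shape[OF ST] ST(3) by (auto simp: linked_def)
    \<comment> \<open>A link absorbed by both idempotents; it is nonzero because multiplication by
      \<open>v\<close> recovers \<open>tab_idem S\<close>.\<close>
    define z where "z = tab_idem S * u"
    have z_alt: "z = u * tab_idem T" by (simp add: z_def uv(3)[symmetric] uv(4)[symmetric] mult.assoc)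
    have zA: "z \<in> grp_alg n" unfolding z_def by (intro grp_alg_mult EA uv)
    have "z * v = tab_idem S" by (simp add: z_def mult.assoc uv(3) id)
    then have "z \<noteq> 0" using tab_idem_trace'[OF ST(1)] hooks_pos[OF ST(1)] by auto
    then have pos: "inner z z > 0"
      using inner_self_nonneg[OF zA] inner_self_eq_0[OF zA] by fastforce
    define y where "y = scalar (1 / sqrt (inner z z)) * z"
    have "y \<in> grp_alg n" unfolding y_def by (intro grp_alg_mult grp_alg_scalar zA)
    moreover have "tab_idem S * z = z" by (simp add: z_def mult.assoc[symmetric] id)
    then have "tab_idem S * y = y" by (simp add: y_def scalar_left_commute[of "tab_idem S"])
    moreover have "z * tab_idem T = z" by (simp add: z_alt mult.assoc id)
    then have "y * tab_idem T = y" by (simp add: y_def mult.assoc)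
    moreover have "inner y y = 1"
    proof -
      have "inner y y = 1 / sqrt (inner z z) * (1 / sqrt (inner z z) * inner z z)"
        by (simp add: y_def inner_def star_scalar_mult mult.assoc scalar_left_commute[of z])
      also have "\<dots> = inner z z / (sqrt (inner z z) * sqrt (inner z z))" by simp
      also have "\<dots> = 1" using pos by simp
      finally show ?thesis .
    qed
    ultimately have "\<exists>x. x \<in> grp_alg n \<and> tab_idem S * x = x \<and> x * tab_idem T = x \<and> inner x x = 1" by blast
    then show ?thesis
      unfolding x_def unit_matrix_def using False by simp (rule someI_ex)
  qed
qed

lemma unit_matrix_mult_eq_0:
  assumes "(S, T) \<in> tab_pairs n" "(U, V) \<in> tab_pairs n" "T \<noteq> U"
  shows "unit_matrix n (S, T) * unit_matrix n (U, V) = 0"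
proof -
  have "unit_matrix n (S, T) * unit_matrix n (U, V)
      = (unit_matrix n (S, T) * tab_idem T) * (tab_idem U * unit_matrix n (U, V))"
    using unit_matrix assms by simp
  also have "\<dots> = unit_matrix n (S, T) * (tab_idem T * tab_idem U) * unit_matrix n (U, V)"
    by (simp only: mult.assoc)
  also have "tab_idem T * tab_idem U = 0"
    using assms by (intro tab_idem_orthogonal) (auto simp: tab_pairs_def tableaux_def)
  finally show ?thesis by simp
qed

text \<open>\<open>star\<close> exchanges the outer idempotents of a matrix unit, so each of these
  products has two distinct idempotents side by side.\<close>

lemma unit_matrix_star_mult:
  assumes "(S, T) \<in> tab_pairs n" "(U, V) \<in> tab_pairs n"
  shows "T \<noteq> V \<Longrightarrow> unit_matrix n (S, T) * star (unit_matrix n (U, V)) = 0"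
    and "S \<noteq> U \<Longrightarrow> star (unit_matrix n (S, T)) * unit_matrix n (U, V) = 0"
    and "S \<noteq> V \<Longrightarrow> star (unit_matrix n (S, T)) * star (unit_matrix n (U, V)) = 0"
proof -
  have st: "star (unit_matrix n (S, T)) = star (unit_matrix n (S, T)) * tab_idem S"
      "star (unit_matrix n (U, V)) = tab_idem V * star (unit_matrix n (U, V))"
    using unit_matrix[OF assms(1)] unit_matrix[OF assms(2)] by (metis star_mult star_tab_idem)+
  have nst: "unit_matrix n (S, T) = unit_matrix n (S, T) * tab_idem T"
      "unit_matrix n (U, V) = tab_idem U * unit_matrix n (U, V)"
    using unit_matrix[OF assms(1)] unit_matrix[OF assms(2)] by auto
  have orth: "tab_idem P * tab_idem Q = 0" if "P \<in> {S, T}" "Q \<in> {U, V}" "P \<noteq> Q" for P Q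
    using assms that by (intro tab_idem_orthogonal) (auto simp: tab_pairs_def tableaux_def)
  show "T \<noteq> V \<Longrightarrow> unit_matrix n (S, T) * star (unit_matrix n (U, V)) = 0"
    by (subst st(2), subst nst(1)) (simp add: mult.assoc orth flip: mult.assoc[of "tab_idem T" "tab_idem V"])
  show "S \<noteq> U \<Longrightarrow> star (unit_matrix n (S, T)) * unit_matrix n (U, V) = 0"
    by (subst st(1), subst nst(2)) (simp add: mult.assoc orth flip: mult.assoc[of "tab_idem S" "tab_idem U"])
  show "S \<noteq> V \<Longrightarrow> star (unit_matrix n (S, T)) * star (unit_matrix n (U, V)) = 0"
    by (subst st(1), subst st(2)) (simp add: mult.assoc orth flip: mult.assoc[of "tab_idem S" "tab_idem V"])
qed

lemma finite_tab_pairs: "finite (tab_pairs n)"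
  by (rule finite_subset[of _ "tableaux n \<times> tableaux n"]) (auto simp: tab_pairs_def finite_tableaux)

lemma orthonormal_unit_matrix: "orthonormal_basis n (tab_pairs n) (unit_matrix n)"
proof -
  have "inner (unit_matrix n i) (unit_matrix n j) = 0"
    if ij: "i \<in> tab_pairs n" "j \<in> tab_pairs n" "i \<noteq> j" for i j
  proof -
    obtain S T U V where [simp]: "i = (S, T)" "j = (U, V)" by (cases i, cases j) auto
    show ?thesis
    proof (cases "T = V")
      case True
      then have "S \<noteq> U" using ij(3) by simp
      \<comment> \<open>With equal second indices nothing cancels inside the product; passing to
        \<open>star\<close> brings the distinct first indices together.\<close>
      have "inner (unit_matrix n i) (unit_matrix n j) = inner (star (unit_matrix n i)) (star (unit_matrix n j))"
        using inner_star_star[of "unit_matrix n i" n] unit_matrix[of S T n] ij(1) by simp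
      also have "\<dots> = 0"
        using unit_matrix_star_mult(2) ij \<open>S \<noteq> U\<close> by (simp add: inner_def)
      finally show ?thesis .
    next
      case False
      then show ?thesis using unit_matrix_star_mult(1) ij by (simp add: inner_def)
    qed
  qed
  then show ?thesis
    unfolding orthonormal_basis_def
    using finite_tab_pairs card_tab_pairs unit_matrix by fastforce
qed


lemma unit_matrix_diag_square:
  assumes "S \<in> tableaux n"
  shows "unit_matrix n (S, S) * unit_matrix n (S, S) = scalar (hooks S) * tab_idem S"
proof -
  have S: "standard S" using assms by (simp add: tableaux_def)
  have "unit_matrix n (S, S) * unit_matrix n (S, S) = scalar (sqrt (hooks S)) * scalar (sqrt (hooks S)) * (tab_idem S * tab_idem S)"
    by (simp add: unit_matrix_def mult.assoc scalar_left_commute[of "tab_idem S"])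
  also have "\<dots> = scalar (sqrt (hooks S) * sqrt (hooks S)) * tab_idem S"
    by (simp only: scalar_mult tab_idem_idem[OF S])
  finally show ?thesis using hooks_pos[OF S] by simp
qed

lemma star_unit_matrix_diag: "star (unit_matrix n (S, S)) = unit_matrix n (S, S)"
  by (simp add: unit_matrix_def star_scalar_mult star_tab_idem)

text \<open>The identity is admissible as \<open>\<sigma>\<close> because all coefficients are real,
  which here takes the place of the Frobenius--Schur indicators being 1. The square of the unit for
  \<open>(S, T)\<close> has the idempotents of \<open>T\<close> and \<open>S\<close> in its
  middle.\<close>

theorem sum_squares: "(\<Sum>g\<in>symgrp n. basis_elt g * basis_elt g) = (\<Sum>T\<in>tableaux n. scalar (hooks T) * tab_idem T)"
proof -
  let ?b = "unit_matrix n"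
  have "(\<Sum>g\<in>symgrp n. basis_elt g * basis_elt g) = (\<Sum>i\<in>tab_pairs n. ?b i * ?b i)"
    using orthonormal_sandwich[OF orthonormal_unit_matrix, where \<sigma>="\<lambda>x. x" and n=n and x=1] by simp
  also have "\<dots> = (\<Sum>i\<in>(\<lambda>S. (S, S)) ` tableaux n. ?b i * ?b i)"
  proof (intro sum.mono_neutral_right finite_tab_pairs ballI)
    fix i assume i: "i \<in> tab_pairs n - (\<lambda>S. (S, S)) ` tableaux n"
    obtain S T where [simp]: "i = (S, T)" by (cases i) auto
    have "S \<noteq> T" using i by (auto simp: tab_pairs_def)
    then show "?b i * ?b i = 0" using unit_matrix_mult_eq_0[of S T n S T] i by simp
  qed (auto simp: tab_pairs_def)
  also have "\<dots> = (\<Sum>S\<in>tableaux n. ?b (S, S) * ?b (S, S))"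
    by (subst sum.reindex) (auto simp: inj_on_def)
  finally show ?thesis using unit_matrix_diag_square by simp
qed

text \<open>\<open>orthonormal_sandwich\<close> is applied twice with \<open>star\<close>: to
  \<open>g\<close> around \<open>h\<close>, then to \<open>h\<close> around
  \<open>star (?b i)\<close>. At each junction of the resulting product of four units two indices
  must agree, which leaves only \<open>i = j = (S, S)\<close>.\<close>

theorem sum_commutators:
  "(\<Sum>g\<in>symgrp n. \<Sum>h\<in>symgrp n. basis_elt g * basis_elt h * basis_elt (- g) * basis_elt (- h))
    = (\<Sum>T\<in>tableaux n. scalar ((hooks T)\<^sup>2) * tab_idem T)"
proof -
  let ?b = "unit_matrix n"
  note on = orthonormal_sandwich[OF orthonormal_unit_matrix, where \<sigma>=star and n=n, OF star_sum star_scalar_mult]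
  have "(\<Sum>g\<in>symgrp n. \<Sum>h\<in>symgrp n. basis_elt g * basis_elt h * basis_elt (- g) * basis_elt (- h))
      = (\<Sum>h\<in>symgrp n. (\<Sum>g\<in>symgrp n. basis_elt g * basis_elt h * star (basis_elt g)) * star (basis_elt h))"
    by (subst sum.swap) (simp add: sum_distrib_right star_basis_elt)
  also have "\<dots> = (\<Sum>h\<in>symgrp n. \<Sum>i\<in>tab_pairs n. ?b i * (basis_elt h * star (?b i) * star (basis_elt h)))"
    unfolding on by (simp add: sum_distrib_right mult.assoc)
  also have "\<dots> = (\<Sum>i\<in>tab_pairs n. ?b i * (\<Sum>h\<in>symgrp n. basis_elt h * star (?b i) * star (basis_elt h)))"
    by (subst sum.swap) (simp add: sum_distrib_left)
  also have "\<dots> = (\<Sum>i\<in>tab_pairs n. \<Sum>j\<in>tab_pairs n. ?b i * ?b j * star (?b i) * star (?b j))"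
    unfolding on by (simp add: sum_distrib_left mult.assoc)
  also have "\<dots> = (\<Sum>p\<in>tab_pairs n \<times> tab_pairs n. ?b (fst p) * ?b (snd p) * star (?b (fst p)) * star (?b (snd p)))"
    by (simp add: sum.cartesian_product case_prod_unfold)
  also have "\<dots> = (\<Sum>p\<in>(\<lambda>S. ((S, S), (S, S))) ` tableaux n. ?b (fst p) * ?b (snd p) * star (?b (fst p)) * star (?b (snd p)))"
  proof (intro sum.mono_neutral_right finite_cartesian_product finite_tab_pairs ballI)
    show "(\<lambda>S. ((S, S), (S, S))) ` tableaux n \<subseteq> tab_pairs n \<times> tab_pairs n"
      by (auto simp: tab_pairs_def)
    fix p assume p: "p \<in> tab_pairs n \<times> tab_pairs n - (\<lambda>S. ((S, S), (S, S))) ` tableaux n"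
    obtain S T U V where p_eq: "p = ((S, T), (U, V))" by (metis prod.exhaust)
    have m: "(S, T) \<in> tab_pairs n" "(U, V) \<in> tab_pairs n" using p p_eq by auto
    have neq: "\<not> (T = U \<and> V = T \<and> S = V)" using p p_eq by (auto simp: tab_pairs_def)
    then consider "T \<noteq> U" | "V \<noteq> T" | "S \<noteq> V" by auto
    then have "?b (S, T) * ?b (U, V) * star (?b (S, T)) * star (?b (U, V)) = 0"
    proof cases
      case 1
      then show ?thesis using unit_matrix_mult_eq_0[OF m] by simp
    next
      case 2
      then show ?thesis using unit_matrix_star_mult(1)[OF m(2,1)] by (simp add: mult.assoc)
    next
      case 3
      then show ?thesis using unit_matrix_star_mult(3)[OF m] by (simp add: mult.assoc)
    qed
    then show "?b (fst p) * ?b (snd p) * star (?b (fst p)) * star (?b (snd p)) = 0"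
      by (simp add: p_eq)
  qed
  also have "\<dots> = (\<Sum>S\<in>tableaux n. ?b (S, S) * ?b (S, S) * (?b (S, S) * ?b (S, S)))"
    by (subst sum.reindex) (auto simp: inj_on_def star_unit_matrix_diag mult.assoc)
  also have "\<dots> = (\<Sum>S\<in>tableaux n. scalar ((hooks S)\<^sup>2) * tab_idem S)"
  proof (rule sum.cong)
    fix S assume S: "S \<in> tableaux n"
    then have "standard S" by (simp add: tableaux_def)
    have "scalar (hooks S) * tab_idem S * (scalar (hooks S) * tab_idem S) = scalar (hooks S) * (scalar (hooks S) * tab_idem S * tab_idem S)"
      by (rule scalar_left_commute)
    also have "\<dots> = scalar ((hooks S)\<^sup>2) * tab_idem S"
      by (simp add: mult.assoc tab_idem_idem[OF \<open>standard S\<close>] power2_eq_square scalar_mult)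
    finally show "?b (S, S) * ?b (S, S) * (?b (S, S) * ?b (S, S)) = scalar ((hooks S)\<^sup>2) * tab_idem S"
      by (simp only: unit_matrix_diag_square[OF S])
  qed simp
  finally show ?thesis .
qed

lemma sum_tab_idem_power:
  assumes "k \<ge> 1"
  shows "(\<Sum>T\<in>tableaux n. scalar (w T) * tab_idem T) ^ k = (\<Sum>T\<in>tableaux n. scalar (w T ^ k) * tab_idem T)"
  using assms
proof (induction k rule: dec_induct)
  case (step k)
  have "(\<Sum>T\<in>tableaux n. scalar (w T) * tab_idem T) ^ Suc k
      = (\<Sum>S\<in>tableaux n. \<Sum>T\<in>tableaux n. (scalar (w S) * tab_idem S) * (scalar (w T ^ k) * tab_idem T))"
    using step.IH by (simp add: sum_product)
  also have "\<dots> = (\<Sum>S\<in>tableaux n. \<Sum>T\<in>tableaux n. if S = T then scalar (w S ^ Suc k) * tab_idem S else 0)"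
  proof (intro sum.cong refl)
    fix S T assume ST: "S \<in> tableaux n" "T \<in> tableaux n"
    have "(scalar (w S) * tab_idem S) * (scalar (w T ^ k) * tab_idem T) = scalar (w T ^ k) * (scalar (w S) * tab_idem S * tab_idem T)"
      by (rule scalar_left_commute)
    also have "\<dots> = scalar (w T ^ k * w S) * (tab_idem S * tab_idem T)"
      by (simp only: scalar_mult mult.assoc)
    finally have eq: "(scalar (w S) * tab_idem S) * (scalar (w T ^ k) * tab_idem T) = scalar (w T ^ k * w S) * (tab_idem S * tab_idem T)" .
    show "(scalar (w S) * tab_idem S) * (scalar (w T ^ k) * tab_idem T) = (if S = T then scalar (w S ^ Suc k) * tab_idem S else 0)"
      unfolding eq using ST tab_idem_orthogonal[of S T] tab_idem_idem[of S]
      by (auto simp: tableaux_def mult.commute)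
  qed
  also have "\<dots> = (\<Sum>S\<in>tableaux n. scalar (w S ^ Suc k) * tab_idem S)"
    using finite_tableaux by (simp add: sum.delta)
  finally show ?case .
qed simp

section \<open>Cycle counts and the main theorem\<close>

text \<open>\<open>g\<close> arises from \<open>v\<close> by inserting \<open>Suc n\<close> into the
  cycle of \<open>j\<close>, directly after \<open>j\<close>.\<close>

lemma orbit_insert_transpose:
  assumes v: "v permutes {1..n}" and j: "j \<in> {1..n}" and x: "x \<in> {1..n}"
  defines "g \<equiv> v \<circ> transpose j (Suc n)"
  shows "orbit g x \<inter> {1..n} = orbit v x"
proof -
  have perm: "permutation v" using v permutation_permutes by blast
  have gj: "g j = Suc n" and gn: "g (Suc n) = v j" and g: "\<And>y. y \<noteq> j \<Longrightarrow> y \<noteq> Suc n \<Longrightarrow> g y = v y"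
    using permutes_not_in[OF v, of "Suc n"] by (auto simp: g_def transpose_def)
  have v_in: "v y \<in> {1..n} \<longleftrightarrow> y \<in> {1..n}" for y using permutes_in_image[OF v] .
  have "y \<in> orbit g x" if "y \<in> orbit v x" for y
    using that
  proof induction
    case base
    show ?case
    proof (cases "x = j")
      case True
      then have "Suc n \<in> orbit g x" using gj orbit.base[of g x] by simp
      then show ?thesis using orbit.step[of "Suc n" g x] gn True by simp
    next
      case False
      then show ?thesis using g[of x] x orbit.base[of g x] by simp
    qed
  next
    case (step y)
    have y: "y \<in> {1..n}" using permutes_orbit_subset[OF v x] step.hyps by auto
    show ?case
    proof (cases "y = j")
      case True
      then have "Suc n \<in> orbit g x" using gj orbit.step[OF step.IH] by simp
      then show ?thesis using orbit.step[of "Suc n" g x] gn True by simp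
    next
      case False
      then show ?thesis using g[of y] y orbit.step[OF step.IH] by simp
    qed
  qed
  \<comment> \<open>The inserted point is represented by its predecessor \<open>j\<close>, which
    gives an invariant that survives the step through \<open>Suc n\<close>.\<close>
  moreover have "if z = Suc n then j \<in> orbit v x else z \<in> orbit v x" if "z \<in> orbit g x" for z
    using that
  proof induction
    case base
    show ?case
      using gj g[of x] x orbit.base[of v x] permutation_self_in_orbit[OF perm, of j] v_in[of x]
      by (cases "x = j") auto
  next
    case (step z)
    consider "z = Suc n" | "z = j" | "z \<noteq> Suc n" "z \<noteq> j" by blast
    then show ?case
    proof cases
      case 1
      then show ?thesis using step.IH orbit.step[of j v x] gn v_in[of j] j by auto
    next
      case 2
      then show ?thesis using step.IH gj j by auto
    next
      case 3
      then have "z \<in> orbit v x" using step.IH by simp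
      then have vz: "v z \<in> orbit v x" by (rule orbit.step)
      then have "v z \<in> {1..n}" using permutes_orbit_subset[OF v x] by (rule subsetD[rotated])
      then show ?thesis using vz g[OF 3(2,1)] by auto
    qed
  qed
  ultimately show ?thesis
    using permutes_orbit_subset[OF v x] by fastforce
qed

text \<open>The inserted point joins an existing cycle, so intersecting with \<open>{1..n}\<close>
  maps the cycles of the enlarged permutation bijectively to those of \<open>v\<close>.\<close>

lemma num_cycles_insert_transpose:
  assumes v: "v permutes {1..n}" and j: "j \<in> {1..n}"
  shows "num_cycles (Suc n) (v \<circ> transpose j (Suc n)) = num_cycles n v"
proof -
  define g where "g = v \<circ> transpose j (Suc n)"
  have "v permutes {1..Suc n}" using v by (rule permutes_subset) auto
  moreover have "transpose j (Suc n) permutes {1..Suc n}" using j by (intro permutes_swap_id) auto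
  ultimately have gp: "g permutes {1..Suc n}" unfolding g_def by (intro permutes_compose)
  then have perm: "permutation g" using permutation_permutes by blast
  have int: "orbit g x \<inter> {1..n} = orbit v x" if "x \<in> {1..n}" for x
    unfolding g_def by (rule orbit_insert_transpose[OF v j that])
  have self: "x \<in> orbit g x" for x by (rule permutation_self_in_orbit[OF perm])
  have "orbit g (g (Suc n)) = orbit g (Suc n)" by (rule permutation_orbit_step[OF perm])
  moreover have "g (Suc n) = v j" by (simp add: g_def)
  moreover have "v j \<in> {1..n}" using permutes_in_image[OF v] j by blast
  ultimately have "orbit g (Suc n) \<in> orbit g ` {1..n}" by (metis imageI)
  moreover have "{1..Suc n} = insert (Suc n) {1..n}" by auto
  ultimately have "orbit g ` {1..Suc n} = orbit g ` {1..n}" by auto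
  moreover have "card (orbit g ` {1..n}) = card (orbit v ` {1..n})"
  proof (rule bij_betw_same_card[of "\<lambda>B. B \<inter> {1..n}"], rule bij_betw_imageI)
    show "inj_on (\<lambda>B. B \<inter> {1..n}) (orbit g ` {1..n})"
    proof (rule inj_onI, clarsimp)
      fix x y assume xy: "Suc 0 \<le> x" "x \<le> n" "Suc 0 \<le> y" "y \<le> n"
        and eq: "orbit g x \<inter> {Suc 0..n} = orbit g y \<inter> {Suc 0..n}"
      have "x \<in> orbit g x \<inter> {Suc 0..n}" using self[of x] xy(1,2) by simp
      then have "x \<in> orbit g y" unfolding eq by simp
      then show "orbit g x = orbit g y"
        by (rule orbit_cyclic_eq3[OF cyclic_on_orbit'[OF perm]])
    qed
    show "(\<lambda>B. B \<inter> {1..n}) ` orbit g ` {1..n} = orbit v ` {1..n}"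
      unfolding image_image using int by (intro image_cong) auto
  qed
  ultimately show ?thesis by (simp add: num_cycles_def g_def)
qed

lemma num_cycles_Suc:
  assumes v: "v permutes {1..n}"
  shows "num_cycles (Suc n) v = Suc (num_cycles n v)"
proof -
  have "v (Suc n) = Suc n" using permutes_not_in[OF v] by simp
  then have "orbit v (Suc n) = {Suc n}" by (simp add: orbit_eq_singleton_iff)
  moreover have "{Suc n} \<notin> orbit v ` {1..n}"
    using permutes_orbit_subset[OF v] by fastforce
  ultimately show ?thesis
    by (simp add: num_cycles_def atLeastAtMostSuc_conv)
qed

section \<open>Jucys' factorisation of the generating function of cycle counts\<close>

primrec JM_prod :: "real \<Rightarrow> nat \<Rightarrow> galg" where
  "JM_prod q 0 = 1"
| "JM_prod q (Suc n) = JM_prod q n * (scalar q + JM (Suc n))"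

lemma JM_prod_grp_alg: "JM_prod q n \<in> grp_alg n"
proof (induction n)
  case (Suc n)
  then have "JM_prod q n \<in> grp_alg (Suc n)" by (rule grp_alg_mono[rotated]) simp
  then show ?case by (auto intro!: grp_alg_mult grp_alg_add JM_grp_alg)
qed simp

lemma JM_prod_tab_idem:
  assumes "standard T"
  shows "JM_prod q (length T) * tab_idem T = scalar (content_prod q T) * tab_idem T"
  using assms
proof (induction T)
  case (Cons r T)
  define J where "J = JM (Suc (length T))"
  define c where "c = next_content T r"
  have std: "standard T" using Cons.prems by simp
  have J: "J * tab_idem (r # T) = scalar c * tab_idem (r # T)"
    unfolding J_def c_def by (rule tab_idem_eigen_left[OF Cons.prems])
  have "JM_prod q (length (r # T)) * tab_idem (r # T) = JM_prod q (length T) * ((scalar q + J) * tab_idem (r # T))"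
    by (simp only: length_Cons JM_prod.simps J_def mult.assoc)
  also have "(scalar q + J) * tab_idem (r # T) = scalar (q + c) * tab_idem (r # T)"
    by (simp only: distrib_right J scalar_add)
  also have "JM_prod q (length T) * (scalar (q + c) * tab_idem (r # T)) = scalar (q + c) * (JM_prod q (length T) * tab_idem (r # T))"
    by (rule scalar_left_commute)
  also have "JM_prod q (length T) * tab_idem (r # T) = scalar (content_prod q T) * tab_idem (r # T)"
    using Cons.IH[OF std] by (simp only: tab_idem.simps mult.assoc[symmetric])
  finally show ?case
    by (simp add: c_def mult.assoc[symmetric] scalar_mult[symmetric] mult.commute del: tab_idem.simps)
qed simp

text \<open>A permutation in \<open>symgrp (Suc n)\<close> either fixes \<open>Suc n\<close>, a new
  cycle that accounts for the factor \<open>q\<close>, or is in exactly one way a permutation in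
  \<open>symgrp n\<close> times a summand of \<open>JM (Suc n)\<close>, which keeps the number of
  cycles.\<close>

lemma coeffg_JM_prod:
  assumes "g \<in> symgrp n"
  shows "coeffg (JM_prod q n) g = q ^ num_cycles n (apply g)"
  using assms
proof (induction n arbitrary: g)
  case 0
  then have "g = 0" by (auto simp: symgrp_iff apply_zero intro!: perm_eqI)
  then show ?case by (simp add: num_cycles_def)
next
  case (Suc n)
  have coeff: "coeffg (JM_prod q (Suc n)) g
      = q * coeffg (JM_prod q n) g + (\<Sum>i\<in>{1..n}. coeffg (JM_prod q n) (g + \<langle>i \<leftrightarrow> Suc n\<rangle>))"
  proof -
    have "JM_prod q (Suc n) = scalar q * JM_prod q n + (\<Sum>i\<in>{1..n}. JM_prod q n * basis_elt \<langle>i \<leftrightarrow> Suc n\<rangle>)"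
      by (simp only: JM_prod.simps distrib_left scalar_commute JM_def sum_distrib_left atLeastLessThanSuc_atLeastAtMost)
    then show ?thesis
      by (simp only: lookup_add lookup_sum coeffg_scalar_mult coeffg_mult_basis_elt uminus_swap)
  qed
  have zero: "coeffg (JM_prod q n) h = 0" if "h \<notin> symgrp n" for h
    using JM_prod_grp_alg[of q n] that by (simp add: grp_alg_iff)
  have gp: "apply g permutes {1..Suc n}" using Suc.prems by (simp add: symgrp_permutes)
  show ?case
  proof (cases "g \<langle>$\<rangle> (Suc n) = Suc n")
    case True
    then have g: "g \<in> symgrp n"
      using Suc.prems by (auto simp: symgrp_iff) (metis Suc_leI le_SucE not_less_eq_eq)
    have "g + \<langle>i \<leftrightarrow> Suc n\<rangle> \<notin> symgrp n" if "i \<in> {1..n}" for i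
    proof
      assume "g + \<langle>i \<leftrightarrow> Suc n\<rangle> \<in> symgrp n"
      then have "\<langle>i \<leftrightarrow> Suc n\<rangle> \<in> symgrp n" using symgrp_plus_iff(1)[OF g] by simp
      then have "\<langle>i \<leftrightarrow> Suc n\<rangle> \<langle>$\<rangle> (Suc n) = Suc n"
        by (auto simp: symgrp_iff simp del: apply_swap_simp apply_swap_eq_iff)
      then show False using that by simp
    qed
    then have "coeffg (JM_prod q (Suc n)) g = q * coeffg (JM_prod q n) g"
      unfolding coeff by (simp add: zero)
    also have "\<dots> = q ^ num_cycles (Suc n) (apply g)"
      using Suc.IH[OF g] g num_cycles_Suc by (simp add: symgrp_permutes)
    finally show ?thesis .
  next
    case False
    have "Suc n \<in> apply g ` {1..Suc n}" using permutes_image[OF gp] by simp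
    then obtain j where j': "g \<langle>$\<rangle> j = Suc n" "j \<in> {1..Suc n}" by auto
    then have "j \<noteq> Suc n" using False by metis
    with j' have j: "g \<langle>$\<rangle> j = Suc n" "j \<in> {1..n}" by auto
    define v where "v = g + \<langle>j \<leftrightarrow> Suc n\<rangle>"
    have "v \<langle>$\<rangle> a = a" if "a \<notin> {1..n}" for a
      using Suc.prems that j by (cases "a = Suc n") (auto simp: v_def apply_plus apply_swap transpose_def symgrp_iff)
    then have v: "v \<in> symgrp n" by (simp add: symgrp_iff)
    have g: "g = v + \<langle>j \<leftrightarrow> Suc n\<rangle>" by (simp add: v_def add.assoc swap_plus_swap)
    have "g \<notin> symgrp n" using False by (auto simp: symgrp_iff intro!: exI[of _ "Suc n"])
    moreover have "g + \<langle>i \<leftrightarrow> Suc n\<rangle> \<notin> symgrp n" if "i \<in> {1..n}" "i \<noteq> j" for i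
    proof
      assume "g + \<langle>i \<leftrightarrow> Suc n\<rangle> \<in> symgrp n"
      then have "(g + \<langle>i \<leftrightarrow> Suc n\<rangle>) \<langle>$\<rangle> (Suc n) = Suc n"
        by (auto simp: symgrp_iff)
      then have "g \<langle>$\<rangle> i = Suc n" by (simp add: apply_plus)
      then show False using j that apply_inj[of g i j] by simp
    qed
    ultimately have "coeffg (JM_prod q n) g = 0"
      and "\<And>i. i \<in> {1..n} \<Longrightarrow> coeffg (JM_prod q n) (g + \<langle>i \<leftrightarrow> Suc n\<rangle>)
        = (if i = j then coeffg (JM_prod q n) v else 0)"
      using zero by (auto simp: v_def)
    then have "coeffg (JM_prod q (Suc n)) g = (\<Sum>i\<in>{1..n}. if i = j then coeffg (JM_prod q n) v else 0)"
      unfolding coeff by (simp only: mult_zero_right add_0_left cong: sum.cong)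
    also have "\<dots> = coeffg (JM_prod q n) v" using j by simp
    also have "\<dots> = q ^ num_cycles n (apply v)" by (rule Suc.IH[OF v])
    also have "num_cycles n (apply v) = num_cycles (Suc n) (apply g)"
    proof -
      have "apply g = apply v \<circ> transpose j (Suc n)"
        by (subst g) (simp add: apply_plus swap.rep_eq)
      then show ?thesis
        using num_cycles_insert_transpose[of "apply v" n j] v j by (simp add: symgrp_permutes)
    qed
    finally show ?thesis .
  qed
qed

section \<open>From permutations as functions to the group algebra\<close>

definition perm_delta :: "(nat \<Rightarrow> nat) \<Rightarrow> galg" where
  "perm_delta p = basis_elt (Perm p)"

lemma apply_Perm:
  assumes "p \<in> Sym n"
  shows "apply (Perm p) = p"
proof -
  have p: "p permutes {1..n}" using assms by (simp add: Sym_def)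
  then have "{a. p a \<noteq> a} \<subseteq> {1..n}" using permutes_not_in[OF p] by blast
  then show ?thesis
    using permutes_bij[OF p] finite_subset by (intro Perm_inverse) blast
qed

lemma Perm_symgrp: "p \<in> Sym n \<Longrightarrow> Perm p \<in> symgrp n"
  using apply_Perm[of p n] by (simp add: symgrp_permutes Sym_def)

lemma perm_delta_comp:
  assumes "p \<in> Sym n" "r \<in> Sym n"
  shows "perm_delta (p \<circ> r) = perm_delta p * perm_delta r"
proof -
  have "p \<circ> r \<in> Sym n" using assms by (simp add: Sym_def permutes_compose)
  then have "Perm (p \<circ> r) = Perm p + Perm r"
    using assms by (intro perm_eqI) (simp add: apply_plus apply_Perm)
  then show ?thesis by (simp add: perm_delta_def basis_elt_plus)
qed

lemma perm_delta_inv: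
  assumes "p \<in> Sym n"
  shows "perm_delta (inv p) = basis_elt (- Perm p)"
proof -
  have "inv p \<in> Sym n" using assms by (simp add: Sym_def permutes_inv)
  then have "Perm (inv p) = - Perm p"
    using assms by (intro perm_eqI) (simp add: apply_uminus apply_Perm)
  then show ?thesis by (simp add: perm_delta_def)
qed

lemma perm_delta_id: "perm_delta id = 1"
proof -
  have "Perm id = (0 :: nat perm)" 
    using apply_Perm[of id 0] by (intro perm_eqI) (simp add: apply_zero Sym_def permutes_id)
  then show ?thesis by (simp add: perm_delta_def basis_elt_zero)
qed

lemma sum_Sym: "(\<Sum>p\<in>Sym n. f p) = (\<Sum>g\<in>symgrp n. f (apply g))"
  using sum.reindex_bij_betw[OF symgrp_bij, of f] by (simp add: Sym_def)

lemma Perm_apply: "Perm (apply g) = g"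
  by (rule type_definition.Rep_inverse[OF type_definition_perm])

lemma Sym_comp: "p \<in> Sym n \<Longrightarrow> r \<in> Sym n \<Longrightarrow> p \<circ> r \<in> Sym n"
  by (simp add: Sym_def permutes_compose)

lemma Sym_inv: "p \<in> Sym n \<Longrightarrow> inv p \<in> Sym n"
  by (simp add: Sym_def permutes_inv)

lemma comp_prod_0: "comp_prod f 0 = id"
  by (simp add: comp_prod_def)

lemma comp_prod_Suc: "comp_prod f (Suc k) = comp_prod f k \<circ> f (Suc k)"
proof -
  have "foldr (\<circ>) (xs @ [y]) id = foldr (\<circ>) xs id \<circ> y" for xs and y :: "'a \<Rightarrow> 'a"
    by (induction xs) (simp_all add: comp_assoc)
  moreover have "map f [1..<Suc (Suc k)] = map f [1..<Suc k] @ [f (Suc k)]" by simp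
  ultimately show ?thesis by (simp only: comp_prod_def)
qed

lemma comp_prod_cong: "(\<And>i. 1 \<le> i \<Longrightarrow> i \<le> k \<Longrightarrow> f i = f' i) \<Longrightarrow> comp_prod f k = comp_prod f' k"
  by (induction k) (auto simp: comp_prod_0 comp_prod_Suc)

lemma comp_prod_Sym: "(\<And>i. 1 \<le> i \<Longrightarrow> i \<le> k \<Longrightarrow> f i \<in> Sym n) \<Longrightarrow> comp_prod f k \<in> Sym n"
  by (induction k) (auto simp: comp_prod_0 comp_prod_Suc Sym_comp, simp add: Sym_def permutes_id)

lemma sum_PiE_Suc:
  "(\<Sum>u\<in>{1..Suc k} \<rightarrow>\<^sub>E Y. F u) = (\<Sum>y\<in>Y. \<Sum>u\<in>{1..k} \<rightarrow>\<^sub>E Y. F (u(Suc k := y)))"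
proof -
  have 1: "{1..Suc k} = insert (Suc k) {1..k}" by auto
  have "inj_on (\<lambda>(y, u). u(Suc k := y)) (Y \<times> ({1..k} \<rightarrow>\<^sub>E Y))"
    by (rule inj_combinator) simp
  then have "(\<Sum>u\<in>{1..Suc k} \<rightarrow>\<^sub>E Y. F u) = (\<Sum>(y, u)\<in>Y \<times> ({1..k} \<rightarrow>\<^sub>E Y). F (u(Suc k := y)))"
    unfolding 1 PiE_insert_eq by (subst sum.reindex) (auto simp: case_prod_unfold)
  then show ?thesis by (simp add: sum.cartesian_product)
qed

text \<open>Distributivity over tuples. The two arguments of \<open>c\<close> fit the commutators;
  the squares use \<open>Z = {()}\<close>, for which there is just one tuple.\<close>

lemma sum_comp_prod:
  assumes c: "\<And>y z. y \<in> Y \<Longrightarrow> z \<in> Z \<Longrightarrow> c y z \<in> Sym n"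
  shows "(\<Sum>u\<in>{1..k} \<rightarrow>\<^sub>E Y. \<Sum>v\<in>{1..k} \<rightarrow>\<^sub>E Z. perm_delta (comp_prod (\<lambda>i. c (u i) (v i)) k))
    = (\<Sum>y\<in>Y. \<Sum>z\<in>Z. perm_delta (c y z)) ^ k"
proof (induction k)
  case 0
  then show ?case by (simp add: comp_prod_0 perm_delta_id[unfolded id_def] id_def)
next
  case (Suc k)
  have step: "perm_delta (comp_prod (\<lambda>i. c ((u(Suc k := y)) i) ((v(Suc k := z)) i)) (Suc k))
      = perm_delta (comp_prod (\<lambda>i. c (u i) (v i)) k) * perm_delta (c y z)"
    if "u \<in> {1..k} \<rightarrow>\<^sub>E Y" "v \<in> {1..k} \<rightarrow>\<^sub>E Z" "y \<in> Y" "z \<in> Z" for u v y z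
  proof -
    have "comp_prod (\<lambda>i. c ((u(Suc k := y)) i) ((v(Suc k := z)) i)) k = comp_prod (\<lambda>i. c (u i) (v i)) k"
      by (rule comp_prod_cong) simp
    moreover have "comp_prod (\<lambda>i. c (u i) (v i)) k \<in> Sym n"
      using that c by (intro comp_prod_Sym) (auto simp: PiE_def Pi_def)
    ultimately show ?thesis
      using c[OF that(3,4)] by (simp add: comp_prod_Suc perm_delta_comp)
  qed
  have "(\<Sum>u\<in>{1..Suc k} \<rightarrow>\<^sub>E Y. \<Sum>v\<in>{1..Suc k} \<rightarrow>\<^sub>E Z. perm_delta (comp_prod (\<lambda>i. c (u i) (v i)) (Suc k)))
    = (\<Sum>y\<in>Y. \<Sum>u\<in>{1..k} \<rightarrow>\<^sub>E Y. \<Sum>z\<in>Z. \<Sum>v\<in>{1..k} \<rightarrow>\<^sub>E Z.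
        perm_delta (comp_prod (\<lambda>i. c (u i) (v i)) k) * perm_delta (c y z))"
    unfolding sum_PiE_Suc by (intro sum.cong refl step)
  also have "\<dots> = (\<Sum>y\<in>Y. \<Sum>z\<in>Z. \<Sum>u\<in>{1..k} \<rightarrow>\<^sub>E Y. \<Sum>v\<in>{1..k} \<rightarrow>\<^sub>E Z.
        perm_delta (comp_prod (\<lambda>i. c (u i) (v i)) k) * perm_delta (c y z))"
    by (intro sum.cong refl sum.swap)
  also have "\<dots> = (\<Sum>y\<in>Y. \<Sum>z\<in>Z. perm_delta (c y z)) ^ k * (\<Sum>y\<in>Y. \<Sum>z\<in>Z. perm_delta (c y z))"
    unfolding Suc.IH[symmetric] by (simp add: sum_distrib_left sum_distrib_right)
  finally show ?case by (simp only: power_Suc2)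
qed

lemma sum_cycles_eq_inner:
  assumes "p \<in> Sym n"
  shows "q ^ num_cycles n p = inner (perm_delta p) (JM_prod q n)"
  using coeffg_JM_prod[OF Perm_symgrp[OF assms], of q] apply_Perm[OF assms]
  by (simp add: perm_delta_def inner_basis_elt_left)

lemma inner_tab_idem_JM_prod:
  assumes "standard T"
  shows "inner (tab_idem T) (JM_prod q (length T)) = content_prod q T / hooks T"
proof -
  have "inner (tab_idem T) (JM_prod q (length T)) = coeffg (star (tab_idem T * star (JM_prod q (length T)))) 0"
    by (simp add: inner_def coeffg_star)
  also have "star (tab_idem T * star (JM_prod q (length T))) = scalar (content_prod q T) * tab_idem T"
    using JM_prod_tab_idem[OF assms] by (simp add: star_mult star_tab_idem)
  finally show ?thesis using tab_idem_trace'[OF assms] by simp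
qed

text \<open>Each tableau brings 1/H through the trace of its idempotent and each shape has n!/H
  tableaux, so a central element with weights w(H) pairs to w(H)/H^2 after division by n!.\<close>

lemma inner_central:
  fixes w :: "real \<Rightarrow> real"
  shows "inner (\<Sum>T\<in>tableaux n. scalar (w (hooks T)) * tab_idem T) (JM_prod q n) / fact n
    = (\<Sum>\<mu>\<in>partitions n. w (real (hook_product \<mu>)) / (real (hook_product \<mu>))\<^sup>2 *
        (\<Prod>t\<in>young_diagram \<mu>. q + of_int (content t)))"
proof -
  define C where "C \<nu> = (\<Prod>i<n. \<Prod>j<\<nu> i. q + (real j - real i))" for \<nu>
  define H where "H = frob_hook n"
  have "inner (\<Sum>T\<in>tableaux n. scalar (w (hooks T)) * tab_idem T) (JM_prod q n) / fact n
      = (\<Sum>T\<in>tableaux n. w (H (count_list T)) * (C (count_list T) / H (count_list T)) / fact n)"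
    unfolding inner_sum_left inner_scalar_left sum_divide_distrib
  proof (rule sum.cong)
    fix T assume T: "T \<in> tableaux n"
    then have "standard T" "length T = n" by (auto simp: tableaux_def)
    then have "content_prod q T = C (count_list T)"
      unfolding C_def using standard_row_less[of T] by (intro content_prod_eq) auto
    then show "w (hooks T) * inner (tab_idem T) (JM_prod q n) / fact n
        = w (H (count_list T)) * (C (count_list T) / H (count_list T)) / fact n"
      using inner_tab_idem_JM_prod[OF \<open>standard T\<close>, of q] \<open>length T = n\<close> by (simp add: H_def)
  qed simp
  also have "\<dots> = (\<Sum>\<mu>\<in>partitions n. real (card (tableaux_of (rows \<mu>))) *
      (w (H (rows \<mu>)) * (C (rows \<mu>) / H (rows \<mu>)) / fact n))"
    by (rule sum_tableaux_by_shape)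
  also have "\<dots> = (\<Sum>\<mu>\<in>partitions n. w (real (hook_product \<mu>)) / (real (hook_product \<mu>))\<^sup>2 *
        (\<Prod>t\<in>young_diagram \<mu>. q + of_int (content t)))"
  proof (rule sum.cong)
    fix \<mu> assume \<mu>: "\<mu> \<in> partitions n"
    have len: "length \<mu> \<le> n" by (rule partition_length_le[OF \<mu>])
    have "(\<Sum>i<n. rows \<mu> i) = n"
      using rows_sum[OF len] \<mu> by (simp add: partitions_def)
    then have "real (card (tableaux_of (rows \<mu>))) * H (rows \<mu>) = fact n"
      unfolding H_def using len by (intro hook_length_formula rows_antimono[OF \<mu>]) (auto simp: rows_def)
    moreover have "H (rows \<mu>) > 0" unfolding H_def by (rule frob_hook_pos[OF rows_antimono[OF \<mu>]])
    ultimately have "real (card (tableaux_of (rows \<mu>))) = fact n / H (rows \<mu>)"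
      by (simp add: field_simps)
    moreover have "real (hook_product \<mu>) = H (rows \<mu>)"
      unfolding H_def by (rule hook_product_eq[OF \<mu> len])
    moreover have "(\<Prod>t\<in>young_diagram \<mu>. q + of_int (content t)) = C (rows \<mu>)"
      unfolding C_def by (rule young_content_prod[OF len])
    ultimately show "real (card (tableaux_of (rows \<mu>))) *
        (w (H (rows \<mu>)) * (C (rows \<mu>) / H (rows \<mu>)) / fact n)
      = w (real (hook_product \<mu>)) / (real (hook_product \<mu>))\<^sup>2 *
        (\<Prod>t\<in>young_diagram \<mu>. q + of_int (content t))"
      by (simp add: power2_eq_square)
  qed simp
  finally show ?thesis .
qed

lemma sum_squares_Sym:
  "(\<Sum>p\<in>Sym n. perm_delta (p ^^ 2)) = (\<Sum>T\<in>tableaux n. scalar (hooks T) * tab_idem T)"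
proof -
  have "perm_delta (apply g ^^ 2) = basis_elt g * basis_elt g" if "g \<in> symgrp n" for g
  proof -
    have "apply g \<in> Sym n" using that by (simp add: symgrp_permutes Sym_def)
    then have "perm_delta (apply g \<circ> apply g) = perm_delta (apply g) * perm_delta (apply g)"
      by (intro perm_delta_comp)
    then show ?thesis by (simp add: numeral_2_eq_2 perm_delta_def Perm_apply)
  qed
  then show ?thesis unfolding sum_Sym sum_squares[symmetric] by (intro sum.cong) auto
qed

lemma sum_commutators_Sym:
  "(\<Sum>p\<in>Sym n. \<Sum>r\<in>Sym n. perm_delta (commutator p r)) = (\<Sum>T\<in>tableaux n. scalar ((hooks T)\<^sup>2) * tab_idem T)"
proof -
  have "perm_delta (commutator (apply g) (apply h)) = basis_elt g * basis_elt h * basis_elt (- g) * basis_elt (- h)"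
    if "g \<in> symgrp n" "h \<in> symgrp n" for g h
  proof -
    have "apply g \<in> Sym n" "apply h \<in> Sym n" using that by (auto simp: symgrp_permutes Sym_def)
    then show ?thesis
      using perm_delta_inv[of _ n]
      by (simp add: commutator_def perm_delta_comp[of _ n] Sym_comp Sym_inv)
         (simp add: perm_delta_def Perm_apply)
  qed
  then show ?thesis unfolding sum_Sym sum_commutators[symmetric] by (intro sum.cong) auto
qed

theorem corollary5:
  fixes n k g q :: nat
  assumes "n \<ge> 1" and "k \<ge> 1" and "g \<ge> 1" and "q \<ge> 1"
  shows "((1 / fact n) *
      (\<Sum>u\<in>{1..k} \<rightarrow>\<^sub>E Sym n. real q ^ num_cycles n (comp_prod (\<lambda>i. u i ^^ 2) k))
    = (\<Sum>\<mu>\<in>partitions n. real (hook_product \<mu>) powi (int k - 2) *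
        (\<Prod>t\<in>young_diagram \<mu>. real q + of_int (content t))))
    \<and> ((1 / fact n) *
      (\<Sum>u\<in>{1..g} \<rightarrow>\<^sub>E Sym n. \<Sum>v\<in>{1..g} \<rightarrow>\<^sub>E Sym n.
        real q ^ num_cycles n (comp_prod (\<lambda>i. commutator (u i) (v i)) g))
    = (\<Sum>\<mu>\<in>partitions n. real (hook_product \<mu>) powi (2 * int g - 2) *
        (\<Prod>t\<in>young_diagram \<mu>. real q + of_int (content t))))"
proof (rule conjI)
  define F where "F = JM_prod (real q) n"
  have hook_nz: "real (hook_product \<mu>) \<noteq> 0" if "\<mu> \<in> partitions n" for \<mu>
    using hook_product_eq[OF that partition_length_le[OF that]] frob_hook_pos[OF rows_antimono[OF that], of n] by simp
  \<comment> \<open>The exponent is -1 for \<open>m = 1\<close>, so splitting off the square relies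
    on a nonzero hook product.\<close>
  have "real (hook_product \<mu>) powi (int m - 2) = real (hook_product \<mu>) ^ m / (real (hook_product \<mu>))\<^sup>2"
    if "\<mu> \<in> partitions n" for \<mu> m
    using hook_nz[OF that] by (simp add: power_int_diff)
  note powi = this
  have sq: "p ^^ 2 \<in> Sym n" if "p \<in> Sym n" for p
    using Sym_comp[OF that that] by (simp add: numeral_2_eq_2)
  have "(\<Sum>u\<in>{1..k} \<rightarrow>\<^sub>E Sym n. real q ^ num_cycles n (comp_prod (\<lambda>i. u i ^^ 2) k))
      = (\<Sum>u\<in>{1..k} \<rightarrow>\<^sub>E Sym n. inner (perm_delta (comp_prod (\<lambda>i. u i ^^ 2) k)) F)"
    unfolding F_def by (intro sum.cong refl sum_cycles_eq_inner comp_prod_Sym sq) (auto simp: PiE_def Pi_def)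
  also have "\<dots> = inner (\<Sum>u\<in>{1..k} \<rightarrow>\<^sub>E Sym n. perm_delta (comp_prod (\<lambda>i. u i ^^ 2) k)) F"
    by (simp only: inner_sum_left)
  also have "(\<Sum>u\<in>{1..k} \<rightarrow>\<^sub>E Sym n. perm_delta (comp_prod (\<lambda>i. u i ^^ 2) k))
      = (\<Sum>p\<in>Sym n. perm_delta (p ^^ 2)) ^ k"
    using sum_comp_prod[of "Sym n" "{()}" "\<lambda>p _. p ^^ 2" n k] sq by (simp add: PiE_singleton card_PiE)
  also have "\<dots> = (\<Sum>T\<in>tableaux n. scalar (hooks T ^ k) * tab_idem T)"
    unfolding sum_squares_Sym by (rule sum_tab_idem_power[OF assms(2)])
  finally show "(1 / fact n) * (\<Sum>u\<in>{1..k} \<rightarrow>\<^sub>E Sym n. real q ^ num_cycles n (comp_prod (\<lambda>i. u i ^^ 2) k))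
    = (\<Sum>\<mu>\<in>partitions n. real (hook_product \<mu>) powi (int k - 2) *
        (\<Prod>t\<in>young_diagram \<mu>. real q + of_int (content t)))"
    using inner_central[of "\<lambda>h. h ^ k" n "real q"] powi by (simp add: F_def)
  have comm: "commutator p r \<in> Sym n" if "p \<in> Sym n" "r \<in> Sym n" for p r
    unfolding commutator_def using that by (intro Sym_comp Sym_inv)
  have "(\<Sum>u\<in>{1..g} \<rightarrow>\<^sub>E Sym n. \<Sum>v\<in>{1..g} \<rightarrow>\<^sub>E Sym n.
        real q ^ num_cycles n (comp_prod (\<lambda>i. commutator (u i) (v i)) g))
      = (\<Sum>u\<in>{1..g} \<rightarrow>\<^sub>E Sym n. \<Sum>v\<in>{1..g} \<rightarrow>\<^sub>E Sym n.
        inner (perm_delta (comp_prod (\<lambda>i. commutator (u i) (v i)) g)) F)"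
    unfolding F_def by (intro sum.cong refl sum_cycles_eq_inner comp_prod_Sym comm) (auto simp: PiE_def Pi_def)
  also have "\<dots> = inner (\<Sum>u\<in>{1..g} \<rightarrow>\<^sub>E Sym n. \<Sum>v\<in>{1..g} \<rightarrow>\<^sub>E Sym n.
        perm_delta (comp_prod (\<lambda>i. commutator (u i) (v i)) g)) F"
    by (simp only: inner_sum_left)
  also have "(\<Sum>u\<in>{1..g} \<rightarrow>\<^sub>E Sym n. \<Sum>v\<in>{1..g} \<rightarrow>\<^sub>E Sym n.
        perm_delta (comp_prod (\<lambda>i. commutator (u i) (v i)) g))
      = (\<Sum>p\<in>Sym n. \<Sum>r\<in>Sym n. perm_delta (commutator p r)) ^ g"
    by (rule sum_comp_prod[OF comm])
  also have "\<dots> = (\<Sum>T\<in>tableaux n. scalar (((hooks T)\<^sup>2) ^ g) * tab_idem T)"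
    unfolding sum_commutators_Sym by (rule sum_tab_idem_power[OF assms(3)])
  also have "\<dots> = (\<Sum>T\<in>tableaux n. scalar (hooks T ^ (2 * g)) * tab_idem T)"
    by (simp only: power_mult)
  finally show "(1 / fact n) * (\<Sum>u\<in>{1..g} \<rightarrow>\<^sub>E Sym n. \<Sum>v\<in>{1..g} \<rightarrow>\<^sub>E Sym n.
        real q ^ num_cycles n (comp_prod (\<lambda>i. commutator (u i) (v i)) g))
    = (\<Sum>\<mu>\<in>partitions n. real (hook_product \<mu>) powi (2 * int g - 2) *
        (\<Prod>t\<in>young_diagram \<mu>. real q + of_int (content t)))"
    using inner_central[of "\<lambda>h. h ^ (2 * g)" n "real q"] powi[of _ "2 * g"] by (simp add: F_def)
qed

end
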